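(* Let $\Omega$ be a non-empty open subset of $\ell^2$. Then there exists a positive exhaustion function $\Psi$ on $\Omega$ with $$\Psi\in C^\infty_{F^\infty}(\Omega)\cap C^\infty_{\ell^2}(\Omega)\cap C^\infty_{\mathscr F}(\Omega,loc).$$
   Context: $\ell^2$ is the real Hilbert space of square-summable sequences, $B_R$ the open ball of radius $R$ about $\mathbf 0$, $\mathbf e_i$ the unit vectors. Fix positive numbers $(a_i)_{i\ge1}$ with $\sum_ia_i<\infty$. Multi-indices $\alpha$ are finitely supported sequences of non-negative integers; $|\alpha|=\sum_i\alpha_i$, $\mathbf a^\alpha=\prod_ia_i^{\alpha_i}$, $D^\alpha f=\frac{\partial^{|\alpha|}f}{\partial x_1^{\alpha_1}\partial x_2^{\alpha_2}\cdots}$. $S\stackrel{\circ}{\subset}V$ means there are $r,R\in(0,\infty)$ with $\bigcup_{\mathbf z\in S}B(\mathbf z,r)\subset V$ and $S\subset B_R$. A real-valued function $\eta$ on $\Omega$ is an exhaustion function on $\Omega$ if $\{\mathbf z\in\Omega:\eta(\mathbf z)\le t\}\stackrel{\circ}{\subset}\Omega$ for all $t\in\mathbb{R}$. $C^k(\Omega)$: real functions that together with all partial derivatives up to order $k$ are continuous on $\Omega$ in the $\ell^2$ topology; $C^\infty(\Omega)=\bigcap_kC^k(\Omega)$. $C^1_F(\Omega)=\{f\in C^1(\Omega):\sup_E(|f|+\sum_i|\partial f/\partial x_i|^2)<\infty\ \forall E\stackrel{\circ}{\subset}\Omega\}$; $C^\infty_{F^\infty}(\Omega)=\{f\in C^\infty(\Omega):D^\alpha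 f\in C^1_F(\Omega)\ \forall\alpha\}$. $C^\infty_{\ell^2}(\Omega)$: infinitely Fréchet differentiable real functions on $\Omega$. $f$ is $\mathcal F$-continuous on $\Omega$ if for all $\mathbf x\in\Omega,n\in\mathbb{N}$, $(s_1,\dots,s_n)\mapsto f(\mathbf x+\sum_{j\le n}s_j\mathbf e_j)$ is continuous on the open set of $s\in\mathbb{R}^n$ where the argument lies in $\Omega$. $C^k_{\mathcal F}(\Omega)$: $\mathcal F$-continuous Borel functions whose partial derivatives of order up to $k$ exist and are $\mathcal F$-continuous and Borel. $C^{k,q}_{\mathscr F}(\Omega)=\{g\in C^k_{\mathcal F}(\Omega):\sup_\Omega\sum_{|\alpha|\le k}|\mathbf a^\alpha D^\alpha g|^q<\infty\}$; $C^{k,q}_{\mathscr F}(\Omega,loc)=\{f\in C^k_{\mathcal F}(\Omega):f|_V\in C^{k,q}_{\mathscr F}(V)\text{ for every non-empty open }V\stackrel{\circ}{\subset}\Omega\}$; $C^\infty_{\mathscr F}(\Omega,loc)=\bigcap_{k\in\mathbb{N},q\ge1}C^{k,q}_{\mathscr F}(\Omega,loc)$. *)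

theory Defs
  imports "HOL-Analysis.Analysis" "HOL-Library.Poly_Mapping"
begin

subsection \<open>The real Hilbert space of square-summable sequences\<close>

text \<open>Coordinates are indexed from 0 rather than from 1.\<close>

typedef ell2 = "{x :: nat \<Rightarrow> real. summable (\<lambda>i. (x i)\<^sup>2)}"
  morphisms coord Abs_ell2
  by (rule exI[of _ "\<lambda>_. 0"]) simp

setup_lifting type_definition_ell2

lemma summable_coord_sq: "summable (\<lambda>i. (coord x i)\<^sup>2)"
  using coord[of x] by simp

lemma ell2_eqI: "(\<And>i. coord x i = coord y i) \<Longrightarrow> x = y"
  by (simp add: coord_inject[symmetric] fun_eq_iff)

lemma summable_prod_of_sq:
  fixes x y :: "nat \<Rightarrow> real"
  assumes "summable (\<lambda>i. (x i)\<^sup>2)" "summable (\<lambda>i. (y i)\<^sup>2)"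
  shows "summable (\<lambda>i. x i * y i)"
proof (rule summable_comparison_test')
  show "summable (\<lambda>i. (x i)\<^sup>2 + (y i)\<^sup>2)"
    using assms by (rule summable_add)
  fix i :: nat
  have "0 \<le> (\<bar>x i\<bar> - \<bar>y i\<bar>)\<^sup>2"
    by simp
  then have "2 * (\<bar>x i\<bar> * \<bar>y i\<bar>) \<le> (x i)\<^sup>2 + (y i)\<^sup>2"
    by (simp add: power2_diff)
  moreover have "0 \<le> \<bar>x i\<bar> * \<bar>y i\<bar>"
    by simp
  ultimately show "norm (x i * y i) \<le> (x i)\<^sup>2 + (y i)\<^sup>2"
    unfolding real_norm_def abs_mult by linarith
qed

lemma summable_sq_add:
  fixes x y :: "nat \<Rightarrow> real"
  assumes "summable (\<lambda>i. (x i)\<^sup>2)" "summable (\<lambda>i. (y i)\<^sup>2)"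
  shows "summable (\<lambda>i. (x i + y i)\<^sup>2)"
proof -
  have "summable (\<lambda>i. (x i)\<^sup>2 + (y i)\<^sup>2 + 2 * (x i * y i))"
    using assms summable_prod_of_sq[OF assms] by (intro summable_add summable_mult)
  then show ?thesis
    by (simp add: power2_sum mult.assoc)
qed

instantiation ell2 :: real_vector
begin

lift_definition zero_ell2 :: ell2 is "\<lambda>_. 0"
  by simp

lift_definition plus_ell2 :: "ell2 \<Rightarrow> ell2 \<Rightarrow> ell2" is "\<lambda>x y i. x i + y i"
  by (rule summable_sq_add)

lift_definition uminus_ell2 :: "ell2 \<Rightarrow> ell2" is "\<lambda>x i. - x i"
  by simp

lift_definition minus_ell2 :: "ell2 \<Rightarrow> ell2 \<Rightarrow> ell2" is "\<lambda>x y i. x i - y i"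
  subgoal for x y using summable_sq_add[of x "\<lambda>i. - y i"] by simp
  done

lift_definition scaleR_ell2 :: "real \<Rightarrow> ell2 \<Rightarrow> ell2" is "\<lambda>c x i. c * x i"
  by (simp add: power_mult_distrib summable_mult)

instance
  by standard (transfer; auto simp: algebra_simps)+

end

instantiation ell2 :: real_inner
begin

lift_definition inner_ell2 :: "ell2 \<Rightarrow> ell2 \<Rightarrow> real" is "\<lambda>x y. suminf (\<lambda>i. x i * y i)" .

definition norm_ell2 :: "ell2 \<Rightarrow> real"
  where "norm_ell2 x = sqrt (inner x x)"

definition sgn_ell2 :: "ell2 \<Rightarrow> ell2"
  where "sgn_ell2 x = x /\<^sub>R norm x"

definition dist_ell2 :: "ell2 \<Rightarrow> ell2 \<Rightarrow> real"
  where "dist_ell2 x y = norm (x - y)"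

definition uniformity_ell2 :: "(ell2 \<times> ell2) filter"
  where "uniformity_ell2 = (INF e\<in>{0<..}. principal {(x, y). dist x y < e})"

definition open_ell2 :: "ell2 set \<Rightarrow> bool"
  where "open_ell2 U \<longleftrightarrow> (\<forall>x\<in>U. eventually (\<lambda>(x', y). x' = x \<longrightarrow> y \<in> U) uniformity)"

instance
proof
  fix x y z :: ell2 and r :: real
  show "dist x y = norm (x - y)"
    by (rule dist_ell2_def)
  show "sgn x = x /\<^sub>R norm x"
    by (rule sgn_ell2_def)
  show "uniformity = (INF e\<in>{0<..}. principal {(x, y). dist x y < (e::real)} :: (ell2 \<times> ell2) filter)"
    by (rule uniformity_ell2_def)
  show "open U \<longleftrightarrow> (\<forall>x\<in>U. \<forall>\<^sub>F (x', y) in uniformity. x' = x \<longrightarrow> y \<in> U)" for U :: "ell2 set"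
    by (rule open_ell2_def)
  show "inner x y = inner y x"
    by transfer (simp add: mult.commute)
  show "inner (x + y) z = inner x z + inner y z"
    by transfer (simp add: distrib_right suminf_add summable_prod_of_sq)
  show "inner (r *\<^sub>R x) y = r * inner x y"
    by transfer (simp add: mult.assoc suminf_mult summable_prod_of_sq)
  show "0 \<le> inner x x"
    by transfer (simp add: suminf_nonneg summable_prod_of_sq)
  show "inner x x = 0 \<longleftrightarrow> x = 0"
    by transfer (auto simp: suminf_eq_zero_iff summable_prod_of_sq fun_eq_iff)
  show "norm x = sqrt (inner x x)"
    by (rule norm_ell2_def)
qed

end

lemma norm_ell2_sq: "(norm x)\<^sup>2 = suminf (\<lambda>i. (coord x i)\<^sup>2)"
  unfolding power2_norm_eq_inner by transfer (simp add: power2_eq_square)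

lemma abs_coord_le_norm: "\<bar>coord x i\<bar> \<le> norm x"
proof -
  have "(coord x i)\<^sup>2 \<le> (norm x)\<^sup>2"
    using sum_le_suminf[OF summable_coord_sq, of "{i}" x] by (simp add: norm_ell2_sq)
  then show ?thesis
    by (simp add: abs_le_square_iff[symmetric])
qed

lemma coord_diff: "coord (x - y) i = coord x i - coord y i"
  by transfer simp

instance ell2 :: complete_space
proof
  fix X :: "nat \<Rightarrow> ell2"
  assume X: "Cauchy X"
  have "Cauchy (\<lambda>n. coord (X n) i)" for i
  proof (rule metric_CauchyI)
    fix e :: real
    assume "0 < e"
    then obtain M where "\<And>m n. m \<ge> M \<Longrightarrow> n \<ge> M \<Longrightarrow> dist (X m) (X n) < e"
      using metric_CauchyD[OF X] by blast
    then have "\<forall>m\<ge>M. \<forall>n\<ge>M. dist (coord (X m) i) (coord (X n) i) < e"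
      by (metis abs_coord_le_norm coord_diff dist_norm dist_real_def order_le_less_trans)
    then show "\<exists>M. \<forall>m\<ge>M. \<forall>n\<ge>M. dist (coord (X m) i) (coord (X n) i) < e" ..
  qed
  then have "convergent (\<lambda>n. coord (X n) i)" for i
    by (simp add: Cauchy_convergent_iff)
  then obtain l where l: "(\<lambda>n. coord (X n) i) \<longlonglongrightarrow> l i" for i
    unfolding convergent_def by metis
  have tail: "\<exists>M. \<forall>m\<ge>M. \<forall>k. (\<Sum>i<k. (coord (X m) i - l i)\<^sup>2) \<le> e\<^sup>2" if "0 < e" for e :: real
  proof -
    obtain M where M: "\<And>m n. m \<ge> M \<Longrightarrow> n \<ge> M \<Longrightarrow> dist (X m) (X n) < e"
      using metric_CauchyD[OF X \<open>0 < e\<close>] by blast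
    have "(\<Sum>i<k. (coord (X m) i - l i)\<^sup>2) \<le> e\<^sup>2" if "m \<ge> M" for m k
    proof (rule LIMSEQ_le_const2)
      show "(\<lambda>n. \<Sum>i<k. (coord (X m) i - coord (X n) i)\<^sup>2) \<longlonglongrightarrow> (\<Sum>i<k. (coord (X m) i - l i)\<^sup>2)"
        by (intro tendsto_intros l)
      have "(\<Sum>i<k. (coord (X m) i - coord (X n) i)\<^sup>2) \<le> e\<^sup>2" if "n \<ge> M" for n
      proof -
        have "(\<Sum>i<k. (coord (X m) i - coord (X n) i)\<^sup>2) \<le> (norm (X m - X n))\<^sup>2"
          using sum_le_suminf[OF summable_coord_sq, of "{..<k}" "X m - X n"]
          by (simp add: norm_ell2_sq coord_diff)
        also have "\<dots> \<le> e\<^sup>2"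
          using M[OF \<open>m \<ge> M\<close> \<open>n \<ge> M\<close>] by (simp add: dist_norm power_mono)
        finally show ?thesis .
      qed
      then show "\<exists>N. \<forall>n\<ge>N. (\<Sum>i<k. (coord (X m) i - coord (X n) i)\<^sup>2) \<le> e\<^sup>2"
        by blast
    qed
    then show ?thesis by blast
  qed
  obtain M where M: "\<And>k. (\<Sum>i<k. (coord (X M) i - l i)\<^sup>2) \<le> 1"
    using tail[of 1] by auto
  have "summable (\<lambda>i. (coord (X M) i - l i)\<^sup>2)"
    by (rule summableI_nonneg_bounded[of _ 1]) (use M in auto)
  then have "summable (\<lambda>i. (coord (X M) i + - (coord (X M) i - l i))\<^sup>2)"
    by (intro summable_sq_add summable_coord_sq) (simp add: power2_commute)
  then have l_sq: "summable (\<lambda>i. (l i)\<^sup>2)"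
    by simp
  define x where "x = Abs_ell2 l"
  have x: "coord x i = l i" for i
    using l_sq by (simp add: x_def Abs_ell2_inverse)
  have "X \<longlonglongrightarrow> x"
  proof (rule metric_LIMSEQ_I)
    fix e :: real
    assume "0 < e"
    then obtain N where N: "\<And>m k. m \<ge> N \<Longrightarrow> (\<Sum>i<k. (coord (X m) i - l i)\<^sup>2) \<le> (e / 2)\<^sup>2"
      using tail[of "e / 2"] by auto
    have "dist (X m) x < e" if "m \<ge> N" for m
    proof -
      have "(norm (X m - x))\<^sup>2 \<le> (e / 2)\<^sup>2"
        unfolding norm_ell2_sq
        by (rule suminf_le_const[OF summable_coord_sq]) (simp add: coord_diff x N[OF that])
      then have "norm (X m - x) \<le> e / 2"
        using \<open>0 < e\<close> by (simp add: abs_le_square_iff[symmetric])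
      then show ?thesis
        using \<open>0 < e\<close> by (simp add: dist_norm)
    qed
    then show "\<exists>no. \<forall>n\<ge>no. dist (X n) x < e"
      by blast
  qed
  then show "convergent X"
    by (rule convergentI)
qed

lift_definition unit_vec :: "nat \<Rightarrow> ell2" is "\<lambda>i j. if j = i then 1 else 0"
  subgoal for i by (rule summable_finite[of "{i}"]) auto
  done


subsection \<open>Sets that are bounded and uniformly inside, exhaustion functions\<close>

definition strictly_inside :: "ell2 set \<Rightarrow> ell2 set \<Rightarrow> bool"
  where "strictly_inside S V \<longleftrightarrow>
    (\<exists>r>0. \<exists>R>0. (\<Union>z\<in>S. ball z r) \<subseteq> V \<and> S \<subseteq> ball 0 R)"

definition exhaustion_function :: "ell2 set \<Rightarrow> (ell2 \<Rightarrow> real) \<Rightarrow> bool"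
  where "exhaustion_function \<Omega> \<eta> \<longleftrightarrow> (\<forall>t. strictly_inside {z \<in> \<Omega>. \<eta> z \<le> t} \<Omega>)"


subsection \<open>Partial derivatives\<close>

text \<open>
  Functions on an open set \<open>\<Omega>\<close> are represented by total functions; only their values
  on \<open>\<Omega>\<close> enter the definitions below.
\<close>

definition partial :: "nat \<Rightarrow> (ell2 \<Rightarrow> real) \<Rightarrow> ell2 \<Rightarrow> real"
  where "partial i f x = deriv (\<lambda>t. f (x + t *\<^sub>R unit_vec i)) 0"

definition partial_list :: "nat list \<Rightarrow> (ell2 \<Rightarrow> real) \<Rightarrow> ell2 \<Rightarrow> real"
  where "partial_list is f = foldr partial is f"

text \<open>
  All iterated partial derivatives up to order \<open>k\<close>, taken in any order, exist on \<open>\<Omega>\<close>.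
\<close>

definition partials_exist :: "nat \<Rightarrow> ell2 set \<Rightarrow> (ell2 \<Rightarrow> real) \<Rightarrow> bool"
  where "partials_exist k \<Omega> f \<longleftrightarrow>
    (\<forall>is i x. length is < k \<longrightarrow> x \<in> \<Omega> \<longrightarrow>
      (\<lambda>t. partial_list is f (x + t *\<^sub>R unit_vec i)) field_differentiable (at 0))"

type_synonym multi_index = "nat \<Rightarrow>\<^sub>0 nat"

definition degree_mi :: "multi_index \<Rightarrow> nat"
  where "degree_mi \<alpha> = (\<Sum>i\<in>Poly_Mapping.keys \<alpha>. Poly_Mapping.lookup \<alpha> i)"

definition power_mi :: "(nat \<Rightarrow> real) \<Rightarrow> multi_index \<Rightarrow> real"
  where "power_mi a \<alpha> = (\<Prod>i\<in>Poly_Mapping.keys \<alpha>. a i ^ Poly_Mapping.lookup \<alpha> i)"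

definition D_mi :: "multi_index \<Rightarrow> (ell2 \<Rightarrow> real) \<Rightarrow> ell2 \<Rightarrow> real"
  where "D_mi \<alpha> = partial_list
    (concat (map (\<lambda>i. replicate (Poly_Mapping.lookup \<alpha> i) i) (sorted_list_of_set (Poly_Mapping.keys \<alpha>))))"


subsection \<open>Functions continuous in the norm topology\<close>

definition C_k :: "nat \<Rightarrow> ell2 set \<Rightarrow> (ell2 \<Rightarrow> real) set"
  where "C_k k \<Omega> = {f. partials_exist k \<Omega> f \<and>
    (\<forall>is. length is \<le> k \<longrightarrow> continuous_on \<Omega> (partial_list is f))}"

definition C_infinity :: "ell2 set \<Rightarrow> (ell2 \<Rightarrow> real) set"
  where "C_infinity \<Omega> = (\<Inter>k. C_k k \<Omega>)"

definition C_1_F :: "ell2 set \<Rightarrow> (ell2 \<Rightarrow> real) set"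
  where "C_1_F \<Omega> = {f \<in> C_k 1 \<Omega>. \<forall>E. strictly_inside E \<Omega> \<longrightarrow>
    (SUP x\<in>E. ennreal \<bar>f x\<bar> + suminf (\<lambda>i. ennreal (\<bar>partial i f x\<bar>\<^sup>2))) < \<infinity>}"

definition C_infinity_F_infinity :: "ell2 set \<Rightarrow> (ell2 \<Rightarrow> real) set"
  where "C_infinity_F_infinity \<Omega> = {f \<in> C_infinity \<Omega>. \<forall>\<alpha>. D_mi \<alpha> f \<in> C_1_F \<Omega>}"


subsection \<open>Infinitely Frechet differentiable functions\<close>

text \<open>
  The \<open>k\<close>-th Frechet derivative at a point is an element of the space of bounded
  \<open>k\<close>-linear forms, normed by \<open>multilinear_norm k\<close>.  A \<open>k\<close>-linear form is represented
  by a function on lists, of which only the values on lists of length \<open>k\<close> matter.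
\<close>

definition multilinear_norm :: "nat \<Rightarrow> (ell2 list \<Rightarrow> real) \<Rightarrow> real"
  where "multilinear_norm k T =
    (SUP vs\<in>{vs. length vs = k \<and> (\<forall>v\<in>set vs. norm v \<le> 1)}. \<bar>T vs\<bar>)"

definition bounded_multilinear :: "nat \<Rightarrow> (ell2 list \<Rightarrow> real) \<Rightarrow> bool"
  where "bounded_multilinear k T \<longleftrightarrow>
    (\<forall>vs. length vs = k \<longrightarrow> (\<forall>i<k. linear (\<lambda>v. T (vs[i := v])))) \<and>
    (\<exists>K. \<forall>vs. length vs = k \<longrightarrow> \<bar>T vs\<bar> \<le> K * prod_list (map norm vs))"

text \<open>
  \<open>F k\<close> is the \<open>k\<close>-th derivative.  The derivative of \<open>F k\<close> at \<open>x\<close>, a bounded linear map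
  into the \<open>k\<close>-linear forms, is identified with the \<open>(k + 1)\<close>-linear form \<open>F (Suc k) x\<close>
  whose first argument is the increment \<open>h\<close>.
\<close>

definition C_infinity_ell2 :: "ell2 set \<Rightarrow> (ell2 \<Rightarrow> real) set"
  where "C_infinity_ell2 \<Omega> = {f. \<exists>F :: nat \<Rightarrow> ell2 \<Rightarrow> ell2 list \<Rightarrow> real.
    (\<forall>x\<in>\<Omega>. F 0 x [] = f x) \<and>
    (\<forall>k. \<forall>x\<in>\<Omega>. bounded_multilinear k (F k x) \<and>
      ((\<lambda>h. multilinear_norm k (\<lambda>vs. F k (x + h) vs - F k x vs - F (Suc k) x (h # vs)) / norm h)
        \<longlongrightarrow> 0) (at 0))}"


subsection \<open>Functions continuous along finite-dimensional slices\<close>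

text \<open>
  \<open>Euclidean_space n\<close> carries the real sequences vanishing from index \<open>n\<close> on.
\<close>

definition F_continuous :: "ell2 set \<Rightarrow> (ell2 \<Rightarrow> real) \<Rightarrow> bool"
  where "F_continuous \<Omega> f \<longleftrightarrow> (\<forall>x\<in>\<Omega>. \<forall>n.
    continuous_map
      (subtopology (Euclidean_space n) {s. x + (\<Sum>j<n. s j *\<^sub>R unit_vec j) \<in> \<Omega>})
      euclideanreal
      (\<lambda>s. f (x + (\<Sum>j<n. s j *\<^sub>R unit_vec j))))"

definition C_k_F :: "nat \<Rightarrow> ell2 set \<Rightarrow> (ell2 \<Rightarrow> real) set"
  where "C_k_F k \<Omega> = {f. partials_exist k \<Omega> f \<and>
    (\<forall>is. length is \<le> k \<longrightarrow>
      F_continuous \<Omega> (partial_list is f) \<and>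
      partial_list is f \<in> borel_measurable (restrict_space borel \<Omega>))}"

definition C_k_q_F :: "(nat \<Rightarrow> real) \<Rightarrow> nat \<Rightarrow> real \<Rightarrow> ell2 set \<Rightarrow> (ell2 \<Rightarrow> real) set"
  where "C_k_q_F a k q \<Omega> = {g \<in> C_k_F k \<Omega>.
    (SUP x\<in>\<Omega>. \<Sum>\<^sub>\<infinity>\<alpha>\<in>{\<alpha>. degree_mi \<alpha> \<le> k}.
      ennreal (\<bar>power_mi a \<alpha> * D_mi \<alpha> g x\<bar> powr q)) < \<infinity>}"

definition C_k_q_F_loc :: "(nat \<Rightarrow> real) \<Rightarrow> nat \<Rightarrow> real \<Rightarrow> ell2 set \<Rightarrow> (ell2 \<Rightarrow> real) set"
  where "C_k_q_F_loc a k q \<Omega> = {f \<in> C_k_F k \<Omega>.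
    \<forall>V. open V \<longrightarrow> V \<noteq> {} \<longrightarrow> strictly_inside V \<Omega> \<longrightarrow> f \<in> C_k_q_F a k q V}"

definition C_infinity_F_loc :: "(nat \<Rightarrow> real) \<Rightarrow> ell2 set \<Rightarrow> (ell2 \<Rightarrow> real) set"
  where "C_infinity_F_loc a \<Omega> = (\<Inter>k. \<Inter>q\<in>{1..}. C_k_q_F_loc a k q \<Omega>)"

end

theory Submission
  imports Defs "HOL-Computational_Algebra.Polynomial"
begin

text \<open>
  Let \<open>g\<close> be a bounded Lipschitz function on \<open>\<ell>\<^sup>2\<close>.  Averaging \<open>g\<close> in every coordinate \<open>i\<close> against a smooth
  kernel of width \<open>\<epsilon> i\<close> gives a function \<open>M g\<close> all of whose partial derivatives are bounded and Lipschitz,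
  and with \<open>(\<epsilon> i)\<^sup>2\<close> proportional to \<open>a i\<close> a Bessel-type inequality makes the weighted sums of partial
  derivatives finite.  But \<open>M g\<close> need not be Frechet differentiable.  This is repaired by Moulis's
  device: there is a smooth Lipschitz map \<open>P\<close>, uniformly close to the identity, whose range is locally
  finite-dimensional.  Then \<open>(M g) \<circ> P\<close> is Lipschitz and Frechet smooth, because locally only finitely many
  partial derivatives of \<open>M g\<close> are involved, and averaging once more, \<open>M ((M g) \<circ> P)\<close> has in addition the
  bounds on partial derivatives, while Frechet smoothness survives since the averaging is over a compact box.

  Let \<open>d x\<close> be the minimum of the distance of \<open>x\<close> to the complement of \<open>\<Omega>\<close> and of \<open>1 / (1 + norm x)\<close>; a
  subset of \<open>\<Omega>\<close> is strictly inside iff \<open>d\<close> is bounded below on it.  The construction, applied to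
  functions of \<open>d\<close>, yields \<open>h n \<ge> 0\<close> with \<open>h n = 1\<close> where \<open>d \<le> 2\<^sup>-\<^sup>n\<close> and \<open>h n = 0\<close> where
  \<open>d \<ge> 2 * 2\<^sup>-\<^sup>n\<close>.  The sum \<open>1 + (\<Sum>n. h n)\<close> is the exhaustion function.
\<close>

section \<open>A compactly supported smooth kernel\<close>

text \<open>Why two averagings. The available bounds on the derivatives of \<open>M g\<close> of
  order \<open>m\<close> in direction \<open>i\<close> grow like the power \<open>-m\<close> of
  \<open>\<epsilon> i\<close>, without bound in \<open>i\<close>, so they give no Taylor estimate in
  the norm. Composing with \<open>P\<close> cures this locally, but the bounds then depend on the
  number of surviving coordinates. The second averaging restores global bounds on partial
  derivatives, because these hold for averages of every bounded Lipschitz function. The boxes of the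
  second averaging are not small compared with the scale of \<open>P\<close>. Frechet smoothness
  survives because the sets on which only finitely many coordinates remain are described by tails,
  and the tails of a box tend to 0. All averages have a nonnegative kernel of mass one, and
  \<open>P\<close> moves points by a bounded distance; hence a function that is constant on a ball
  keeps exactly that value at the centre. This is why \<open>h n\<close> is exactly 0 or 1 where it
  should be, and why one finite number of terms serves a whole strictly inside set: global bounds on
  the terms become bounds on the set.\<close>

definition exp_poly :: "real poly \<Rightarrow> real \<Rightarrow> real"
  where "exp_poly p x = (if x > 0 then poly p (1 / x) * exp (- (1 / x)) else 0)"

lemma poly_times_exp_tendsto_0: "((\<lambda>y. poly p y * exp (- y)) \<longlongrightarrow> (0::real)) at_top"
proof -
  have "((\<lambda>y. \<Sum>i\<le>degree p. coeff p i * (y ^ i / exp y)) \<longlongrightarrow> (\<Sum>i\<le>degree p. coeff p i * (0::real))) at_top"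
    by (intro tendsto_intros tendsto_power_div_exp_0)
  then show ?thesis
    by (simp add: poly_altdef exp_minus sum_distrib_right divide_inverse mult.assoc)
qed

text \<open>Dividing by \<open>h\<close> multiplies the polynomial in \<open>1 / h\<close> by its
  variable, so the difference quotient at 0 is again of the form polynomial times exponential
  decay.\<close>

lemma exp_poly_tendsto_0: "((\<lambda>h. exp_poly p h / h) \<longlongrightarrow> 0) (at 0)"
proof -
  have "((\<lambda>y. poly (pCons 0 p) y * exp (- y)) \<longlongrightarrow> 0) at_top"
    by (rule poly_times_exp_tendsto_0)
  then have "((\<lambda>h. poly (pCons 0 p) (inverse h) * exp (- inverse h)) \<longlongrightarrow> 0) (at_right 0)"
    by (rule filterlim_compose[OF _ filterlim_inverse_at_top_right])
  moreover have "\<forall>\<^sub>F h in at_right 0. poly (pCons 0 p) (inverse h) * exp (- inverse h) = exp_poly p h / h"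
    using eventually_at_right_less[of "0::real"]
    by eventually_elim (simp add: exp_poly_def field_simps)
  ultimately have "((\<lambda>h. exp_poly p h / h) \<longlongrightarrow> 0) (at_right 0)"
    by (rule Lim_transform_eventually)
  moreover have "((\<lambda>h. exp_poly p h / h) \<longlongrightarrow> 0) (at_left 0)"
    by (rule Lim_transform_eventually[OF tendsto_const])
       (auto simp: eventually_at_filter exp_poly_def)
  ultimately show ?thesis
    by (simp add: filterlim_at_split)
qed

text \<open>With \<open>y = 1 / x\<close> the derivative of \<open>y\<close> is
  \<open>- y^2\<close>, so \<open>p(y) exp(-y)\<close> goes to
  \<open>y^2 (p - p')(y) exp(-y)\<close>. Closure of the family under differentiation handles all
  orders at once, including the gluing point 0.\<close>

lemma exp_poly_has_derivative:
  "(exp_poly p has_real_derivative exp_poly (monom 1 2 * (p - pderiv p)) x) (at x)"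
proof -
  consider "x > 0" | "x = 0" | "x < 0" by linarith
  then show ?thesis
  proof cases
    case 1
    have "((\<lambda>x. poly p (1 / x) * exp (- (1 / x))) has_real_derivative
        poly (pderiv p) (1 / x) * (- (1 / x^2)) * exp (- (1 / x)) + exp (- (1/x)) * (1 / x^2) * poly p (1 / x)) (at x)"
    proof (rule DERIV_mult)
      have A: "((\<lambda>x. 1 / x) has_real_derivative - (1 / x^2)) (at x)"
        using DERIV_inverse[of x UNIV] 1 by (simp add: inverse_eq_divide power2_eq_square)
      show "((\<lambda>x. poly p (1 / x)) has_real_derivative poly (pderiv p) (1 / x) * (- (1 / x^2))) (at x)"
        by (rule DERIV_chain2[OF poly_DERIV A])
      show "((\<lambda>x. exp (- (1 / x))) has_real_derivative exp (- (1 / x)) * (1 / x^2)) (at x)"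
        using DERIV_chain2[OF DERIV_exp DERIV_minus[OF A]] by simp
    qed
    moreover have "poly (pderiv p) (1 / x) * (- (1 / x^2)) * exp (- (1 / x)) + exp (- (1/x)) * (1 / x^2) * poly p (1 / x)
       = exp_poly (monom 1 2 * (p - pderiv p)) x"
      using 1 by (simp add: exp_poly_def poly_monom power_divide left_diff_distrib right_diff_distrib)
    ultimately have "((\<lambda>x. poly p (1 / x) * exp (- (1 / x))) has_real_derivative exp_poly (monom 1 2 * (p - pderiv p)) x) (at x)"
      by simp
    then show ?thesis
      by (rule has_field_derivative_transform_within_open[where S="{0<..}"])
         (use 1 in \<open>auto simp: exp_poly_def\<close>)
  next
    case 2
    then show ?thesis
      using exp_poly_tendsto_0[of p] by (simp add: DERIV_def exp_poly_def)
  next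
    case 3
    then have "exp_poly (monom 1 2 * (p - pderiv p)) x = 0" by (simp add: exp_poly_def)
    moreover have "(exp_poly p has_real_derivative 0) (at x)"
      by (rule has_field_derivative_transform_within_open[OF DERIV_const[of 0], where S="{..<0}"])
         (use 3 in \<open>auto simp: exp_poly_def\<close>)
    ultimately show ?thesis by simp
  qed
qed

lemma exp_poly_continuous: "continuous_on A (exp_poly p)"
  by (meson exp_poly_has_derivative DERIV_isCont continuous_at_imp_continuous_on)

lemma exp_poly_bounded: "\<exists>B. \<forall>x\<le>b. \<bar>exp_poly p x\<bar> \<le> B"
proof -
  have "bounded (exp_poly p ` {0..b})"
    by (intro compact_imp_bounded compact_continuous_image exp_poly_continuous compact_Icc)
  then obtain B where B: "\<forall>y\<in>exp_poly p ` {0..b}. norm y \<le> B"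
    unfolding bounded_iff by blast
  have "\<bar>exp_poly p x\<bar> \<le> max B 0" if "x \<le> b" for x
  proof (cases "x > 0")
    case True
    then have "norm (exp_poly p x) \<le> B" using B that by (intro bspec[OF B]) auto
    then show ?thesis by simp
  qed (simp add: exp_poly_def)
  then show ?thesis by blast
qed

text \<open>Squaring doubles the exponent: one copy of the exponential is split off, and the other
  still suppresses the squared polynomial. This is the source of
  \<open>bump_dominated\<close>.\<close>

lemma exp_poly_sq: "(exp_poly p x)\<^sup>2 = exp_poly 1 x * exp_poly (p * p) x"
  by (simp add: exp_poly_def power2_eq_square)

text \<open>Products supported in [-1, 1] together with their sums: the product rule keeps
  derivatives inside. Scalar factors and signs are absorbed by the polynomials.\<close>

inductive_set bump_class :: "(real \<Rightarrow> real) set" where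
  prod: "(\<lambda>s. exp_poly p (1 - s) * exp_poly q (1 + s)) \<in> bump_class"
| add: "f \<in> bump_class \<Longrightarrow> g \<in> bump_class \<Longrightarrow> (\<lambda>s. f s + g s) \<in> bump_class"

lemma bump_class_derivative:
  assumes "f \<in> bump_class"
  shows "\<exists>f'\<in>bump_class. \<forall>s. (f has_real_derivative f' s) (at s)"
  using assms
proof induction
  case (prod p q)
  let ?d = "\<lambda>p. monom 1 2 * (p - pderiv p)"
  let ?f' = "\<lambda>s. exp_poly (- ?d p) (1 - s) * exp_poly q (1 + s) + exp_poly p (1 - s) * exp_poly (?d q) (1 + s)"
  have "?f' \<in> bump_class"
    by (intro bump_class.intros)
  moreover have "((\<lambda>s. exp_poly p (1 - s) * exp_poly q (1 + s)) has_real_derivative ?f' s) (at s)" for s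
  proof -
    have a: "((\<lambda>s. exp_poly p (1 - s)) has_real_derivative exp_poly (?d p) (1 - s) * (-1)) (at s)"
      by (rule DERIV_chain2[OF exp_poly_has_derivative]) (auto intro!: derivative_eq_intros)
    have b: "((\<lambda>s. exp_poly q (1 + s)) has_real_derivative exp_poly (?d q) (1 + s) * 1) (at s)"
      by (rule DERIV_chain2[OF exp_poly_has_derivative]) (auto intro!: derivative_eq_intros)
    have m: "exp_poly (- p) x = - exp_poly p x" for p x
      by (simp add: exp_poly_def)
    show ?thesis
      using DERIV_mult[OF a b] unfolding m by (simp add: algebra_simps)
  qed
  ultimately show ?case by (intro bexI[of _ ?f']) auto
next
  case (add f g)
  then obtain f' g' where "f' \<in> bump_class" "g' \<in> bump_class"
    "\<forall>s. (f has_real_derivative f' s) (at s)" "\<forall>s. (g has_real_derivative g' s) (at s)"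
    by blast
  then show ?case
    by (intro bexI[of _ "\<lambda>s. f' s + g' s"]) (auto intro: bump_class.add DERIV_add)
qed

lemma bump_class_support:
  assumes "f \<in> bump_class" "\<bar>s\<bar> \<ge> 1"
  shows "f s = 0"
  using assms by induction (auto simp: exp_poly_def)

text \<open>By \<open>exp_poly_sq\<close> the square of a product is the basic bump times a function
  bounded on the support; for sums, \<open>(f + g)^2\<close> is at most
  \<open>2 f^2 + 2 g^2\<close>.\<close>

lemma bump_class_dominated:
  assumes "f \<in> bump_class"
  shows "\<exists>C>0. \<forall>s. (f s)\<^sup>2 \<le> C * (exp_poly 1 (1 - s) * exp_poly 1 (1 + s))"
  using assms
proof induction
  case (prod p q)
  obtain B1 B2 where B: "\<And>x. x \<le> 2 \<Longrightarrow> \<bar>exp_poly (p * p) x\<bar> \<le> B1" "\<And>x. x \<le> 2 \<Longrightarrow> \<bar>exp_poly (q * q) x\<bar> \<le> B2"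
    using exp_poly_bounded by metis
  let ?C = "\<bar>B1\<bar> * \<bar>B2\<bar> + 1"
  have "(exp_poly p (1 - s) * exp_poly q (1 + s))\<^sup>2 \<le> ?C * (exp_poly 1 (1 - s) * exp_poly 1 (1 + s))" for s
  proof (cases "\<bar>s\<bar> \<ge> 1")
    case True
    then show ?thesis by (auto simp: exp_poly_def)
  next
    case False
    have nn: "0 \<le> exp_poly 1 (1 - s) * exp_poly 1 (1 + s)"
      by (simp add: exp_poly_def)
    have nn2: "0 \<le> exp_poly (p * p) x" "0 \<le> exp_poly (q * q) x" for x
      by (simp_all add: exp_poly_def)
    have "exp_poly (p * p) (1 - s) * exp_poly (q * q) (1 + s) \<le> \<bar>B1\<bar> * \<bar>B2\<bar>"
    proof (intro mult_mono)
      show "exp_poly (p * p) (1 - s) \<le> \<bar>B1\<bar>" "exp_poly (q * q) (1 + s) \<le> \<bar>B2\<bar>"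
        using B(1)[of "1 - s"] B(2)[of "1 + s"] False by linarith+
    qed (use nn2 in auto)
    then have "(exp_poly 1 (1 - s) * exp_poly 1 (1 + s)) * (exp_poly (p * p) (1 - s) * exp_poly (q * q) (1 + s))
        \<le> (exp_poly 1 (1 - s) * exp_poly 1 (1 + s)) * ?C"
      using nn by (intro mult_left_mono) auto
    then show ?thesis
      by (simp add: power_mult_distrib exp_poly_sq mult_ac)
  qed
  moreover have "?C > 0" by (simp add: add_nonneg_pos)
  ultimately show ?case by blast
next
  case (add f g)
  then obtain C D where CD: "C > 0" "D > 0"
    "\<And>s. (f s)\<^sup>2 \<le> C * (exp_poly 1 (1 - s) * exp_poly 1 (1 + s))"
    "\<And>s. (g s)\<^sup>2 \<le> D * (exp_poly 1 (1 - s) * exp_poly 1 (1 + s))"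
    by blast
  have "(f s + g s)\<^sup>2 \<le> (2 * C + 2 * D) * (exp_poly 1 (1 - s) * exp_poly 1 (1 + s))" for s
  proof -
    have "(f s + g s)\<^sup>2 \<le> 2 * (f s)\<^sup>2 + 2 * (g s)\<^sup>2"
      using sum_squares_ge_zero[of "f s - g s" 0] by (simp add: power2_eq_square algebra_simps)
    also have "\<dots> \<le> 2 * (C * (exp_poly 1 (1 - s) * exp_poly 1 (1 + s))) + 2 * (D * (exp_poly 1 (1 - s) * exp_poly 1 (1 + s)))"
      using CD(3)[of s] CD(4)[of s] by linarith
    finally show ?thesis by (simp add: algebra_simps)
  qed
  then show ?case
    using CD by (intro exI[of _ "2 * C + 2 * D"]) auto
qed

lemma bump_class_deriv:
  assumes "f \<in> bump_class"
  shows "deriv f \<in> bump_class" "(f has_real_derivative deriv f s) (at s)"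
proof -
  obtain f' where f': "f' \<in> bump_class" "\<And>s. (f has_real_derivative f' s) (at s)"
    using bump_class_derivative[OF assms] by blast
  then have "deriv f = f'"
    by (auto simp: fun_eq_iff DERIV_imp_deriv)
  then show "deriv f \<in> bump_class" "(f has_real_derivative deriv f s) (at s)"
    using f' by auto
qed

lemma smooth_bump_exists:
  "\<exists>\<phi> :: nat \<Rightarrow> real \<Rightarrow> real.
    (\<forall>m s. (\<phi> m has_real_derivative \<phi> (Suc m) s) (at s)) \<and> (\<forall>s. 0 \<le> \<phi> 0 s) \<and>
    (\<forall>m s. 1 \<le> \<bar>s\<bar> \<longrightarrow> \<phi> m s = 0) \<and> integral {-1..1} (\<phi> 0) = 1 \<and>
    (\<forall>m. \<exists>C>0. \<forall>s. (\<phi> m s)\<^sup>2 \<le> C * \<phi> 0 s)"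
proof -
  let ?b = "\<lambda>s. exp_poly 1 (1 - s) * exp_poly 1 (1 + s)"
  define I where "I = integral {-1..1} ?b"
  have b_cont: "continuous_on A ?b" for A
    by (intro continuous_intros continuous_on_compose2[OF exp_poly_continuous[of UNIV]]) auto
  have b_nn: "0 \<le> ?b s" for s
    by (simp add: exp_poly_def)
  have "I \<noteq> 0"
  proof
    assume "I = 0"
    then have "\<forall>x\<in>{-1..1}. ?b x = 0"
      using integral_eq_0_iff[of "-1" 1 ?b] b_cont b_nn by (simp add: I_def)
    then have "?b 0 = 0" by (rule bspec) simp
    then show False by (simp add: exp_poly_def)
  qed
  moreover have "I \<ge> 0"
    unfolding I_def by (intro integral_nonneg integrable_continuous_interval b_cont) (use b_nn in auto)
  ultimately have I: "I > 0" by simp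
  \<comment> \<open>The normalising factor sits in a constant polynomial, so the kernel itself stays
    in \<open>bump_class\<close>.\<close>
  define \<phi>0 where "\<phi>0 = (\<lambda>s. exp_poly [:1 / I:] (1 - s) * exp_poly 1 (1 + s))"
  have \<phi>0: "\<phi>0 s = ?b s / I" for s
    by (simp add: \<phi>0_def exp_poly_def)
  have mem: "(deriv ^^ m) \<phi>0 \<in> bump_class" for m
    by (induction m) (auto simp: \<phi>0_def intro: bump_class.intros bump_class_deriv)
  have dom: "\<exists>C>0. \<forall>s. ((deriv ^^ m) \<phi>0 s)\<^sup>2 \<le> C * \<phi>0 s" for m
  proof -
    obtain C where C: "C > 0" "\<And>s. ((deriv ^^ m) \<phi>0 s)\<^sup>2 \<le> C * ?b s"
      using bump_class_dominated[OF mem] by blast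
    show ?thesis
      using C I by (intro exI[of _ "C * I"]) (simp add: \<phi>0)
  qed
  have "integral {-1..1} \<phi>0 = 1"
    using I integral_divide[of "{-1..1}" ?b I] by (simp add: \<phi>0[abs_def] I_def[symmetric])
  then show ?thesis
    using mem dom b_nn I
    by (intro exI[of _ "\<lambda>m. (deriv ^^ m) \<phi>0"])
       (auto simp: \<phi>0 intro: bump_class_deriv(2) bump_class_support)
qed

text \<open>
  \<open>bump m\<close> is the \<open>m\<close>-th derivative of \<open>bump 0\<close>.  That its square is dominated by \<open>bump 0\<close> itself
  is what the variance estimate \<open>conv_bessel\<close> needs; a generic bump function does not have this property.
\<close>

definition bump :: "nat \<Rightarrow> real \<Rightarrow> real"
  where "bump = (SOME \<phi>.
    (\<forall>m s. (\<phi> m has_real_derivative \<phi> (Suc m) s) (at s)) \<and> (\<forall>s. 0 \<le> \<phi> 0 s) \<and>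
    (\<forall>m s. 1 \<le> \<bar>s\<bar> \<longrightarrow> \<phi> m s = 0) \<and> integral {-1..1} (\<phi> 0) = 1 \<and>
    (\<forall>m. \<exists>C>0. \<forall>s. (\<phi> m s)\<^sup>2 \<le> C * \<phi> 0 s))"

lemma bump_has_derivative: "(bump m has_real_derivative bump (Suc m) s) (at s)"
  and bump_nonneg: "0 \<le> bump 0 s"
  and bump_support: "1 \<le> \<bar>s\<bar> \<Longrightarrow> bump m s = 0"
  and bump_integral: "integral {-1..1} (bump 0) = 1"
  and bump_dominated: "\<exists>C>0. \<forall>s. (bump m s)\<^sup>2 \<le> C * bump 0 s"
  using someI_ex[OF smooth_bump_exists, folded bump_def] by auto

lemma bump_continuous: "continuous_on A (bump m)"
  by (meson bump_has_derivative DERIV_isCont continuous_at_imp_continuous_on)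

lemma bump_integral_derivative: "integral {-1..1} (bump (Suc m)) = 0"
proof -
  have "(bump (Suc m) has_integral bump m 1 - bump m (-1)) {-1..1}"
    by (intro fundamental_theorem_of_calculus)
       (auto intro!: bump_has_derivative has_field_derivative_at_within
         simp: has_real_derivative_iff_has_vector_derivative[symmetric])
  then show ?thesis
    by (simp add: bump_support integral_unique)
qed

section \<open>Uniformly smooth families of functions\<close>

definition has_dir_deriv :: "('a::real_normed_vector \<Rightarrow> real) \<Rightarrow> 'a \<Rightarrow> 'a \<Rightarrow> real \<Rightarrow> bool"
  where "has_dir_deriv f v x d \<longleftrightarrow> ((\<lambda>t. f (x + t *\<^sub>R v)) has_real_derivative d) (at 0)"

definition dir_deriv :: "'a::real_normed_vector \<Rightarrow> ('a \<Rightarrow> real) \<Rightarrow> 'a \<Rightarrow> real"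
  where "dir_deriv v f x = deriv (\<lambda>t. f (x + t *\<^sub>R v)) 0"

abbreviation dir_derivs :: "'a::real_normed_vector list \<Rightarrow> ('a \<Rightarrow> real) \<Rightarrow> 'a \<Rightarrow> real"
  where "dir_derivs \<equiv> foldr dir_deriv"

lemma dir_deriv_eqI: "has_dir_deriv f v x d \<Longrightarrow> dir_deriv v f x = d"
  by (simp add: has_dir_deriv_def dir_deriv_def DERIV_imp_deriv)

lemma has_dir_deriv_dir_deriv: "has_dir_deriv f v x d \<Longrightarrow> has_dir_deriv f v x (dir_deriv v f x)"
  by (simp add: dir_deriv_eqI)

lemma eventually_line_in_open:
  fixes x v :: "'a::real_normed_vector"
  assumes "open U" "x + s *\<^sub>R v \<in> U"
  shows "\<forall>\<^sub>F t in nhds s. x + t *\<^sub>R v \<in> U"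
proof -
  have "filterlim (\<lambda>t. x + t *\<^sub>R v) (nhds (x + s *\<^sub>R v)) (nhds s)"
    by (intro tendsto_intros filterlim_ident)
  moreover have "\<forall>\<^sub>F y in nhds (x + s *\<^sub>R v). y \<in> U"
    using assms by (simp add: eventually_nhds_in_open)
  ultimately show ?thesis
    by (rule eventually_compose_filterlim[rotated])
qed

lemma has_dir_deriv_cong:
  assumes "open U" "x \<in> U" "\<And>y. y \<in> U \<Longrightarrow> f y = g y"
  shows "has_dir_deriv f v x d \<longleftrightarrow> has_dir_deriv g v x d"
  unfolding has_dir_deriv_def
proof (rule DERIV_cong_ev[OF refl _ refl])
  show "\<forall>\<^sub>F t in nhds 0. f (x + t *\<^sub>R v) = g (x + t *\<^sub>R v)"
    using eventually_line_in_open[OF assms(1), of x 0 v] assms(2)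
    by (auto elim!: eventually_mono intro: assms(3))
qed

lemma dir_deriv_cong:
  assumes "open U" "x \<in> U" "\<And>y. y \<in> U \<Longrightarrow> f y = g y"
  shows "dir_deriv v f x = dir_deriv v g x"
proof -
  have "has_dir_deriv f v x d = has_dir_deriv g v x d" for d
    using assms by (rule has_dir_deriv_cong)
  then show ?thesis
    by (simp add: dir_deriv_def deriv_def has_dir_deriv_def)
qed

lemma has_dir_deriv_line:
  "has_dir_deriv f v (x + s *\<^sub>R v) d \<longleftrightarrow> ((\<lambda>t. f (x + t *\<^sub>R v)) has_real_derivative d) (at s)"
  unfolding has_dir_deriv_def
  using DERIV_shift[of "\<lambda>t. f (x + t *\<^sub>R v)" d 0 s]
  by (simp add: scaleR_left_distrib add.commute[of _ s] add.assoc)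

lemma has_dir_deriv_const: "has_dir_deriv (\<lambda>_. c) v x 0"
  by (simp add: has_dir_deriv_def)

lemma has_dir_deriv_add:
  "has_dir_deriv f v x d \<Longrightarrow> has_dir_deriv g v x e \<Longrightarrow> has_dir_deriv (\<lambda>x. f x + g x) v x (d + e)"
  unfolding has_dir_deriv_def by (rule DERIV_add)

lemma has_dir_deriv_mult:
  "has_dir_deriv f v x d \<Longrightarrow> has_dir_deriv g v x e \<Longrightarrow> has_dir_deriv (\<lambda>x. f x * g x) v x (d * g x + f x * e)"
  unfolding has_dir_deriv_def by (drule (1) DERIV_mult) (simp add: add.commute mult.commute)

lemma has_dir_deriv_cmult: "has_dir_deriv f v x d \<Longrightarrow> has_dir_deriv (\<lambda>x. c * f x) v x (c * d)"
  unfolding has_dir_deriv_def by (rule DERIV_cmult)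

lemma has_dir_deriv_comp:
  assumes "(\<theta> has_real_derivative e) (at (f x))" "has_dir_deriv f v x d"
  shows "has_dir_deriv (\<lambda>x. \<theta> (f x)) v x (e * d)"
  using DERIV_chain2[of \<theta> e "\<lambda>t. f (x + t *\<^sub>R v)" 0 d UNIV] assms
  by (simp add: has_dir_deriv_def)

lemma has_dir_deriv_scale:
  assumes "has_dir_deriv f v x d"
  shows "has_dir_deriv f (c *\<^sub>R v) x (c * d)"
proof -
  have "((\<lambda>t. f (x + (t * c) *\<^sub>R v)) has_real_derivative d * c) (at 0)"
    by (rule DERIV_chain2[of "\<lambda>t. f (x + t *\<^sub>R v)"])
       (use assms in \<open>auto simp: has_dir_deriv_def intro!: derivative_eq_intros\<close>)
  then show ?thesis
    by (simp add: has_dir_deriv_def mult_ac)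
qed

lemma has_dir_deriv_linear:
  assumes "linear f"
  shows "has_dir_deriv f v x (f v)"
  unfolding has_dir_deriv_def
  by (auto simp: linear_add[OF assms] linear_scale[OF assms] intro!: derivative_eq_intros)

lemma dir_deriv_lipschitz:
  fixes f :: "'a::real_normed_vector \<Rightarrow> real"
  assumes "closed_segment x y \<subseteq> U"
    and "\<And>z. z \<in> U \<Longrightarrow> has_dir_deriv f (y - x) z (d z)" "\<And>z. z \<in> U \<Longrightarrow> \<bar>d z\<bar> \<le> K"
  shows "\<bar>f y - f x\<bar> \<le> K"
proof -
  let ?p = "\<lambda>t. x + t *\<^sub>R (y - x)"
  have in_U: "?p t \<in> U" if "0 \<le> t" "t \<le> 1" for t
  proof -
    have "?p t = (1 - t) *\<^sub>R x + t *\<^sub>R y"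
      by (simp add: algebra_simps)
    then show ?thesis
      using assms(1) that by (auto simp: closed_segment_def)
  qed
  obtain t where t: "0 < t" "t < 1" "f (?p 1) - f (?p 0) = (1 - 0) * d (?p t)"
    using MVT2[of 0 1 "\<lambda>t. f (?p t)" "\<lambda>t. d (?p t)"] assms(2)[OF in_U]
    by (auto simp: has_dir_deriv_line)
  then show ?thesis
    using assms(3)[OF in_U[of t]] by simp
qed

text \<open>Two applications of the mean value theorem on the segment. The direction
  \<open>h\<close> is not normalised, so in applications \<open>K\<close> carries the factor
  \<open>norm h\<close> squared.\<close>

lemma dir_deriv_taylor:
  fixes f :: "'a::real_normed_vector \<Rightarrow> real"
  assumes seg: "closed_segment x (x + h) \<subseteq> U"
    and d: "\<And>z. z \<in> U \<Longrightarrow> has_dir_deriv f h z (d z)" "\<And>z. z \<in> U \<Longrightarrow> has_dir_deriv d h z (e z)"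
    and K: "\<And>z. z \<in> U \<Longrightarrow> \<bar>e z\<bar> \<le> K"
  shows "\<bar>f (x + h) - f x - d x\<bar> \<le> K"
proof -
  let ?p = "\<lambda>t. x + t *\<^sub>R h"
  have in_U: "?p t \<in> U" if "0 \<le> t" "t \<le> 1" for t
  proof -
    have "?p t = (1 - t) *\<^sub>R x + t *\<^sub>R (x + h)"
      by (simp add: algebra_simps)
    then show ?thesis
      using seg that by (auto simp: closed_segment_def)
  qed
  obtain t where t: "0 < t" "t < 1" "f (?p 1) - f (?p 0) = (1 - 0) * d (?p t)"
    using MVT2[of 0 1 "\<lambda>t. f (?p t)" "\<lambda>t. d (?p t)"] d(1)[OF in_U]
    by (auto simp: has_dir_deriv_line)
  obtain s where s: "0 < s" "s < t" "d (?p t) - d (?p 0) = (t - 0) * e (?p s)"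
    using MVT2[of 0 t "\<lambda>t. d (?p t)" "\<lambda>t. e (?p t)"] d(2)[OF in_U] t(1,2)
    by (auto simp: has_dir_deriv_line)
  have "\<bar>t * e (?p s)\<bar> \<le> 1 * K"
    unfolding abs_mult using t s K[OF in_U[of s]] by (intro mult_mono) auto
  then show ?thesis
    using s(3) t(3) by simp
qed

section \<open>Closure properties of families with uniformly bounded derivatives\<close>

abbreviation unit_dir_derivs :: "('a::real_normed_vector \<Rightarrow> real) set \<Rightarrow> ('a \<Rightarrow> real) set"
  where "unit_dir_derivs F \<equiv> {dir_deriv v f | v f. norm v \<le> 1 \<and> f \<in> F}"

abbreviation sum_family :: "('a \<Rightarrow> real) set \<Rightarrow> ('a \<Rightarrow> real) set \<Rightarrow> ('a \<Rightarrow> real) set"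
  where "sum_family F G \<equiv> {\<lambda>x. f x + g x | f g. f \<in> F \<and> g \<in> G}"

abbreviation prod_family :: "('a \<Rightarrow> real) set \<Rightarrow> ('a \<Rightarrow> real) set \<Rightarrow> ('a \<Rightarrow> real) set"
  where "prod_family F G \<equiv> {\<lambda>x. f x * g x | f g. f \<in> F \<and> g \<in> G}"

text \<open>
  Families, instead of single functions, absorb the unit vectors of the iterated directional derivatives,
  so that the closure properties become plain inductions on \<open>k\<close>.
\<close>

primrec unif_smooth :: "nat \<Rightarrow> 'a::real_normed_vector set \<Rightarrow> ('a \<Rightarrow> real) set \<Rightarrow> bool" where
  "unif_smooth 0 U F \<longleftrightarrow> (\<exists>M. \<forall>f\<in>F. \<forall>x\<in>U. \<bar>f x\<bar> \<le> M)"
| "unif_smooth (Suc k) U F \<longleftrightarrow> (\<exists>M. \<forall>f\<in>F. \<forall>x\<in>U. \<bar>f x\<bar> \<le> M) \<and>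
    (\<forall>f\<in>F. \<forall>x\<in>U. \<forall>v. \<exists>d. has_dir_deriv f v x d) \<and> unif_smooth k U (unit_dir_derivs F)"

lemma unif_smooth_bounded: "unif_smooth k U F \<Longrightarrow> \<exists>M. \<forall>f\<in>F. \<forall>x\<in>U. \<bar>f x\<bar> \<le> M"
  by (cases k) auto

lemma unif_smooth_dir_deriv:
  "unif_smooth (Suc k) U F \<Longrightarrow> f \<in> F \<Longrightarrow> x \<in> U \<Longrightarrow> has_dir_deriv f v x (dir_deriv v f x)"
  by (metis has_dir_deriv_dir_deriv unif_smooth.simps(2))

lemma unif_smooth_unit_dir_derivs: "unif_smooth (Suc k) U F \<Longrightarrow> unif_smooth k U (unit_dir_derivs F)"
  by (simp only: unif_smooth.simps)

lemma unif_smooth_SucD: "unif_smooth (Suc k) U F \<Longrightarrow> unif_smooth k U F"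
proof (induction k arbitrary: F)
  case (Suc k)
  then show ?case
    by (simp only: unif_smooth.simps(2)) blast
qed auto

text \<open>On an open set a directional derivative depends only on nearby values, so agreement on
  \<open>U\<close> passes to the families of unit derivatives and the induction goes
  through.\<close>

lemma unif_smooth_cong:
  assumes "open U" "unif_smooth k U F" "\<And>g. g \<in> G \<Longrightarrow> \<exists>f\<in>F. \<forall>x\<in>U. g x = f x"
  shows "unif_smooth k U G"
  using assms(2,3)
proof (induction k arbitrary: F G)
  case 0
  then show ?case by (metis unif_smooth.simps(1))
next
  case (Suc k)
  have "\<exists>M. \<forall>f\<in>G. \<forall>x\<in>U. \<bar>f x\<bar> \<le> M"
    using Suc.prems by (metis unif_smooth_bounded)
  moreover have "\<exists>d. has_dir_deriv g v x d" if gG: "g \<in> G" and "x \<in> U" for g x v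
  proof -
    obtain f where f: "f \<in> F" "\<forall>x\<in>U. g x = f x"
      using Suc.prems(2)[OF gG] by blast
    then show ?thesis
      using unif_smooth_dir_deriv[OF Suc.prems(1), of f x v] \<open>x \<in> U\<close>
        has_dir_deriv_cong[OF assms(1) \<open>x \<in> U\<close>, of g f v] by auto
  qed
  moreover have "unif_smooth k U (unit_dir_derivs G)"
  proof (rule Suc.IH)
    show "unif_smooth k U (unit_dir_derivs F)"
      by (rule unif_smooth_unit_dir_derivs[OF Suc.prems(1)])
    fix g' assume "g' \<in> unit_dir_derivs G"
    then obtain v g where g: "g' = dir_deriv v g" "norm v \<le> 1" "g \<in> G"
      by blast
    then obtain f where f: "f \<in> F" "\<forall>x\<in>U. g x = f x"
      using Suc.prems(2)[OF g(3)] by blast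
    then have "\<forall>x\<in>U. g' x = dir_deriv v f x"
      using dir_deriv_cong[OF assms(1)] g(1) by blast
    then show "\<exists>f\<in>unit_dir_derivs F. \<forall>x\<in>U. g' x = f x"
      using f(1) g(2) by blast
  qed
  ultimately show ?case by simp
qed

lemma unif_smooth_subset: "unif_smooth k U F \<Longrightarrow> G \<subseteq> F \<Longrightarrow> open U \<Longrightarrow> unif_smooth k U G"
  by (rule unif_smooth_cong) auto

text \<open>Instead of computing the family of unit derivatives it suffices to place it inside some
  family already known to be smooth to order \<open>k\<close>. Each closure rule below is an
  induction through this one.\<close>

lemma unif_smooth_SucI:
  assumes "open U" "unif_smooth k U F" "unif_smooth k U G"
    and deriv: "\<And>f. f \<in> F \<Longrightarrow> \<exists>E. (\<forall>v. \<forall>x\<in>U. has_dir_deriv f v x (E v x)) \<and> (\<forall>v. norm v \<le> 1 \<longrightarrow> E v \<in> G)"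
  shows "unif_smooth (Suc k) U F"
proof -
  have "unif_smooth k U (unit_dir_derivs F)"
  proof (rule unif_smooth_cong[OF assms(1,3)])
    fix g assume "g \<in> unit_dir_derivs F"
    then obtain v f where g: "g = dir_deriv v f" "norm v \<le> 1" "f \<in> F"
      by blast
    then obtain E where "\<forall>x\<in>U. has_dir_deriv f v x (E v x)" "E v \<in> G"
      using deriv by blast
    then show "\<exists>e\<in>G. \<forall>x\<in>U. g x = e x"
      using g(1) dir_deriv_eqI by blast
  qed
  moreover have "\<forall>f\<in>F. \<forall>x\<in>U. \<forall>v. \<exists>d. has_dir_deriv f v x d"
    using deriv by blast
  ultimately show ?thesis
    using unif_smooth_bounded[OF assms(2)] by (simp only: unif_smooth.simps)
qed

lemma unif_smooth_Un: "unif_smooth k U F \<Longrightarrow> unif_smooth k U G \<Longrightarrow> unif_smooth k U (F \<union> G)"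
proof (induction k arbitrary: F G)
  case 0
  then obtain M N where "\<forall>f\<in>F. \<forall>x\<in>U. \<bar>f x\<bar> \<le> M" "\<forall>f\<in>G. \<forall>x\<in>U. \<bar>f x\<bar> \<le> N"
    by auto
  then show ?case
    by (auto intro!: exI[of _ "max M N"] simp: le_max_iff_disj)
next
  case (Suc k)
  have "\<exists>M. \<forall>f\<in>F \<union> G. \<forall>x\<in>U. \<bar>f x\<bar> \<le> M"
    by (rule unif_smooth_bounded[OF Suc.IH[OF Suc.prems[THEN unif_smooth_SucD]]])
  moreover have "unif_smooth k U (unit_dir_derivs F \<union> unit_dir_derivs G)"
    by (rule Suc.IH[OF Suc.prems[THEN unif_smooth_unit_dir_derivs]])
  moreover have "unit_dir_derivs F \<union> unit_dir_derivs G = unit_dir_derivs (F \<union> G)"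
    by blast
  ultimately show ?case
    using Suc.prems by auto
qed

lemma unif_smooth_finite_UN:
  assumes "finite I" "\<And>i. i \<in> I \<Longrightarrow> unif_smooth k U (F i)"
  shows "unif_smooth k U (\<Union>i\<in>I. F i)"
  using assms
proof (induction rule: finite_induct)
  case empty
  then show ?case by (induction k) auto
qed (simp add: unif_smooth_Un)

lemma sum_memI: "f \<in> F \<Longrightarrow> g \<in> G \<Longrightarrow> (\<lambda>x. f x + g x) \<in> sum_family F G"
  by blast

lemma prod_memI: "f \<in> F \<Longrightarrow> g \<in> G \<Longrightarrow> (\<lambda>x. f x * g x) \<in> prod_family F G"
  by blast

lemma unif_smooth_add:
  assumes "open U"
  shows "unif_smooth k U F \<Longrightarrow> unif_smooth k U G \<Longrightarrow> unif_smooth k U (sum_family F G)"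
proof (induction k arbitrary: F G)
  case 0
  then obtain M N where "\<forall>f\<in>F. \<forall>x\<in>U. \<bar>f x\<bar> \<le> M" "\<forall>f\<in>G. \<forall>x\<in>U. \<bar>f x\<bar> \<le> N"
    by auto
  then have "\<bar>f x + g x\<bar> \<le> M + N" if "f \<in> F" "g \<in> G" "x \<in> U" for f g x
    using that abs_triangle_ineq[of "f x" "g x"] by fastforce
  then show ?case
    by auto
next
  case (Suc k)
  show ?case
  proof (rule unif_smooth_SucI[OF assms Suc.IH[OF Suc.prems[THEN unif_smooth_SucD]]
        Suc.IH[OF Suc.prems[THEN unif_smooth_unit_dir_derivs]]])
    fix h assume "h \<in> sum_family F G"
    then obtain f g where h: "h = (\<lambda>x. f x + g x)" "f \<in> F" "g \<in> G"
      by blast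
    have "has_dir_deriv h v x (dir_deriv v f x + dir_deriv v g x)" if "x \<in> U" for v x
      unfolding h(1) by (intro has_dir_deriv_add Suc.prems[THEN unif_smooth_dir_deriv] h that)
    moreover have "(\<lambda>x. dir_deriv v f x + dir_deriv v g x) \<in> sum_family (unit_dir_derivs F) (unit_dir_derivs G)"
      if "norm v \<le> 1" for v
      using h that by (intro sum_memI) blast+
    ultimately show "\<exists>E. (\<forall>v. \<forall>x\<in>U. has_dir_deriv h v x (E v x)) \<and>
        (\<forall>v. norm v \<le> 1 \<longrightarrow> E v \<in> sum_family (unit_dir_derivs F) (unit_dir_derivs G))"
      by (intro exI[of _ "\<lambda>v x. dir_deriv v f x + dir_deriv v g x"]) simp
  qed
qed

lemma unif_smooth_mult:
  assumes "open U"
  shows "unif_smooth k U F \<Longrightarrow> unif_smooth k U G \<Longrightarrow> unif_smooth k U (prod_family F G)"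
proof (induction k arbitrary: F G)
  case 0
  then obtain M N where MN: "\<forall>f\<in>F. \<forall>x\<in>U. \<bar>f x\<bar> \<le> M" "\<forall>f\<in>G. \<forall>x\<in>U. \<bar>f x\<bar> \<le> N"
    by auto
  have "\<bar>f x * g x\<bar> \<le> \<bar>M\<bar> * \<bar>N\<bar>" if "f \<in> F" "g \<in> G" "x \<in> U" for f g x
    unfolding abs_mult using MN that by (intro mult_mono) (force intro: order_trans[OF _ abs_ge_self])+
  then show ?case
    by (auto intro!: exI[of _ "\<bar>M\<bar> * \<bar>N\<bar>"])
next
  case (Suc k)
  let ?P = "prod_family (unit_dir_derivs F) G" and ?Q = "prod_family F (unit_dir_derivs G)"
  have D: "unif_smooth k U (sum_family ?P ?Q)"
    by (intro unif_smooth_add[OF assms] Suc.IH unif_smooth_unit_dir_derivs Suc.prems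
        Suc.prems[THEN unif_smooth_SucD])
  show ?case
  proof (rule unif_smooth_SucI[OF assms Suc.IH[OF Suc.prems[THEN unif_smooth_SucD]] D])
    fix h assume "h \<in> prod_family F G"
    then obtain f g where h: "h = (\<lambda>x. f x * g x)" "f \<in> F" "g \<in> G"
      by blast
    have "has_dir_deriv h v x (dir_deriv v f x * g x + f x * dir_deriv v g x)" if "x \<in> U" for v x
      unfolding h(1) by (intro has_dir_deriv_mult Suc.prems[THEN unif_smooth_dir_deriv] h that)
    moreover have "(\<lambda>x. dir_deriv v f x * g x + f x * dir_deriv v g x) \<in> sum_family ?P ?Q"
      if "norm v \<le> 1" for v
    proof (rule sum_memI)
      show "(\<lambda>x. dir_deriv v f x * g x) \<in> ?P" "(\<lambda>x. f x * dir_deriv v g x) \<in> ?Q"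
        using h(2,3) that by blast+
    qed
    ultimately show "\<exists>E. (\<forall>v. \<forall>x\<in>U. has_dir_deriv h v x (E v x)) \<and>
        (\<forall>v. norm v \<le> 1 \<longrightarrow> E v \<in> sum_family ?P ?Q)"
      by (intro exI[of _ "\<lambda>v x. dir_deriv v f x * g x + f x * dir_deriv v g x"] conjI allI ballI impI)
  qed
qed

lemma unif_smooth_const:
  assumes "open U"
  shows "unif_smooth k U {\<lambda>_. c | c. \<bar>c\<bar> \<le> C}"
proof (induction k arbitrary: C)
  case (Suc k)
  show ?case
  proof (rule unif_smooth_SucI[OF assms Suc Suc[of 0]])
    fix f :: "'a \<Rightarrow> real" assume "f \<in> {\<lambda>_. c | c. \<bar>c\<bar> \<le> C}"
    then show "\<exists>E. (\<forall>v. \<forall>x\<in>U. has_dir_deriv f v x (E v x)) \<and> (\<forall>v. norm v \<le> 1 \<longrightarrow> E v \<in> {\<lambda>_. c | c. \<bar>c\<bar> \<le> 0})"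
      by (intro exI[of _ "\<lambda>_ _. 0"]) (auto intro: has_dir_deriv_const)
  qed
qed auto

lemma unif_smooth_sum:
  assumes "open U" "unif_smooth k U F"
  shows "unif_smooth k U {\<lambda>x. \<Sum>i<(n::nat). f i x | f. \<forall>i<n. f i \<in> F}"
proof (induction n)
  case 0
  show ?case
    by (rule unif_smooth_subset[OF unif_smooth_const[OF assms(1), where C = 0]]) (use assms in auto)
next
  case (Suc n)
  show ?case
  proof (rule unif_smooth_subset[OF unif_smooth_add[OF assms(1) Suc assms(2)] _ assms(1)], safe)
    fix f assume "\<forall>i<Suc n. f i \<in> F"
    then show "\<exists>h g. (\<lambda>x. \<Sum>i<Suc n. f i x) = (\<lambda>x. h x + g x) \<and>
        h \<in> {\<lambda>x. \<Sum>i<n. f i x | f. \<forall>i<n. f i \<in> F} \<and> g \<in> F"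
      by (intro exI[of _ "\<lambda>x. \<Sum>i<n. f i x"] exI[of _ "f n"]) auto
  qed
qed

text \<open>Differentiating raises the index of the outer function by one, so the induction runs
  over the families with outer functions up to index \<open>j\<close>, for all \<open>j\<close>
  simultaneously.\<close>

lemma unif_smooth_comp:
  fixes \<theta> :: "nat \<Rightarrow> real \<Rightarrow> real"
  assumes "open U" and \<theta>: "\<And>m s. (\<theta> m has_real_derivative \<theta> (Suc m) s) (at s)" "\<And>m s. \<bar>\<theta> m s\<bar> \<le> B m"
  shows "unif_smooth k U F \<Longrightarrow> unif_smooth k U {\<lambda>x. \<theta> m (f x) | m f. m \<le> j \<and> f \<in> F}"
proof (induction k arbitrary: j)
  case 0
  have "\<bar>\<theta> m s\<bar> \<le> Max (B ` {..j})" if "m \<le> j" for m s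
    using that \<theta>(2)[of m s] by (intro order_trans[OF _ Max_ge]) auto
  then show ?case by auto
next
  case (Suc k)
  let ?T = "\<lambda>j. {\<lambda>x. \<theta> m (f x) | m f. m \<le> j \<and> f \<in> F}"
  note IH = Suc.IH[OF unif_smooth_SucD[OF Suc.prems]]
  let ?P = "prod_family (?T (Suc j)) (unit_dir_derivs F)"
  show ?case
  proof (rule unif_smooth_SucI[OF assms(1) IH unif_smooth_mult[OF assms(1) IH unif_smooth_unit_dir_derivs[OF Suc.prems]]])
    fix h assume "h \<in> ?T j"
    then obtain m f where h: "h = (\<lambda>x. \<theta> m (f x))" "m \<le> j" "f \<in> F"
      by blast
    have "has_dir_deriv h v x (\<theta> (Suc m) (f x) * dir_deriv v f x)" if "x \<in> U" for v x
      unfolding h(1) by (intro has_dir_deriv_comp \<theta>(1) unif_smooth_dir_deriv[OF Suc.prems] h that)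
    moreover have "(\<lambda>x. \<theta> (Suc m) (f x) * dir_deriv v f x) \<in> ?P" if "norm v \<le> 1" for v
    proof (rule prod_memI)
      show "(\<lambda>x. \<theta> (Suc m) (f x)) \<in> ?T (Suc j)" "dir_deriv v f \<in> unit_dir_derivs F"
        using h(2,3) that by (blast, blast)
    qed
    ultimately show "\<exists>E. (\<forall>v. \<forall>x\<in>U. has_dir_deriv h v x (E v x)) \<and> (\<forall>v. norm v \<le> 1 \<longrightarrow> E v \<in> ?P)"
      by (intro exI[of _ "\<lambda>v x. \<theta> (Suc m) (f x) * dir_deriv v f x"] conjI allI ballI impI)
  qed
qed

lemma unif_smooth_inner:
  fixes U :: "'a::real_inner set"
  assumes "open U" "bounded U"
  shows "unif_smooth k U {\<lambda>x. v \<bullet> x | v. norm v \<le> C}"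
proof (induction k)
  case 0
  obtain R where R: "\<And>x. x \<in> U \<Longrightarrow> norm x \<le> R"
    using assms(2) bounded_iff by blast
  have "\<bar>v \<bullet> x\<bar> \<le> C * R" if "norm v \<le> C" "x \<in> U" for v x
    using Cauchy_Schwarz_ineq2[of v x] mult_mono'[OF that(1) R[OF that(2)]] by simp
  then show ?case by auto
next
  case (Suc k)
  show ?case
  proof (rule unif_smooth_SucI[OF assms(1) Suc unif_smooth_const[OF assms(1), of _ C]])
    fix f assume "f \<in> {\<lambda>x::'a. v \<bullet> x | v. norm v \<le> C}"
    then obtain v where v: "f = (\<lambda>x. v \<bullet> x)" "norm v \<le> C"
      by blast
    have "has_dir_deriv f w x (v \<bullet> w)" for w x
      unfolding v(1) by (intro has_dir_deriv_linear bounded_linear.linear bounded_linear_inner_right)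
    moreover have "\<bar>v \<bullet> w\<bar> \<le> C" if "norm w \<le> 1" for w
      using Cauchy_Schwarz_ineq2[of v w] mult_mono'[OF v(2) that] by simp
    ultimately show "\<exists>E. (\<forall>v. \<forall>x\<in>U. has_dir_deriv f v x (E v x)) \<and> (\<forall>v. norm v \<le> 1 \<longrightarrow> E v \<in> {\<lambda>_. c | c. \<bar>c\<bar> \<le> C})"
      by (intro exI[of _ "\<lambda>w _. v \<bullet> w"]) auto
  qed
qed

lemma unif_smooth_norm_sq:
  fixes U :: "'a::real_inner set"
  assumes "open U" "bounded U"
  shows "unif_smooth k U {\<lambda>x. x \<bullet> x}"
proof (induction k)
  case 0
  obtain R where R: "\<And>x. x \<in> U \<Longrightarrow> norm x \<le> R"
    using assms(2) bounded_iff by blast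
  have "\<bar>x \<bullet> x\<bar> \<le> R * R" if "x \<in> U" for x
    using Cauchy_Schwarz_ineq2[of x x] mult_mono'[OF R[OF that] R[OF that]] by simp
  then show ?case by auto
next
  case (Suc k)
  show ?case
  proof (rule unif_smooth_SucI[OF assms(1) Suc unif_smooth_inner[OF assms, of _ 2]])
    fix f :: "'a \<Rightarrow> real" assume f: "f \<in> {\<lambda>x. x \<bullet> x}"
    have "(\<lambda>t. (x + t *\<^sub>R w) \<bullet> (x + t *\<^sub>R w)) = (\<lambda>t. x \<bullet> x + t * (2 * (w \<bullet> x)) + t * t * (w \<bullet> w))" for w x :: 'a
      by (simp add: inner_add_left inner_add_right inner_commute algebra_simps fun_eq_iff)
    then have "has_dir_deriv f w x ((2 *\<^sub>R w) \<bullet> x)" for w x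
      using f by (auto simp: has_dir_deriv_def intro!: derivative_eq_intros)
    moreover have "(\<lambda>x. (2 *\<^sub>R w) \<bullet> x) \<in> {\<lambda>x. v \<bullet> x | v. norm v \<le> 2}" if "norm w \<le> 1" for w :: 'a
      using that by (intro CollectI exI[of _ "2 *\<^sub>R w"]) simp
    ultimately show "\<exists>E. (\<forall>v. \<forall>x\<in>U. has_dir_deriv f v x (E v x)) \<and> (\<forall>v. norm v \<le> 1 \<longrightarrow> E v \<in> {\<lambda>x. v \<bullet> x | v. norm v \<le> 2})"
      by (intro exI[of _ "\<lambda>w x. (2 *\<^sub>R w) \<bullet> x"]) simp
  qed
qed

section \<open>Iterated directional derivatives and Frechet differentiability\<close>

text \<open>Restricted to the line through \<open>x\<close> this is term-by-term differentiation
  with uniformly convergent derivatives. The index \<open>start\<close> is there because finite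
  averages are differentiable along coordinate \<open>i\<close> only once that coordinate has been
  averaged.\<close>

lemma has_dir_deriv_limit:
  fixes V :: "'a::real_normed_vector set"
  assumes V: "open V" "x \<in> V"
    and deriv: "\<And>n z. n \<ge> start \<Longrightarrow> z \<in> V \<Longrightarrow> has_dir_deriv (f n) v z (f' n z)"
    and lim: "\<And>z. z \<in> V \<Longrightarrow> (\<lambda>n. f n z) \<longlonglongrightarrow> F z"
    and unif: "uniform_limit V f' G sequentially"
  shows "has_dir_deriv F v x (G x)"
proof -
  obtain r where r: "r > 0" "\<And>t. \<bar>t\<bar> < r \<Longrightarrow> x + t *\<^sub>R v \<in> V"
    using eventually_line_in_open[OF V(1), of x 0 v] V(2)
    by (auto simp: eventually_nhds_metric dist_real_def)
  let ?p = "\<lambda>t. x + t *\<^sub>R v"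
  let ?S = "ball (0::real) r"
  have inV: "?p t \<in> V" if "t \<in> ?S" for t
    using r(2) that by simp
  have "\<exists>g. \<forall>t\<in>?S. (\<lambda>n. f (n + start) (?p t)) \<longlonglongrightarrow> g t \<and> (g has_derivative (\<lambda>h. G (?p t) * h)) (at t within ?S)"
  proof (rule has_derivative_sequence)
    show "convex ?S" "(0::real) \<in> ?S" using r(1) by auto
    show "((\<lambda>t. f (n + start) (?p t)) has_derivative (\<lambda>h. f' (n + start) (?p t) * h)) (at t within ?S)"
      if "t \<in> ?S" for n t
      using deriv[OF _ inV[OF that], of "n + start"]
      by (auto simp: has_dir_deriv_line has_field_derivative_def intro: has_derivative_at_withinI)
    show "(\<lambda>n. f (n + start) (?p 0)) \<longlonglongrightarrow> F (?p 0)"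
      using lim[of x] V(2) by (intro LIMSEQ_ignore_initial_segment) simp
    fix e :: real assume "e > 0"
    then have "\<forall>\<^sub>F n in sequentially. \<forall>z\<in>V. dist (f' n z) (G z) < e"
      using unif by (auto simp: uniform_limit_iff)
    then obtain N where N: "\<And>n z. n \<ge> N \<Longrightarrow> z \<in> V \<Longrightarrow> \<bar>f' n z - G z\<bar> < e"
      unfolding eventually_sequentially dist_real_def by blast
    have "norm (f' (n + start) (?p t) * h - G (?p t) * h) \<le> e * norm h" if "n \<ge> N" "t \<in> ?S" for n t h
    proof -
      have "norm ((f' (n + start) (?p t) - G (?p t)) * h) \<le> e * norm h"
        unfolding norm_mult using N[of "n + start", OF _ inV[OF that(2)]] that(1)
        by (intro mult_right_mono) (auto intro: less_imp_le)
      then show ?thesis by (simp add: algebra_simps)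
    qed
    then show "\<forall>\<^sub>F n in sequentially. \<forall>t\<in>?S. \<forall>h.
        norm (f' (n + start) (?p t) * h - G (?p t) * h) \<le> e * norm h"
      unfolding eventually_sequentially by blast
  qed
  then obtain g where g: "\<And>t. t \<in> ?S \<Longrightarrow> (\<lambda>n. f (n + start) (?p t)) \<longlonglongrightarrow> g t"
    "\<And>t. t \<in> ?S \<Longrightarrow> (g has_derivative (\<lambda>h. G (?p t) * h)) (at t within ?S)"
    by blast
  have "g t = F (?p t)" if "t \<in> ?S" for t
    by (rule LIMSEQ_unique[OF g(1)[OF that] LIMSEQ_ignore_initial_segment[OF lim[OF inV[OF that]]]])
  moreover have "(g has_real_derivative G x) (at 0)"
    using g(2)[of 0] r(1) by (simp add: has_field_derivative_def at_within_open[OF _ open_ball])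
  ultimately have "((\<lambda>t. F (?p t)) has_real_derivative G x) (at 0)"
    using r(1) by (elim has_field_derivative_transform_within_open[where S = ?S]) auto
  then show ?thesis
    by (simp add: has_dir_deriv_def)
qed

lemma has_derivative_0_quadratic:
  fixes r :: "real \<Rightarrow> real"
  assumes "\<forall>\<^sub>F t in nhds 0. \<bar>r t\<bar> \<le> M * t\<^sup>2"
  shows "(r has_real_derivative 0) (at 0)"
proof -
  have r0: "r 0 = 0"
    using eventually_nhds_x_imp_x[OF assms] by simp
  have "((\<lambda>t. M * \<bar>t\<bar>) \<longlongrightarrow> M * \<bar>0\<bar>) (at (0::real))"
    by (intro tendsto_intros)
  then have lim: "((\<lambda>t. M * \<bar>t\<bar>) \<longlongrightarrow> 0) (at (0::real))"
    by simp
  have "((\<lambda>t. r t / t) \<longlongrightarrow> 0) (at 0)"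
  proof (rule Lim_null_comparison[OF _ lim])
    have "\<forall>\<^sub>F t in at 0. \<bar>r t\<bar> \<le> M * t\<^sup>2"
      using assms by (auto simp: eventually_at_filter elim: eventually_mono)
    moreover have "\<forall>\<^sub>F t in at 0. t \<noteq> (0::real)"
      by (simp add: eventually_at_filter)
    ultimately show "\<forall>\<^sub>F t in at 0. norm (r t / t) \<le> M * \<bar>t\<bar>"
    proof eventually_elim
      case (elim t)
      have "\<bar>r t\<bar> \<le> M * \<bar>t\<bar> * \<bar>t\<bar>"
        using elim(1) by (simp add: power2_eq_square mult.assoc)
      then show ?case
        using elim(2) by (simp add: abs_divide pos_divide_le_eq)
    qed
  qed
  then show ?thesis
    by (simp add: DERIV_def r0)
qed

text \<open>The difference \<open>g (x + t v + t w) - g (x + t v)\<close> is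
  \<open>t * D w (x + t v)\<close> up to an error of order \<open>t^2\<close>, by the bound on the
  second derivative. As \<open>D w\<close> is differentiable along \<open>v\<close>, the main term
  has derivative \<open>D w x\<close> at \<open>t = 0\<close>.\<close>

lemma dir_deriv_add_vector:
  fixes g :: "'a::real_normed_vector \<Rightarrow> real"
  assumes U: "open U" "x \<in> U"
    and D: "\<And>z u. z \<in> U \<Longrightarrow> has_dir_deriv g u z (D u z)"
    and E: "\<And>z u. z \<in> U \<Longrightarrow> has_dir_deriv (D w) u z (E u z)"
    and M: "\<And>z. z \<in> U \<Longrightarrow> \<bar>E w z\<bar> \<le> M"
  shows "D (v + w) x = D v x + D w x"
proof -
  obtain r where r: "r > 0" "ball x r \<subseteq> U"
    using U by (meson open_contains_ball)
  let ?r = "\<lambda>t. g ((x + t *\<^sub>R v) + t *\<^sub>R w) - g (x + t *\<^sub>R v) - t * D w (x + t *\<^sub>R v)"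
  have "\<bar>?r t\<bar> \<le> M * t\<^sup>2" if t: "\<bar>t\<bar> * (norm v + norm w) < r" for t
  proof -
    have "norm (t *\<^sub>R v) \<le> \<bar>t\<bar> * (norm v + norm w)" "norm (t *\<^sub>R v + t *\<^sub>R w) \<le> \<bar>t\<bar> * (norm v + norm w)"
      by (auto simp: distrib_left intro: order_trans[OF norm_triangle_ineq])
    moreover have dist_add: "dist x (x + u) = norm u" for u
      by (simp add: dist_norm)
    ultimately have "x + t *\<^sub>R v \<in> ball x r" "x + t *\<^sub>R v + t *\<^sub>R w \<in> ball x r"
      using t by (simp_all add: add.assoc dist_add)
    then have seg: "closed_segment (x + t *\<^sub>R v) (x + t *\<^sub>R v + t *\<^sub>R w) \<subseteq> U"
      using r(2) by (meson closed_segment_subset convex_ball subset_trans)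
    show ?thesis
    proof (rule dir_deriv_taylor[OF seg])
      fix z assume z: "z \<in> U"
      show "has_dir_deriv g (t *\<^sub>R w) z (t * D w z)"
        by (intro has_dir_deriv_scale D z)
      show "has_dir_deriv (\<lambda>z. t * D w z) (t *\<^sub>R w) z (t * (t * E w z))"
        by (intro has_dir_deriv_cmult has_dir_deriv_scale E z)
      show "\<bar>t * (t * E w z)\<bar> \<le> M * t\<^sup>2"
        using M[OF z] mult_right_mono[OF M[OF z], of "t\<^sup>2"] by (simp add: abs_mult power2_eq_square mult_ac)
    qed
  qed
  moreover have "\<forall>\<^sub>F t in nhds 0. \<bar>t\<bar> * (norm v + norm w) < r"
  proof (rule order_tendstoD(2))
    show "((\<lambda>t. \<bar>t\<bar> * (norm v + norm w)) \<longlongrightarrow> \<bar>0\<bar> * (norm v + norm w)) (nhds (0::real))"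
      by (intro tendsto_intros filterlim_ident)
  qed (use r in simp)
  ultimately have "(?r has_real_derivative 0) (at 0)"
    by (intro has_derivative_0_quadratic[where M = M]) (auto elim: eventually_mono)
  moreover have "((\<lambda>t. t * D w (x + t *\<^sub>R v)) has_real_derivative 1 * D w (x + 0 *\<^sub>R v) + E v x * 0) (at 0)"
    using E[OF U(2), of v] by (intro DERIV_mult) (auto simp: has_dir_deriv_def)
  moreover have "((\<lambda>t. g (x + t *\<^sub>R v)) has_real_derivative D v x) (at 0)"
    using D[OF U(2), of v] by (simp add: has_dir_deriv_def)
  ultimately have "((\<lambda>t. (?r t + t * D w (x + t *\<^sub>R v)) + g (x + t *\<^sub>R v)) has_real_derivative
      (0 + (1 * D w (x + 0 *\<^sub>R v) + E v x * 0)) + D v x) (at 0)"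
    by (intro DERIV_add)
  then have "has_dir_deriv g (v + w) x (D w x + D v x)"
    by (simp add: has_dir_deriv_def scaleR_add_right add.assoc)
  then show ?thesis
    using dir_deriv_eqI D[OF U(2), of "v + w"] by (metis add.commute)
qed

section \<open>Functions with bounded directional derivatives of every order\<close>

definition smooth_bounded :: "'a::real_normed_vector set \<Rightarrow> ('a \<Rightarrow> real) \<Rightarrow> bool"
  where "smooth_bounded U f \<longleftrightarrow> open U \<and> (\<forall>k. unif_smooth k U {f})"

lemma smooth_bounded_cong:
  "smooth_bounded U f \<Longrightarrow> (\<And>y. y \<in> U \<Longrightarrow> f y = g y) \<Longrightarrow> smooth_bounded U g"
  unfolding smooth_bounded_def by (blast intro: unif_smooth_cong[where F = "{f}"] dest: sym)

lemma smooth_bounded_subset: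
  assumes "smooth_bounded U f" "open V" "V \<subseteq> U"
  shows "smooth_bounded V f"
proof -
  have "unif_smooth k U F \<Longrightarrow> unif_smooth k V F" for k F
    using assms(3)
  proof (induction k arbitrary: F)
    case (Suc k)
    then show ?case
      by (simp only: unif_smooth.simps) (meson subsetD)
  qed auto
  then show ?thesis
    using assms by (simp add: smooth_bounded_def)
qed

lemma smooth_bounded_const: "open U \<Longrightarrow> smooth_bounded U (\<lambda>_. c)"
  unfolding smooth_bounded_def by (auto intro: unif_smooth_subset[OF unif_smooth_const[of U _ "\<bar>c\<bar>"]])

lemma smooth_bounded_add:
  assumes f: "smooth_bounded U f" and g: "smooth_bounded U g"
  shows "smooth_bounded U (\<lambda>x. f x + g x)"
proof -
  have U: "open U"
    using f by (simp add: smooth_bounded_def)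
  have "unif_smooth k U (sum_family {f} {g})" for k
    using f g by (intro unif_smooth_add) (auto simp: smooth_bounded_def)
  then have "unif_smooth k U {\<lambda>x. f x + g x}" for k
    by (rule unif_smooth_subset[OF _ _ U]) blast
  then show ?thesis
    using U by (simp add: smooth_bounded_def)
qed

lemma dir_derivs_cong:
  assumes "open U" "\<And>y. y \<in> U \<Longrightarrow> f y = g y" "x \<in> U"
  shows "dir_derivs vs f x = dir_derivs vs g x"
  using assms(3)
proof (induction vs arbitrary: x)
  case (Cons v vs)
  have "dir_deriv v (dir_derivs vs f) x = dir_deriv v (dir_derivs vs g) x"
    by (rule dir_deriv_cong[OF assms(1) Cons.prems Cons.IH])
  then show ?case by simp
qed (simp add: assms(2))

text \<open>\<open>unif_smooth\<close> bounds derivatives only in directions of norm at most 1.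
  Homogeneity extends this to arbitrary directions: each vector is replaced by its
  \<open>sgn\<close>, and the norms come out as a product.\<close>

lemma
  fixes f :: "'a::real_normed_vector \<Rightarrow> real"
  assumes f: "smooth_bounded U f"
  shows smooth_bounded_deriv:
      "x \<in> U \<Longrightarrow> has_dir_deriv (dir_derivs vs f) v x (dir_derivs (v # vs) f x)"
    and smooth_bounded_bound:
      "\<exists>M. \<forall>vs. length vs = k \<longrightarrow> (\<forall>x\<in>U. \<bar>dir_derivs vs f x\<bar> \<le> M * prod_list (map norm vs))"
proof -
  have U: "open U"
    using f by (simp add: smooth_bounded_def)
  let ?D = "\<lambda>j. {dir_derivs vs f | vs. length vs = j \<and> (\<forall>v\<in>set vs. norm v \<le> 1)}"
  have D: "unif_smooth k U (?D j)" for k j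
  proof (induction j arbitrary: k)
    case 0
    show ?case by (rule unif_smooth_subset[OF _ _ U]) (use f in \<open>auto simp: smooth_bounded_def\<close>)
  next
    case (Suc j)
    have "?D (Suc j) \<subseteq> unit_dir_derivs (?D j)"
    proof
      fix g assume "g \<in> ?D (Suc j)"
      then obtain vs where vs: "g = dir_derivs vs f" "length vs = Suc j" "\<forall>v\<in>set vs. norm v \<le> 1"
        by blast
      then obtain w ws where ws: "vs = w # ws" by (cases vs) auto
      then have "dir_derivs ws f \<in> ?D j"
        using vs by auto
      then show "g \<in> unit_dir_derivs (?D j)"
        using vs ws by auto
    qed
    then show ?case
      by (rule unif_smooth_subset[OF unif_smooth_unit_dir_derivs[OF Suc] _ U])
  qed
  have sgn_mem: "dir_derivs (map sgn vs) f \<in> ?D (length vs)" for vs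
    by (auto intro!: exI[of _ "map sgn vs"] simp: norm_sgn)
  have sgn_deriv: "has_dir_deriv (dir_derivs (map sgn vs) f) v x (dir_deriv v (dir_derivs (map sgn vs) f) x)"
    if "x \<in> U" for vs v x
    by (rule unif_smooth_dir_deriv[OF D[of "Suc 0"] sgn_mem that])
  have scale: "dir_derivs vs f x = prod_list (map norm vs) * dir_derivs (map sgn vs) f x"
    if "x \<in> U" for vs x
    using that
  proof (induction vs arbitrary: x)
    case (Cons v vs)
    let ?g = "dir_derivs (map sgn vs) f"
    let ?c = "prod_list (map norm vs)"
    have "dir_deriv v (dir_derivs vs f) x = dir_deriv v (\<lambda>x. ?c * ?g x) x"
      by (rule dir_deriv_cong[OF U Cons.prems Cons.IH])
    also have "has_dir_deriv (\<lambda>x. ?c * ?g x) (norm v *\<^sub>R sgn v) x (?c * (norm v * dir_deriv (sgn v) ?g x))"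
      by (intro has_dir_deriv_cmult has_dir_deriv_scale sgn_deriv Cons.prems)
    then have "dir_deriv v (\<lambda>x. ?c * ?g x) x = ?c * (norm v * dir_deriv (sgn v) ?g x)"
      by (cases "v = 0") (auto simp: sgn_div_norm dest: dir_deriv_eqI)
    finally show ?case by simp
  qed simp
  show "has_dir_deriv (dir_derivs vs f) v x (dir_derivs (v # vs) f x)" if "x \<in> U"
  proof -
    have "has_dir_deriv (dir_derivs vs f) v x d \<longleftrightarrow>
        has_dir_deriv (\<lambda>x. prod_list (map norm vs) * dir_derivs (map sgn vs) f x) v x d" for d
      by (rule has_dir_deriv_cong[OF U that scale])
    then have "\<exists>d. has_dir_deriv (dir_derivs vs f) v x d"
      using has_dir_deriv_cmult[OF sgn_deriv[OF that]] by blast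
    then show ?thesis
      by (auto simp: has_dir_deriv_dir_deriv)
  qed
  obtain M where M: "\<forall>g\<in>?D k. \<forall>x\<in>U. \<bar>g x\<bar> \<le> M"
      using unif_smooth_bounded[OF D[of 0 k]] by blast
    have "\<bar>dir_derivs vs f x\<bar> \<le> M * prod_list (map norm vs)" if "length vs = k" "x \<in> U" for vs x
    proof -
      have "dir_derivs (map sgn vs) f \<in> ?D k"
        using sgn_mem[of vs] that(1) by simp
      then have "\<bar>dir_derivs (map sgn vs) f x\<bar> \<le> M"
        using M that(2) by blast
      moreover have "0 \<le> prod_list (map norm vs)"
        by (rule prod_list_nonneg) auto
      ultimately show ?thesis
        by (subst scale[OF that(2)]) (simp add: abs_mult mult.commute[of M] mult_left_mono)
    qed
  then show "\<exists>M. \<forall>vs. length vs = k \<longrightarrow> (\<forall>x\<in>U. \<bar>dir_derivs vs f x\<bar> \<le> M * prod_list (map norm vs))"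
    by blast
qed

text \<open>Additivity in the outermost direction is \<open>dir_deriv_add_vector\<close>, fed with
  the bound on derivatives of one order higher. In any other slot it follows by differentiating the
  induction hypothesis, which holds on the whole open set.\<close>

lemma dir_derivs_linear:
  assumes f: "smooth_bounded U f"
  shows "x \<in> U \<Longrightarrow> i < length vs \<Longrightarrow> dir_derivs (vs[i := v + w]) f x
        = dir_derivs (vs[i := v]) f x + dir_derivs (vs[i := w]) f x"
    and "x \<in> U \<Longrightarrow> i < length vs \<Longrightarrow> dir_derivs (vs[i := c *\<^sub>R v]) f x
        = c * dir_derivs (vs[i := v]) f x"
proof (induction vs arbitrary: x i)
  case (Cons u us)
  have U: "open U"
    using f by (simp add: smooth_bounded_def)
  {
    case 1
    show ?case
    proof (cases i)
      case 0
      obtain M where M: "\<And>vs x. length vs = length us + 2 \<Longrightarrow> x \<in> U \<Longrightarrow>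
          \<bar>dir_derivs vs f x\<bar> \<le> M * prod_list (map norm vs)"
        using smooth_bounded_bound[OF f] by blast
      have "dir_derivs ((v + w) # us) f x = dir_derivs (v # us) f x + dir_derivs (w # us) f x"
      proof (rule dir_deriv_add_vector[OF U 1(1), of "dir_derivs us f" "\<lambda>u. dir_derivs (u # us) f"
            w "\<lambda>u. dir_derivs (u # w # us) f" "M * prod_list (map norm (w # w # us))"])
        fix z assume "z \<in> U"
        then show "\<bar>dir_derivs (w # w # us) f z\<bar> \<le> M * prod_list (map norm (w # w # us))"
          by (intro M) auto
      qed (intro smooth_bounded_deriv[OF f], assumption)+
      then show ?thesis
        using 0 by simp
    next
      case (Suc j)
      have "dir_derivs ((u # us)[i := v + w]) f x
          = dir_deriv u (\<lambda>x. dir_derivs (us[j := v]) f x + dir_derivs (us[j := w]) f x) x"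
        using Suc 1(2) dir_deriv_cong[OF U 1(1) Cons.IH(1)[of _ j]] by simp
      also have "\<dots> = dir_derivs (u # us[j := v]) f x + dir_derivs (u # us[j := w]) f x"
        by (intro dir_deriv_eqI has_dir_deriv_add smooth_bounded_deriv[OF f] 1(1))
      finally show ?thesis using Suc by simp
    qed
  next
    case 2
    show ?case
    proof (cases i)
      case 0
      have "has_dir_deriv (dir_derivs us f) (c *\<^sub>R v) x (c * dir_derivs (v # us) f x)"
        by (intro has_dir_deriv_scale smooth_bounded_deriv[OF f 2(1)])
      from dir_deriv_eqI[OF this] show ?thesis
        using 0 by simp
    next
      case (Suc j)
      have "dir_derivs ((u # us)[i := c *\<^sub>R v]) f x
          = dir_deriv u (\<lambda>x. c * dir_derivs (us[j := v]) f x) x"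
        using Suc 2(2) dir_deriv_cong[OF U 2(1) Cons.IH(2)[of _ j]] by simp
      also have "\<dots> = c * dir_derivs (u # us[j := v]) f x"
        by (intro dir_deriv_eqI has_dir_deriv_cmult smooth_bounded_deriv[OF f] 2(1))
      finally show ?thesis using Suc by simp
    qed
  }
qed simp_all

section \<open>From directional to Frechet derivatives\<close>

lemma prod_list_norm_le_1: "\<forall>v\<in>set vs. norm v \<le> 1 \<Longrightarrow> prod_list (map norm vs) \<le> 1"
  for vs :: "'a::real_normed_vector list"
  by (induction vs) (auto intro!: mult_le_one prod_list_nonneg)

lemma multilinear_norm_le:
  assumes "\<And>vs. length vs = k \<Longrightarrow> \<bar>T vs\<bar> \<le> K * prod_list (map norm vs)" "0 \<le> K"
  shows "0 \<le> multilinear_norm k T" "multilinear_norm k T \<le> K"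
proof -
  let ?S = "{vs. length vs = k \<and> (\<forall>v\<in>set vs. norm (v::ell2) \<le> 1)}"
  have ne: "replicate k 0 \<in> ?S"
    by auto
  have bd: "\<bar>T vs\<bar> \<le> K" if "vs \<in> ?S" for vs
    using assms(1)[of vs] mult_left_mono[OF prod_list_norm_le_1 assms(2), of vs] that by auto
  show "multilinear_norm k T \<le> K"
    unfolding multilinear_norm_def by (rule cSUP_least) (use ne bd in blast)+
  have "bdd_above ((\<lambda>vs. \<bar>T vs\<bar>) ` ?S)"
    using bd by (intro bdd_aboveI[of _ K]) auto
  from cSUP_upper[OF ne this] show "0 \<le> multilinear_norm k T"
    unfolding multilinear_norm_def by linarith
qed

text \<open>The \<open>k\<close>-th Frechet derivative is the iterated directional derivative, with
  the newest increment at the head of the list. The Taylor remainder is at most a constant times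
  \<open>norm h\<close> squared times the product of the norms of the arguments, uniformly in these,
  hence small in \<open>multilinear_norm\<close> after division by \<open>norm h\<close>.\<close>

lemma smooth_bounded_imp_C_infinity_ell2:
  assumes "\<And>x. x \<in> \<Omega> \<Longrightarrow> \<exists>U. open U \<and> x \<in> U \<and> smooth_bounded U f"
  shows "f \<in> C_infinity_ell2 \<Omega>"
  unfolding C_infinity_ell2_def
proof (rule CollectI, rule exI[of _ "\<lambda>k x vs. dir_derivs vs f x"], intro conjI ballI allI)
  fix k x assume "x \<in> \<Omega>"
  then obtain U where U: "open U" "x \<in> U" "smooth_bounded U f"
    using assms by blast
  show "bounded_multilinear k (\<lambda>vs. dir_derivs vs f x)"
    unfolding bounded_multilinear_def
  proof (intro conjI allI impI)
    fix vs :: "ell2 list" and i assume "length vs = k" "i < k"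
    then show "linear (\<lambda>v. dir_derivs (vs[i := v]) f x)"
      using dir_derivs_linear[OF U(3,2)] by (intro linearI) simp_all
  next
    show "\<exists>K. \<forall>vs. length vs = k \<longrightarrow> \<bar>dir_derivs vs f x\<bar> \<le> K * prod_list (map norm vs)"
      using smooth_bounded_bound[OF U(3), of k] U(2) by blast
  qed
  obtain r where r: "r > 0" "ball x r \<subseteq> U"
    using U by (meson open_contains_ball)
  obtain M where M: "\<And>vs z. length vs = k + 2 \<Longrightarrow> z \<in> U \<Longrightarrow>
      \<bar>dir_derivs vs f z\<bar> \<le> M * prod_list (map norm vs)"
    using smooth_bounded_bound[OF U(3)] by blast
  let ?T = "\<lambda>h vs. dir_derivs vs f (x + h) - dir_derivs vs f x - dir_derivs (h # vs) f x"
  have T: "\<bar>?T h vs\<bar> \<le> \<bar>M\<bar> * norm h * norm h * prod_list (map norm vs)"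
    if "norm h < r" "length vs = k" for h vs
  proof (rule dir_deriv_taylor[where U = U])
    have "x \<in> ball x r" "x + h \<in> ball x r"
      using that(1) r(1) by (auto simp: dist_norm)
    then show "closed_segment x (x + h) \<subseteq> U"
      using r(2) by (meson closed_segment_subset convex_ball subset_trans)
    fix z assume z: "z \<in> U"
    show "has_dir_deriv (dir_derivs vs f) h z (dir_derivs (h # vs) f z)"
      "has_dir_deriv (dir_derivs (h # vs) f) h z (dir_derivs (h # h # vs) f z)"
      by (intro smooth_bounded_deriv[OF U(3) z])+
    have "0 \<le> prod_list (map norm (h # h # vs))"
      by (rule prod_list_nonneg) auto
    then have "M * prod_list (map norm (h # h # vs)) \<le> \<bar>M\<bar> * prod_list (map norm (h # h # vs))"
      by (intro mult_right_mono) auto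
    then show "\<bar>dir_derivs (h # h # vs) f z\<bar> \<le> \<bar>M\<bar> * norm h * norm h * prod_list (map norm vs)"
      using M[of "h # h # vs" z] that(2) z by (simp add: mult_ac)
  qed
  have mn: "\<bar>multilinear_norm k (?T h)\<bar> \<le> \<bar>M\<bar> * norm h * norm h" if "norm h < r" for h
    using multilinear_norm_le[of k "?T h" "\<bar>M\<bar> * norm h * norm h"] T[OF that] by auto
  have lim: "((\<lambda>h. \<bar>M\<bar> * norm (h::ell2)) \<longlongrightarrow> 0) (at 0)"
    by (intro tendsto_mult_right_zero tendsto_norm_zero tendsto_ident_at)
  show "((\<lambda>h. multilinear_norm k (?T h) / norm h) \<longlongrightarrow> 0) (at 0)"
  proof (rule Lim_null_comparison[OF _ lim])
    have "\<forall>\<^sub>F h in at (0::ell2). h \<in> ball 0 r"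
      using r(1) by (intro eventually_at_in_open') auto
    moreover have "\<forall>\<^sub>F h in at (0::ell2). h \<noteq> 0"
      by (simp add: eventually_at_filter)
    ultimately show "\<forall>\<^sub>F h in at (0::ell2). norm (multilinear_norm k (?T h) / norm h) \<le> \<bar>M\<bar> * norm h"
    proof eventually_elim
      case (elim h)
      then show ?case
        using mn[of h] by (simp add: abs_divide pos_divide_le_eq)
    qed
  qed
qed simp

section \<open>Chain rule in finitely many directions and the gradient bound\<close>

text \<open>Continuous partial derivatives in the frame directions suffice for the chain rule. The
  induction changes the last coefficient separately, by the mean value theorem, and lets the others
  move with the last one frozen at its value at time 0.\<close>

lemma has_derivative_along_frame:
  fixes H :: "'a::real_normed_vector \<Rightarrow> real" and e :: "nat \<Rightarrow> 'a"
  assumes "\<And>i x. i < N \<Longrightarrow> has_dir_deriv H (e i) x (D i x)" "\<And>i. i < N \<Longrightarrow> continuous_on UNIV (D i)"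
    "\<And>i. i < N \<Longrightarrow> (c i has_real_derivative c' i) (at 0)"
  shows "((\<lambda>t. H (w + (\<Sum>i<N. c i t *\<^sub>R e i))) has_real_derivative
      (\<Sum>i<N. D i (w + (\<Sum>j<N. c j 0 *\<^sub>R e j)) * c' i)) (at 0)"
  using assms
proof (induction N arbitrary: w)
  case 0
  then show ?case by simp
next
  case (Suc N)
  let ?p = "\<lambda>t. \<Sum>i<N. c i t *\<^sub>R e i"
  let ?q = "w + (\<Sum>j<Suc N. c j 0 *\<^sub>R e j)"
  let ?R = "\<lambda>t. H (w + ?p t + c N t *\<^sub>R e N) - H (w + ?p t + c N 0 *\<^sub>R e N)"
  have "((\<lambda>t. H ((w + c N 0 *\<^sub>R e N) + ?p t)) has_real_derivative
      (\<Sum>i<N. D i ((w + c N 0 *\<^sub>R e N) + ?p 0) * c' i)) (at 0)"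
    using Suc.prems by (intro Suc.IH) auto
  then have 1: "((\<lambda>t. H (w + ?p t + c N 0 *\<^sub>R e N)) has_real_derivative (\<Sum>i<N. D i ?q * c' i)) (at 0)"
    by (simp add: add_ac)
  \<comment> \<open>The intermediate point depends on \<open>t\<close>, but it is squeezed to
    \<open>c N 0\<close>, so continuity of \<open>D N\<close> identifies the limit of the
    quotient.\<close>
  have "\<exists>s. \<bar>s - c N 0\<bar> \<le> \<bar>c N t - c N 0\<bar> \<and> ?R t = (c N t - c N 0) * D N (w + ?p t + s *\<^sub>R e N)" for t
  proof -
    have d: "((\<lambda>s. H (w + ?p t + s *\<^sub>R e N)) has_real_derivative D N (w + ?p t + s *\<^sub>R e N)) (at s)" for s
      using Suc.prems(1)[of N "w + ?p t + s *\<^sub>R e N"] by (simp add: has_dir_deriv_line)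
    show ?thesis
    proof (cases "c N t = c N 0")
      case False
      then consider "c N 0 < c N t" | "c N t < c N 0" by linarith
      then show ?thesis
      proof cases
        case 1
        from MVT2[OF this, of "\<lambda>s. H (w + ?p t + s *\<^sub>R e N)", OF d] obtain s where
          "c N 0 < s" "s < c N t" "?R t = (c N t - c N 0) * D N (w + ?p t + s *\<^sub>R e N)"
          by blast
        then show ?thesis by (intro exI[of _ s]) auto
      next
        case 2
        from MVT2[OF this, of "\<lambda>s. H (w + ?p t + s *\<^sub>R e N)", OF d] obtain s where
          "c N t < s" "s < c N 0" "- ?R t = (c N 0 - c N t) * D N (w + ?p t + s *\<^sub>R e N)"
          by auto
        then show ?thesis by (intro exI[of _ s]) (auto simp: algebra_simps)
      qed
    qed (auto intro: exI[of _ "c N 0"])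
  qed
  then obtain s where s: "\<And>t. \<bar>s t - c N 0\<bar> \<le> \<bar>c N t - c N 0\<bar>"
    "\<And>t. ?R t = (c N t - c N 0) * D N (w + ?p t + s t *\<^sub>R e N)"
    by metis
  have cont: "(c i \<longlongrightarrow> c i 0) (at 0)" if "i < Suc N" for i
    using DERIV_isCont[OF Suc.prems(3)[OF that]] by (simp add: isCont_def)
  have "((\<lambda>t. c N t - c N 0) \<longlongrightarrow> 0) (at 0)"
    using cont[of N] by (simp add: LIM_zero_iff)
  then have "((\<lambda>t. s t - c N 0) \<longlongrightarrow> 0) (at 0)"
    by (rule tendsto_0_le[where K = 1]) (use s(1) in simp)
  then have "(s \<longlongrightarrow> c N 0) (at 0)"
    by (simp add: LIM_zero_iff)
  then have "((\<lambda>t. w + ?p t + s t *\<^sub>R e N) \<longlongrightarrow> w + ?p 0 + c N 0 *\<^sub>R e N) (at 0)"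
    using cont by (intro tendsto_intros) auto
  moreover have "isCont (D N) (w + ?p 0 + c N 0 *\<^sub>R e N)"
    using Suc.prems(2)[of N] by (simp add: continuous_on_eq_continuous_at)
  ultimately have "((\<lambda>t. D N (w + ?p t + s t *\<^sub>R e N)) \<longlongrightarrow> D N (w + ?p 0 + c N 0 *\<^sub>R e N)) (at 0)"
    by (rule isCont_tendsto_compose[rotated])
  moreover have "((\<lambda>t. (c N t - c N 0) / t) \<longlongrightarrow> c' N) (at 0)"
    using Suc.prems(3)[of N] by (simp add: DERIV_def)
  ultimately have "((\<lambda>t. (c N t - c N 0) / t * D N (w + ?p t + s t *\<^sub>R e N))
      \<longlongrightarrow> c' N * D N (w + ?p 0 + c N 0 *\<^sub>R e N)) (at 0)"
    by (intro tendsto_mult)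
  moreover have "(\<lambda>t. (c N t - c N 0) / t * D N (w + ?p t + s t *\<^sub>R e N)) = (\<lambda>t. ?R t / t)"
    unfolding s(2) by simp
  ultimately have "((\<lambda>t. ?R t / t) \<longlongrightarrow> c' N * D N (w + ?p 0 + c N 0 *\<^sub>R e N)) (at 0)"
    by simp
  then have "(?R has_real_derivative c' N * D N (w + ?p 0 + c N 0 *\<^sub>R e N)) (at 0)"
    by (simp add: DERIV_def)
  from DERIV_add[OF this 1] show ?case
    by (simp add: add_ac mult.commute)
qed

lemma unit_vec_inner: "unit_vec i \<bullet> x = coord x i"
proof -
  have "(\<lambda>j. (if j = i then 1 else 0) * coord x j) = (\<lambda>j. if j = i then coord x j else 0)"
    by auto
  then show ?thesis
    using sums_If_finite[of "\<lambda>j. j = i" "coord x"]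
    by (simp add: inner_ell2.rep_eq unit_vec.rep_eq sums_iff)
qed

lemma coord_unit_vec: "coord (unit_vec i) j = (if j = i then 1 else 0)"
  by (simp add: unit_vec.rep_eq)

lemma coord_add: "coord (x + y) i = coord x i + coord y i"
  by (simp add: plus_ell2.rep_eq)

lemma coord_scaleR: "coord (c *\<^sub>R x) i = c * coord x i"
  by (simp add: scaleR_ell2.rep_eq)

lemma coord_sum: "coord (\<Sum>i\<in>I. f i) j = (\<Sum>i\<in>I. coord (f i) j)"
  by (simp add: unit_vec_inner[symmetric] inner_sum_right)

lemma coord_sum_unit_vec: "coord (\<Sum>i<n. c i *\<^sub>R unit_vec i) j = (if j < n then c j else 0)"
proof -
  have "coord (\<Sum>i<n. c i *\<^sub>R unit_vec i) j = (\<Sum>i<n. if j = i then c i else 0)"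
    by (simp add: coord_sum coord_scaleR coord_unit_vec if_distrib cong: if_cong)
  then show ?thesis by simp
qed

lemma norm_unit_vec [simp]: "norm (unit_vec i) = 1"
  by (simp add: norm_eq_sqrt_inner unit_vec_inner coord_unit_vec)

lemma norm_sum_unit_vec_sq: "(norm (\<Sum>i<n. c i *\<^sub>R unit_vec i))\<^sup>2 = (\<Sum>i<n::nat. (c i)\<^sup>2)"
proof -
  have "(\<Sum>i<n. c i *\<^sub>R unit_vec i) \<bullet> y = (\<Sum>i<n. c i * coord y i)" for y
    by (simp add: inner_sum_left unit_vec_inner)
  then have "(norm (\<Sum>i<n. c i *\<^sub>R unit_vec i))\<^sup>2 = (\<Sum>i<n. c i * coord (\<Sum>i<n. c i *\<^sub>R unit_vec i) i)"
    unfolding power2_norm_eq_inner .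
  then show ?thesis
    by (simp add: coord_sum_unit_vec power2_eq_square)
qed

text \<open>The derivative along the truncated gradient \<open>v\<close> is the square of
  \<open>norm v\<close>, and the Lipschitz bound makes it at most \<open>L * norm v\<close>. The
  estimate does not depend on \<open>n\<close>, so it controls the full series of squares.\<close>

lemma gradient_sum_le:
  assumes "\<And>i x. has_dir_deriv H (unit_vec i) x (D i x)" "\<And>i. continuous_on UNIV (D i)"
    and L: "\<And>x y. \<bar>H x - H y\<bar> \<le> L * norm (x - y)"
  shows "(\<Sum>i<n. (D i x)\<^sup>2) \<le> L\<^sup>2"
proof -
  define S where "S = (\<Sum>i<n. (D i x)\<^sup>2)"
  let ?v = "\<Sum>i<n. D i x *\<^sub>R unit_vec i"
  have "((\<lambda>t. H (x + (\<Sum>i<n. (t * D i x) *\<^sub>R unit_vec i))) has_real_derivative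
      (\<Sum>i<n. D i (x + (\<Sum>j<n. (0 * D j x) *\<^sub>R unit_vec j)) * D i x)) (at 0)"
    using assms(1,2) by (intro has_derivative_along_frame) (auto intro!: derivative_eq_intros)
  then have "((\<lambda>t. H (x + t *\<^sub>R ?v)) has_real_derivative S) (at 0)"
    by (simp add: S_def scaleR_sum_right power2_eq_square)
  then have "((\<lambda>t. (H (x + t *\<^sub>R ?v) - H x) / t) \<longlongrightarrow> S) (at 0)"
    by (simp add: DERIV_def)
  then have "((\<lambda>t. \<bar>(H (x + t *\<^sub>R ?v) - H x) / t\<bar>) \<longlongrightarrow> \<bar>S\<bar>) (at 0)"
    by (rule tendsto_rabs)
  moreover have "\<bar>(H (x + t *\<^sub>R ?v) - H x) / t\<bar> \<le> L * norm ?v" if "t \<noteq> 0" for t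
    using L[of "x + t *\<^sub>R ?v" x] that by (simp add: abs_divide pos_divide_le_eq mult_ac)
  ultimately have "\<bar>S\<bar> \<le> L * norm ?v"
    by (intro tendsto_upperbound[of _ _ "at (0::real)"]) (auto simp: eventually_at_filter)
  moreover have "S \<ge> 0"
    by (auto simp: S_def intro: sum_nonneg)
  moreover have nv: "(norm ?v)\<^sup>2 = S"
    by (simp add: norm_sum_unit_vec_sq S_def)
  ultimately have "S\<^sup>2 \<le> (L * norm ?v)\<^sup>2"
    by (intro power_mono) auto
  then have "S * S \<le> L\<^sup>2 * S"
    unfolding power_mult_distrib nv by (simp add: power2_eq_square)
  then show ?thesis
    unfolding S_def[symmetric] using \<open>S \<ge> 0\<close> by (cases "S = 0") auto
qed

section \<open>Mollification along the coordinate axes\<close>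

text \<open>Substituting \<open>r = t + \<epsilon> * s\<close> moves the parameter from
  \<open>g\<close>, which is merely continuous, to the smooth kernel.\<close>

lemma bump_convolution_derivative:
  assumes g: "continuous_on UNIV g" and "\<epsilon> > 0"
  shows "((\<lambda>t. integral {-1..1} (\<lambda>s. bump m s * g (t + \<epsilon> * s))) has_real_derivative
    (- 1 / \<epsilon>) * integral {-1..1} (\<lambda>s. bump (Suc m) s * g (\<epsilon> * s))) (at 0)"
proof -
  \<comment> \<open>For \<open>\<bar>t\<bar> < 1\<close> the shifted kernel lives in [-R, R], so the
    domain of integration can be fixed before differentiating.\<close>
  define R where "R = 1 + \<epsilon>"
  define Q where "Q m t = integral {-R..R} (\<lambda>r. bump m ((r - t) / \<epsilon>) * g r)" for m t
  have gc: "continuous_on A (\<lambda>x. g (h x))" if "continuous_on A h" for A and h :: "'a::topological_space \<Rightarrow> real"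
    using continuous_on_compose2[OF g that] by simp
  have bc: "continuous_on A (\<lambda>x. bump m (h x))" if "continuous_on A h" for A m and h :: "'a::topological_space \<Rightarrow> real"
    using continuous_on_compose2[OF bump_continuous[of UNIV] that] by simp
  have A: "integral {-1..1} (\<lambda>s. bump m s * g (t + \<epsilon> * s)) = Q m t / \<epsilon>" if "\<bar>t\<bar> < 1" for m t
  proof -
    have "((\<lambda>r. bump m ((r - t) / \<epsilon>) * g r) has_integral Q m t) (cbox (-R) R)"
      unfolding Q_def cbox_interval using \<open>\<epsilon> > 0\<close>
      by (intro integrable_integral integrable_continuous_interval continuous_intros bc gc) auto
    moreover have "(\<lambda>s. bump m ((\<epsilon> *\<^sub>R s + t - t) / \<epsilon>) * g (\<epsilon> *\<^sub>R s + t)) = (\<lambda>s. bump m s * g (\<epsilon> * s + t))"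
      using \<open>\<epsilon> > 0\<close> by simp
    ultimately have "((\<lambda>s. bump m s * g (\<epsilon> * s + t)) has_integral Q m t / \<epsilon>) {(- R - t) / \<epsilon>..(R - t) / \<epsilon>}"
      using has_integral_affinity'[of "\<lambda>r. bump m ((r - t) / \<epsilon>) * g r" "Q m t" "-R" R \<epsilon> t] \<open>\<epsilon> > 0\<close>
      by (simp only: cbox_interval) (simp add: divide_inverse_commute)
    moreover have "integral {(- R - t) / \<epsilon>..(R - t) / \<epsilon>} (\<lambda>s. bump m s * g (\<epsilon> * s + t))
        = integral {-1..1} (\<lambda>s. bump m s * g (\<epsilon> * s + t))"
    proof (rule integral_unique, rule has_integral_on_superset)
      show "((\<lambda>s. bump m s * g (\<epsilon> * s + t)) has_integral integral {-1..1} (\<lambda>s. bump m s * g (\<epsilon> * s + t))) {-1..1}"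
        by (intro integrable_integral integrable_continuous_interval continuous_intros bc gc)
      show "{-1..1} \<subseteq> {(- R - t) / \<epsilon>..(R - t) / \<epsilon>}"
        using \<open>\<epsilon> > 0\<close> that by (auto simp: R_def divide_le_eq le_divide_eq)
      fix s :: real assume "s \<notin> {-1..1}"
      then have "1 \<le> \<bar>s\<bar>" by auto
      then show "bump m s * g (\<epsilon> * s + t) = 0"
        by (simp add: bump_support)
    qed
    ultimately show ?thesis
      by (simp add: integral_unique add.commute)
  qed
  have "((\<lambda>t. integral (cbox (-R) R) (\<lambda>r. bump m ((r - t) / \<epsilon>) * g r)) has_real_derivative
      integral (cbox (-R) R) (\<lambda>r. bump (Suc m) ((r - 0) / \<epsilon>) * (- 1 / \<epsilon>) * g r)) (at 0 within {-1<..<1})"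
  proof (rule leibniz_rule_field_derivative[where fx = "\<lambda>t r. bump (Suc m) ((r - t) / \<epsilon>) * (- 1 / \<epsilon>) * g r"])
    fix t r :: real
    have "((\<lambda>t. (r - t) / \<epsilon>) has_real_derivative (- 1 / \<epsilon>)) (at t)"
      using \<open>\<epsilon> > 0\<close> by (auto intro!: derivative_eq_intros)
    from DERIV_cmult_right[OF DERIV_chain2[OF bump_has_derivative this], of m "g r"]
    show "((\<lambda>t. bump m ((r - t) / \<epsilon>) * g r) has_real_derivative
        bump (Suc m) ((r - t) / \<epsilon>) * (- 1 / \<epsilon>) * g r) (at t within {-1<..<1})"
      by (rule has_field_derivative_at_within)
    show "(\<lambda>r. bump m ((r - t) / \<epsilon>) * g r) integrable_on cbox (-R) R"
      using \<open>\<epsilon> > 0\<close> by (intro integrable_continuous continuous_intros bc gc) auto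
    show "continuous_on ({-1<..<1} \<times> cbox (-R) R)
       (\<lambda>(t, r). bump (Suc m) ((r - t) / \<epsilon>) * (- 1 / \<epsilon>) * g r)"
      unfolding case_prod_beta using \<open>\<epsilon> > 0\<close> by (intro continuous_intros bc gc) auto
  qed auto
  moreover have "integral (cbox (-R) R) (\<lambda>r. bump (Suc m) ((r - 0) / \<epsilon>) * (- 1 / \<epsilon>) * g r) = (- 1 / \<epsilon>) * Q (Suc m) 0"
    unfolding Q_def cbox_interval integral_mult_right[symmetric] by (intro integral_cong) simp
  ultimately have "(Q m has_real_derivative (- 1 / \<epsilon>) * Q (Suc m) 0) (at 0)"
    by (simp add: Q_def[abs_def] at_within_open[of 0 "{-1<..<1}"])
  from DERIV_cdivide[OF this, of \<epsilon>]
  have "((\<lambda>t. Q m t / \<epsilon>) has_real_derivative (- 1 / \<epsilon>) * integral {-1..1} (\<lambda>s. bump (Suc m) s * g (\<epsilon> * s))) (at 0)"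
    using A[of 0 "Suc m"] by simp
  then show ?thesis
    by (rule has_field_derivative_transform_within_open[where S = "{-1<..<1}"]) (auto simp: A)
qed

text \<open>Expand the nonnegative integral of \<open>(f - I / 2)^2\<close>, where
  \<open>I / 2\<close> is the mean of \<open>f\<close>; the factor 2 is the length of the
  interval.\<close>

lemma cauchy_schwarz_interval:
  fixes f :: "real \<Rightarrow> real"
  assumes "continuous_on {-1..1} f"
  shows "(integral {-1..1} f)\<^sup>2 \<le> 2 * integral {-1..1} (\<lambda>s. (f s)\<^sup>2)"
proof -
  define I where "I = integral {-1..1} f"
  have "0 \<le> integral {-1..1} (\<lambda>s. (f s - I / 2)\<^sup>2)"
    by (intro integral_nonneg integrable_continuous_interval continuous_on_power continuous_on_diff
        continuous_on_const assms) auto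
  also have "integral {-1..1} (\<lambda>s. (f s - I / 2)\<^sup>2) = integral {-1..1} (\<lambda>s. (f s)\<^sup>2 - I * f s + I\<^sup>2 / 4)"
    by (intro integral_cong) (simp add: power2_eq_square algebra_simps)
  also have "\<dots> = integral {-1..1} (\<lambda>s. (f s)\<^sup>2 - I * f s) + integral {-1..1} (\<lambda>s::real. I\<^sup>2 / 4)"
    by (rule Henstock_Kurzweil_Integration.integral_add)
      (intro integrable_continuous_interval continuous_intros assms)+
  also have "integral {-1..1} (\<lambda>s. (f s)\<^sup>2 - I * f s) = integral {-1..1} (\<lambda>s. (f s)\<^sup>2) - integral {-1..1} (\<lambda>s. I * f s)"
    by (rule Henstock_Kurzweil_Integration.integral_diff)
      (intro integrable_continuous_interval continuous_intros assms)+
  finally show ?thesis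
    by (simp add: I_def[symmetric] power2_eq_square)
qed

section \<open>Averaging in one coordinate\<close>

locale mollifier =
  fixes \<epsilon> :: "nat \<Rightarrow> real"
  assumes eps_pos: "\<epsilon> i > 0" and eps_summable: "summable (\<lambda>i. (\<epsilon> i)\<^sup>2)"
begin

text \<open>
  Averaging over a segment of half-length \<open>\<epsilon> i\<close> in the direction of the \<open>i\<close>-th unit vector; for \<open>m > 0\<close>
  this is the \<open>m\<close>-th partial derivative of the average, with the derivative moved to the kernel.
\<close>

definition conv :: "nat \<Rightarrow> nat \<Rightarrow> (ell2 \<Rightarrow> real) \<Rightarrow> ell2 \<Rightarrow> real"
  where "conv i m u x = (- 1 / \<epsilon> i) ^ m *
    integral {-1..1} (\<lambda>s. bump m s * u (x + (\<epsilon> i * s) *\<^sub>R unit_vec i))"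

text \<open>A bound for the norm of \<open>conv i m\<close> on bounded functions, namely the L1 norm
  of the rescaled kernel. It equals 1 for \<open>m = 0\<close>, so coordinates that are averaged but
  not differentiated cost nothing.\<close>

definition conv_bound :: "nat \<Rightarrow> nat \<Rightarrow> real"
  where "conv_bound i m = integral {-1..1} (\<lambda>s. \<bar>bump m s\<bar>) / \<epsilon> i ^ m"

lemma conv_integrand_continuous:
  assumes "continuous_on UNIV u"
  shows "continuous_on A (\<lambda>s. bump m s * u (x + (\<epsilon> i * s) *\<^sub>R unit_vec i))"
  by (intro continuous_intros bump_continuous continuous_on_compose2[OF assms]) auto

lemma conv_integrand_integrable:
  "continuous_on UNIV u \<Longrightarrow> (\<lambda>s. bump m s * u (x + (\<epsilon> i * s) *\<^sub>R unit_vec i)) integrable_on {-1..1}"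
  by (intro integrable_continuous_interval conv_integrand_continuous)

lemma conv_bound_nonneg: "0 \<le> conv_bound i m"
  unfolding conv_bound_def using eps_pos[of i]
  by (intro divide_nonneg_nonneg integral_nonneg integrable_continuous_interval continuous_intros bump_continuous) auto

lemma conv_bound_0: "conv_bound i 0 = 1"
  using bump_integral bump_nonneg by (simp add: conv_bound_def)

lemma conv_abs_le:
  assumes u: "continuous_on UNIV u" and B: "\<And>s. \<bar>s\<bar> \<le> 1 \<Longrightarrow> \<bar>u (x + (\<epsilon> i * s) *\<^sub>R unit_vec i)\<bar> \<le> B"
  shows "\<bar>conv i m u x\<bar> \<le> conv_bound i m * B"
proof -
  have "norm (integral {-1..1} (\<lambda>s. bump m s * u (x + (\<epsilon> i * s) *\<^sub>R unit_vec i)))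
      \<le> integral {-1..1} (\<lambda>s. \<bar>bump m s\<bar> * B)"
  proof (rule integral_norm_bound_integral)
    show "(\<lambda>s. \<bar>bump m s\<bar> * B) integrable_on {-1..1}"
      by (intro integrable_continuous_interval continuous_intros bump_continuous)
    fix s :: real assume "s \<in> {-1..1}"
    then show "norm (bump m s * u (x + (\<epsilon> i * s) *\<^sub>R unit_vec i)) \<le> \<bar>bump m s\<bar> * B"
      unfolding real_norm_def abs_mult by (intro mult_left_mono B) auto
  qed (rule conv_integrand_integrable[OF u])
  then have "\<bar>- 1 / \<epsilon> i\<bar> ^ m * \<bar>integral {-1..1} (\<lambda>s. bump m s * u (x + (\<epsilon> i * s) *\<^sub>R unit_vec i))\<bar>
      \<le> \<bar>- 1 / \<epsilon> i\<bar> ^ m * (integral {-1..1} (\<lambda>s. \<bar>bump m s\<bar>) * B)"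
    by (intro mult_left_mono) auto
  then show ?thesis
    using eps_pos[of i] by (simp add: conv_def conv_bound_def abs_mult power_abs power_divide)
qed

lemma conv_continuous:
  assumes "continuous_on UNIV u"
  shows "continuous_on UNIV (conv i m u)"
proof -
  have "continuous_on UNIV (\<lambda>x. integral (cbox (-1) 1) (\<lambda>s. bump m s * u (x + (\<epsilon> i * s) *\<^sub>R unit_vec i)))"
    by (rule integral_continuous_on_param)
       (auto simp: case_prod_beta intro!: continuous_intros continuous_on_compose2[OF assms]
         continuous_on_compose2[OF bump_continuous[of UNIV]])
  then show ?thesis
    unfolding conv_def[abs_def] cbox_interval by (intro continuous_intros)
qed

lemma conv_add:
  assumes "continuous_on UNIV u" "continuous_on UNIV w"
  shows "conv i m (\<lambda>y. u y + w y) x = conv i m u x + conv i m w x"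
  unfolding conv_def
  by (simp add: distrib_left Henstock_Kurzweil_Integration.integral_add conv_integrand_integrable[OF assms(1)] conv_integrand_integrable[OF assms(2)])

lemma conv_cmult:
  "conv i m (\<lambda>y. c * u y) x = c * conv i m u x"
  by (simp add: conv_def mult.left_commute[of _ c])

lemma conv_const: "conv i 0 (\<lambda>_. c) x = c"
  using bump_integral by (simp add: conv_def)

lemma conv_translate: "conv i m (\<lambda>y. u (y + h)) x = conv i m u (x + h)"
  by (simp add: conv_def add_ac)

lemma conv_sum:
  assumes "finite I" "\<And>j. j \<in> I \<Longrightarrow> continuous_on UNIV (w j)"
  shows "conv i m (\<lambda>y. \<Sum>j\<in>I. w j y) x = (\<Sum>j\<in>I. conv i m (w j) x)"
  using assms
proof (induction rule: finite_induct)
  case empty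
  then show ?case by (simp add: conv_def)
next
  case (insert j I)
  then show ?case
    by (simp add: conv_add continuous_on_sum)
qed

lemma conv_mono:
  assumes "continuous_on UNIV u" "continuous_on UNIV w" "\<And>y. u y \<le> w y"
  shows "conv i 0 u x \<le> conv i 0 w x"
  unfolding conv_def
  by (auto intro!: integral_le conv_integrand_integrable assms mult_left_mono bump_nonneg)

lemma conv_has_dir_deriv_unit:
  assumes "continuous_on UNIV u"
  shows "has_dir_deriv (conv i m u) (unit_vec i) x (conv i (Suc m) u x)"
proof -
  have "continuous_on UNIV (\<lambda>r. u (x + r *\<^sub>R unit_vec i))"
    by (intro continuous_intros continuous_on_compose2[OF assms]) auto
  from bump_convolution_derivative[OF this eps_pos[of i], of m, THEN DERIV_cmult, of "(- 1 / \<epsilon> i) ^ m"]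
  show ?thesis
    unfolding has_dir_deriv_def conv_def
    by (simp add: scaleR_add_left add_ac mult_ac)
qed

text \<open>Here the derivative falls on \<open>u\<close> rather than on the kernel. It serves two
  purposes: passing a coordinate derivative through averages in other coordinates, and
  differentiating averages of smooth functions in arbitrary directions.\<close>

lemma conv_has_dir_deriv:
  assumes u: "continuous_on UNIV u" "continuous_on UNIV u'" "\<And>z. has_dir_deriv u v z (u' z)"
  shows "has_dir_deriv (conv i m u) v x (conv i m u' x)"
proof -
  let ?p = "\<lambda>t s. x + t *\<^sub>R v + (\<epsilon> i * s) *\<^sub>R unit_vec i"
  have "((\<lambda>t. integral (cbox (-1) 1) (\<lambda>s. bump m s * u (?p t s))) has_real_derivative
      integral (cbox (-1) 1) (\<lambda>s. bump m s * u' (?p 0 s))) (at 0 within UNIV)"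
  proof (rule leibniz_rule_field_derivative[where fx = "\<lambda>t s. bump m s * u' (?p t s)"])
    fix t s
    have "((\<lambda>t. u ((x + (\<epsilon> i * s) *\<^sub>R unit_vec i) + t *\<^sub>R v)) has_real_derivative
        u' ((x + (\<epsilon> i * s) *\<^sub>R unit_vec i) + t *\<^sub>R v)) (at t)"
      using u(3) by (simp add: has_dir_deriv_line[symmetric])
    then have "((\<lambda>t. u (?p t s)) has_real_derivative u' (?p t s)) (at t)"
      by (simp add: add_ac)
    from DERIV_cmult[OF this, of "bump m s"]
    show "((\<lambda>t. bump m s * u (?p t s)) has_real_derivative bump m s * u' (?p t s)) (at t within UNIV)" .
    show "(\<lambda>s. bump m s * u (?p t s)) integrable_on cbox (-1) 1"
      by (intro integrable_continuous continuous_intros bump_continuous continuous_on_compose2[OF u(1)]) auto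
    show "continuous_on (UNIV \<times> cbox (-1) 1) (\<lambda>(t, s). bump m s * u' (?p t s))"
      unfolding case_prod_beta
      by (intro continuous_intros continuous_on_compose2[OF bump_continuous[of UNIV]] continuous_on_compose2[OF u(2)]) auto
  qed auto
  from DERIV_cmult[OF this, of "(- 1 / \<epsilon> i) ^ m"] show ?thesis
    by (simp add: has_dir_deriv_def conv_def)
qed

section \<open>Averages over finitely many coordinates\<close>

definition iter :: "nat list \<Rightarrow> (nat \<Rightarrow> nat) \<Rightarrow> (ell2 \<Rightarrow> real) \<Rightarrow> ell2 \<Rightarrow> real"
  where "iter is \<alpha> = foldr (\<lambda>i. conv i (\<alpha> i)) is"

lemma iter_Nil [simp]: "iter [] \<alpha> u = u"
  and iter_Cons [simp]: "iter (i # is) \<alpha> u = conv i (\<alpha> i) (iter is \<alpha> u)"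
  and iter_append: "iter (is @ js) \<alpha> u = iter is \<alpha> (iter js \<alpha> u)"
  by (simp_all add: iter_def)

lemma iter_continuous: "continuous_on UNIV u \<Longrightarrow> continuous_on UNIV (iter is \<alpha> u)"
  by (induction "is") (auto intro: conv_continuous)

lemma iter_cong: "(\<And>i. i \<in> set is \<Longrightarrow> \<alpha> i = \<beta> i) \<Longrightarrow> iter is \<alpha> u = iter is \<beta> u"
  by (induction "is") auto

lemma iter_diff:
  assumes "continuous_on UNIV u" "continuous_on UNIV w"
  shows "iter is \<alpha> (\<lambda>y. u y - w y) = (\<lambda>x. iter is \<alpha> u x - iter is \<alpha> w x)"
proof (induction "is")
  case (Cons i "is")
  have c: "continuous_on UNIV (iter is \<alpha> u)" "continuous_on UNIV (\<lambda>x. - 1 * iter is \<alpha> w x)"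
    by (intro continuous_intros iter_continuous assms)+
  show ?case
    using conv_add[OF c, of i "\<alpha> i"] conv_cmult[of i "\<alpha> i" "-1" "iter is \<alpha> w"]
    by (simp add: Cons fun_eq_iff)
qed simp

lemma iter_translate: "iter is \<alpha> (\<lambda>y. u (y + h)) = (\<lambda>x. iter is \<alpha> u (x + h))"
proof (induction "is")
  case (Cons i "is")
  show ?case
    unfolding iter_Cons Cons by (rule ext) (rule conv_translate)
qed simp

lemma iter_const: "iter is (\<lambda>_. 0) (\<lambda>_. c) = (\<lambda>_. c)"
  by (induction "is") (auto simp: conv_const)

text \<open>The points at which averages over the coordinates in \<open>I\<close>, taken at
  \<open>x\<close>, can evaluate their argument.\<close>

definition box_over :: "nat set \<Rightarrow> ell2 \<Rightarrow> ell2 set"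
  where "box_over I x = {y. \<forall>i. \<bar>coord y i - coord x i\<bar> \<le> (if i \<in> I then \<epsilon> i else 0)}"

lemma box_over_mono:
  assumes "I \<subseteq> J"
  shows "box_over I x \<subseteq> box_over J x"
  unfolding box_over_def
proof (intro Collect_mono impI allI)
  fix y i assume "\<forall>i. \<bar>coord y i - coord x i\<bar> \<le> (if i \<in> I then \<epsilon> i else 0)"
  then have "\<bar>coord y i - coord x i\<bar> \<le> (if i \<in> I then \<epsilon> i else 0)"
    by blast
  also have "\<dots> \<le> (if i \<in> J then \<epsilon> i else 0)"
    using assms less_imp_le[OF eps_pos[of i]] by auto
  finally show "\<bar>coord y i - coord x i\<bar> \<le> (if i \<in> J then \<epsilon> i else 0)" .
qed

lemma box_over_self: "x \<in> box_over I x"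
  using less_imp_le[OF eps_pos] by (simp add: box_over_def)

text \<open>As the list is distinct, each coordinate is displaced at most once and by at most
  \<open>\<epsilon> i\<close>, so evaluation stays inside the box while the kernel bounds
  multiply.\<close>

lemma iter_abs_le:
  assumes "continuous_on UNIV u" "distinct is"
  shows "(\<And>y. y \<in> box_over (set is) x \<Longrightarrow> \<bar>u y\<bar> \<le> B) \<Longrightarrow>
    \<bar>iter is \<alpha> u x\<bar> \<le> (\<Prod>i\<in>set is. conv_bound i (\<alpha> i)) * B"
  using assms(2)
proof (induction "is" arbitrary: x)
  case Nil
  then show ?case using box_over_self[of x "{}"] by simp
next
  case (Cons i "is")
  have "\<bar>conv i (\<alpha> i) (iter is \<alpha> u) x\<bar> \<le> conv_bound i (\<alpha> i) * ((\<Prod>i\<in>set is. conv_bound i (\<alpha> i)) * B)"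
  proof (rule conv_abs_le[OF iter_continuous[OF assms(1)]])
    fix s :: real assume s: "\<bar>s\<bar> \<le> 1"
    show "\<bar>iter is \<alpha> u (x + (\<epsilon> i * s) *\<^sub>R unit_vec i)\<bar> \<le> (\<Prod>i\<in>set is. conv_bound i (\<alpha> i)) * B"
    proof (rule Cons.IH)
      fix y assume y: "y \<in> box_over (set is) (x + (\<epsilon> i * s) *\<^sub>R unit_vec i)"
      have "y \<in> box_over (set (i # is)) x"
        unfolding box_over_def
      proof (intro CollectI allI)
        fix j
        have j: "\<bar>coord y j - (coord x j + (if j = i then \<epsilon> i * s else 0))\<bar> \<le> (if j \<in> set is then \<epsilon> j else 0)"
        proof -
          have "coord (x + (\<epsilon> i * s) *\<^sub>R unit_vec i) j = coord x j + (if j = i then \<epsilon> i * s else 0)"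
            by (simp add: coord_add coord_scaleR coord_unit_vec)
          moreover have "\<bar>coord y j - coord (x + (\<epsilon> i * s) *\<^sub>R unit_vec i) j\<bar> \<le> (if j \<in> set is then \<epsilon> j else 0)"
            using y unfolding box_over_def by blast
          ultimately show ?thesis by simp
        qed
        show "\<bar>coord y j - coord x j\<bar> \<le> (if j \<in> set (i # is) then \<epsilon> j else 0)"
        proof (cases "j = i")
          case True
          then have "coord y j - coord x j = \<epsilon> i * s"
            using j Cons.prems(2) by simp
          moreover have "\<bar>\<epsilon> i * s\<bar> \<le> \<epsilon> i"
            using s eps_pos[of i] by (simp add: abs_mult mult_left_le)
          ultimately show ?thesis
            using True by simp
        qed (use j in simp)
      qed
      then show "\<bar>u y\<bar> \<le> B"
        by (rule Cons.prems(1))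
    qed (use Cons.prems in simp)
  qed
  then show ?case
    using Cons.prems(2) by (simp add: mult.assoc)
qed

text \<open>The derivative passes through the averages in other coordinates until it meets the one
  for \<open>i\<close>, whose kernel absorbs it; \<open>u\<close> itself need not be
  differentiable.\<close>

lemma iter_has_dir_deriv_unit:
  assumes "continuous_on UNIV u"
  shows "distinct is \<Longrightarrow> i \<in> set is \<Longrightarrow>
    has_dir_deriv (iter is \<alpha> u) (unit_vec i) x (iter is (\<alpha>(i := Suc (\<alpha> i))) u x)"
proof (induction "is" arbitrary: x)
  case (Cons j "is")
  show ?case
  proof (cases "j = i")
    case True
    then have "iter is (\<alpha>(i := Suc (\<alpha> i))) u = iter is \<alpha> u"
      using Cons.prems by (intro iter_cong) auto
    then have "iter (j # is) (\<alpha>(i := Suc (\<alpha> i))) u = conv i (Suc (\<alpha> i)) (iter is \<alpha> u)"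
      using True by (simp del: fun_upd_apply add: fun_upd_same)
    then show ?thesis
      using conv_has_dir_deriv_unit[OF iter_continuous[OF assms]] by (simp only: True iter_Cons)
  next
    case False
    then show ?thesis
      using Cons by (auto intro!: conv_has_dir_deriv iter_continuous assms)
  qed
qed simp

lemma iter_has_dir_deriv:
  assumes "continuous_on UNIV u" "continuous_on UNIV u'" "\<And>z. has_dir_deriv u v z (u' z)"
  shows "has_dir_deriv (iter is \<alpha> u) v x (iter is \<alpha> u' x)"
  by (induction "is" arbitrary: x) (auto intro!: conv_has_dir_deriv iter_continuous assms)

section \<open>Passage to infinitely many coordinates\<close>

definition tail :: "nat \<Rightarrow> real"
  where "tail n = sqrt (suminf (\<lambda>i. (\<epsilon> i)\<^sup>2) - (\<Sum>i<n. (\<epsilon> i)\<^sup>2))"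

lemma tail_tendsto_0: "tail \<longlonglongrightarrow> 0"
proof -
  have "(\<lambda>n. sqrt (suminf (\<lambda>i. (\<epsilon> i)\<^sup>2) - (\<Sum>i<n. (\<epsilon> i)\<^sup>2))) \<longlonglongrightarrow>
      sqrt (suminf (\<lambda>i. (\<epsilon> i)\<^sup>2) - suminf (\<lambda>i. (\<epsilon> i)\<^sup>2))"
    by (intro tendsto_intros summable_LIMSEQ eps_summable)
  then show ?thesis
    unfolding tail_def by simp
qed

lemma box_over_norm_le:
  assumes "I \<subseteq> {n..}" "y \<in> box_over I x"
  shows "norm (y - x) \<le> tail n"
proof -
  have s: "(\<lambda>i. (\<epsilon> i)\<^sup>2 - (if i < n then (\<epsilon> i)\<^sup>2 else 0)) sums (suminf (\<lambda>i. (\<epsilon> i)\<^sup>2) - (\<Sum>i<n. (\<epsilon> i)\<^sup>2))"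
    using sums_If_finite[of "\<lambda>i. i < n" "\<lambda>i. (\<epsilon> i)\<^sup>2"] eps_summable
    by (intro sums_diff) (auto simp: summable_sums lessThan_def)
  have "(norm (y - x))\<^sup>2 \<le> suminf (\<lambda>i. (\<epsilon> i)\<^sup>2 - (if i < n then (\<epsilon> i)\<^sup>2 else 0))"
    unfolding norm_ell2_sq
  proof (rule suminf_le[OF _ summable_coord_sq sums_summable[OF s]])
    fix i
    have "\<bar>coord (y - x) i\<bar> \<le> (if i \<in> I then \<epsilon> i else 0)"
      using assms(2) by (simp add: box_over_def coord_diff)
    then have "\<bar>coord (y - x) i\<bar>\<^sup>2 \<le> (if i \<in> I then \<epsilon> i else 0)\<^sup>2"
      by (intro power_mono) auto
    then show "(coord (y - x) i)\<^sup>2 \<le> (\<epsilon> i)\<^sup>2 - (if i < n then (\<epsilon> i)\<^sup>2 else 0)"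
      using assms(1) by (auto split: if_splits)
  qed
  then have "sqrt ((norm (y - x))\<^sup>2) \<le> tail n"
    unfolding tail_def sums_unique[OF s, symmetric] by (rule real_sqrt_le_mono)
  then show ?thesis by simp
qed

text \<open>Coordinate 0 is averaged outermost, so increasing \<open>n\<close> inserts a new average
  innermost, next to \<open>u\<close>. The estimate of successive differences rests on this
  order.\<close>

definition mollify :: "(nat \<Rightarrow> nat) \<Rightarrow> (ell2 \<Rightarrow> real) \<Rightarrow> ell2 \<Rightarrow> real"
  where "mollify \<alpha> u x = lim (\<lambda>n. iter [0..<n] \<alpha> u x)"

definition order_bound :: "nat \<Rightarrow> (nat \<Rightarrow> nat) \<Rightarrow> real"
  where "order_bound m \<alpha> = (\<Prod>i<m. conv_bound i (\<alpha> i))"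

lemma order_bound_nonneg: "0 \<le> order_bound m \<alpha>"
  by (auto simp: order_bound_def intro: prod_nonneg conv_bound_nonneg)

lemma order_bound_0: "order_bound m (\<lambda>_. 0) = 1"
  by (simp add: order_bound_def conv_bound_0)

lemma prod_conv_bound:
  assumes "\<And>i. m \<le> i \<Longrightarrow> \<alpha> i = 0" "m \<le> n"
  shows "(\<Prod>i\<in>set [0..<n]. conv_bound i (\<alpha> i)) = order_bound m \<alpha>"
  unfolding order_bound_def
  by (rule prod.mono_neutral_right) (use assms conv_bound_0 in auto)

text \<open>The additional inner averages have order 0, hence mass one, and displace their argument
  by at most \<open>tail n\<close>; so they change \<open>u\<close> by at most
  \<open>L * tail n\<close>, and the outer averages amplify this by
  \<open>order_bound m \<alpha>\<close>. The Lipschitz condition is required only on the box around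
  \<open>x\<close>, so that derivatives which are Lipschitz only locally can be averaged
  too.\<close>

lemma iter_diff_le:
  assumes u: "continuous_on UNIV u" and \<alpha>: "\<And>i. m \<le> i \<Longrightarrow> \<alpha> i = 0"
    and L: "\<And>y z. y \<in> box_over UNIV x \<Longrightarrow> z \<in> box_over UNIV x \<Longrightarrow> \<bar>u y - u z\<bar> \<le> L * norm (y - z)"
    and "0 \<le> L" "m \<le> n" "n \<le> n'"
  shows "\<bar>iter [0..<n'] \<alpha> u x - iter [0..<n] \<alpha> u x\<bar> \<le> order_bound m \<alpha> * (L * tail n)"
proof -
  let ?w = "iter [n..<n'] \<alpha> u"
  have split: "iter [0..<n'] \<alpha> u = iter [0..<n] \<alpha> ?w"
    using upt_add_eq_append[of 0 n "n' - n"] \<open>n \<le> n'\<close> by (simp add: iter_append[symmetric])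
  have w: "continuous_on UNIV ?w"
    by (rule iter_continuous[OF u])
  have "\<bar>iter [0..<n] \<alpha> (\<lambda>y. ?w y - u y) x\<bar> \<le> (\<Prod>i\<in>set [0..<n]. conv_bound i (\<alpha> i)) * (L * tail n)"
  proof (rule iter_abs_le)
    fix y assume y: "y \<in> box_over (set [0..<n]) x"
    have 0: "iter [n..<n'] \<alpha> v = iter [n..<n'] (\<lambda>_. 0) v" for v
      using \<alpha> \<open>m \<le> n\<close> by (intro iter_cong) auto
    have "?w y - u y = iter [n..<n'] \<alpha> (\<lambda>z. u z - u y) y"
      using iter_diff[OF u continuous_on_const[of _ "u y"], of "[n..<n']" \<alpha>] 0[of "\<lambda>_. u y"]
      by (simp add: iter_const)
    also have "\<bar>\<dots>\<bar> \<le> (\<Prod>i\<in>set [n..<n']. conv_bound i (\<alpha> i)) * (L * tail n)"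
    proof (rule iter_abs_le)
      show "continuous_on UNIV (\<lambda>z. u z - u y)"
        by (intro continuous_intros u)
      fix z assume z: "z \<in> box_over (set [n..<n']) y"
      have "z \<in> box_over UNIV x"
        unfolding box_over_def
      proof (intro CollectI allI)
        fix i
        have "\<bar>coord z i - coord y i\<bar> \<le> (if i \<in> set [n..<n'] then \<epsilon> i else 0)"
          "\<bar>coord y i - coord x i\<bar> \<le> (if i \<in> set [0..<n] then \<epsilon> i else 0)"
          using y z by (auto simp: box_over_def)
        then show "\<bar>coord z i - coord x i\<bar> \<le> (if i \<in> UNIV then \<epsilon> i else 0)"
          using eps_pos[of i] by (auto split: if_splits)
      qed
      moreover have "y \<in> box_over UNIV x"
        using y box_over_mono[of _ UNIV] by blast
      ultimately have "\<bar>u z - u y\<bar> \<le> L * norm (z - y)"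
        by (rule L)
      also have "\<dots> \<le> L * tail n"
        by (intro mult_left_mono box_over_norm_le[OF _ z] \<open>0 \<le> L\<close>) auto
      finally show "\<bar>u z - u y\<bar> \<le> L * tail n" .
    qed simp
    also have "(\<Prod>i\<in>set [n..<n']. conv_bound i (\<alpha> i)) = 1"
      using \<alpha> \<open>m \<le> n\<close> by (intro prod.neutral) (auto simp: conv_bound_0)
    finally show "\<bar>?w y - u y\<bar> \<le> L * tail n" by simp
  qed (auto intro!: continuous_intros w u)
  also have "(\<Prod>i\<in>set [0..<n]. conv_bound i (\<alpha> i)) = order_bound m \<alpha>"
    using prod_conv_bound[OF \<alpha> \<open>m \<le> n\<close>] .
  finally show ?thesis
    by (simp add: split iter_diff[OF w u])
qed

lemma iter_tendsto:
  assumes u: "continuous_on UNIV u" and \<alpha>: "\<And>i. m \<le> i \<Longrightarrow> \<alpha> i = 0"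
    and L: "\<And>y z. y \<in> box_over UNIV x \<Longrightarrow> z \<in> box_over UNIV x \<Longrightarrow> \<bar>u y - u z\<bar> \<le> L * norm (y - z)"
    and "0 \<le> L"
  shows "(\<lambda>n. iter [0..<n] \<alpha> u x) \<longlonglongrightarrow> mollify \<alpha> u x"
    and "m \<le> n \<Longrightarrow> \<bar>iter [0..<n] \<alpha> u x - mollify \<alpha> u x\<bar> \<le> order_bound m \<alpha> * (L * tail n)"
proof -
  have rate: "\<bar>iter [0..<n'] \<alpha> u x - iter [0..<n] \<alpha> u x\<bar> \<le> order_bound m \<alpha> * (L * tail n)" if "m \<le> n" "n \<le> n'" for n n'
    using iter_diff_le[OF u \<alpha> L \<open>0 \<le> L\<close> that] by simp
  have lim0: "(\<lambda>n. order_bound m \<alpha> * (L * tail n)) \<longlonglongrightarrow> 0"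
    by (intro tendsto_mult_right_zero tail_tendsto_0)
  have "Cauchy (\<lambda>n. iter [0..<n] \<alpha> u x)"
  proof (rule metric_CauchyI)
    fix e :: real assume "e > 0"
    then have "\<forall>\<^sub>F n in sequentially. order_bound m \<alpha> * (L * tail n) < e / 2"
      using order_tendstoD(2)[OF lim0, of "e / 2"] by simp
    moreover have "\<forall>\<^sub>F n in sequentially. m \<le> n"
      by (rule eventually_ge_at_top)
    ultimately obtain N where N: "order_bound m \<alpha> * (L * tail N) < e / 2" "m \<le> N"
      by (metis (mono_tags, lifting) eventually_conj eventually_happens trivial_limit_sequentially)
    have "dist (iter [0..<p] \<alpha> u x) (iter [0..<q] \<alpha> u x) < e" if "p \<ge> N" "q \<ge> N" for p q
      using rate[OF N(2) that(1)] rate[OF N(2) that(2)] N(1) unfolding dist_real_def by linarith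
    then show "\<exists>N. \<forall>p\<ge>N. \<forall>q\<ge>N. dist (iter [0..<p] \<alpha> u x) (iter [0..<q] \<alpha> u x) < e"
      by blast
  qed
  then show lim: "(\<lambda>n. iter [0..<n] \<alpha> u x) \<longlonglongrightarrow> mollify \<alpha> u x"
    unfolding mollify_def by (simp add: Cauchy_convergent_iff convergent_LIMSEQ_iff)
  assume "m \<le> n"
  have "(\<lambda>n'. \<bar>iter [0..<n'] \<alpha> u x - iter [0..<n] \<alpha> u x\<bar>) \<longlonglongrightarrow> \<bar>mollify \<alpha> u x - iter [0..<n] \<alpha> u x\<bar>"
    by (intro tendsto_intros lim)
  then have "\<bar>mollify \<alpha> u x - iter [0..<n] \<alpha> u x\<bar> \<le> order_bound m \<alpha> * (L * tail n)"
    by (rule LIMSEQ_le_const2) (use rate[OF \<open>m \<le> n\<close>] in blast)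
  then show "\<bar>iter [0..<n] \<alpha> u x - mollify \<alpha> u x\<bar> \<le> order_bound m \<alpha> * (L * tail n)"
    by (simp add: abs_minus_commute)
qed

end

section \<open>Derivatives of mollified functions\<close>

lemma continuous_on_of_lipschitz:
  fixes u :: "'a::real_normed_vector \<Rightarrow> real"
  assumes "\<And>x y. x \<in> A \<Longrightarrow> y \<in> A \<Longrightarrow> \<bar>u x - u y\<bar> \<le> L * norm (x - y)" "0 \<le> L"
  shows "continuous_on A u"
  by (rule lipschitz_on_continuous_on[of L], rule lipschitz_onI)
     (use assms in \<open>auto simp: dist_norm\<close>)

text \<open>The derivatives of the next order are bounded, and convexity keeps the segment of the
  mean value estimate inside \<open>W\<close>.\<close>

lemma smooth_bounded_lipschitz:
  assumes "convex W" "smooth_bounded W F"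
  shows "\<exists>L\<ge>0. \<forall>y\<in>W. \<forall>z\<in>W. \<bar>dir_derivs vs F y - dir_derivs vs F z\<bar> \<le> L * norm (y - z)"
proof -
  obtain M where M: "\<And>us x. length us = Suc (length vs) \<Longrightarrow> x \<in> W \<Longrightarrow>
      \<bar>dir_derivs us F x\<bar> \<le> M * prod_list (map norm us)"
    using smooth_bounded_bound[OF assms(2)] by blast
  let ?P = "prod_list (map norm vs)"
  have P: "0 \<le> ?P"
    by (rule prod_list_nonneg) auto
  have "\<bar>dir_derivs vs F y - dir_derivs vs F z\<bar> \<le> (\<bar>M\<bar> * ?P) * norm (y - z)" if "y \<in> W" "z \<in> W" for y z
  proof (rule dir_deriv_lipschitz[where U = W and d = "dir_derivs ((y - z) # vs) F"])
    show "closed_segment z y \<subseteq> W"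
      using that assms(1) by (simp add: closed_segment_subset)
    fix x assume x: "x \<in> W"
    show "has_dir_deriv (dir_derivs vs F) (y - z) x (dir_derivs ((y - z) # vs) F x)"
      by (rule smooth_bounded_deriv[OF assms(2) x])
    have "\<bar>dir_derivs ((y - z) # vs) F x\<bar> \<le> M * (norm (y - z) * ?P)"
      using M[of "(y - z) # vs" x] x by simp
    also have "\<dots> \<le> \<bar>M\<bar> * (norm (y - z) * ?P)"
      using P by (intro mult_right_mono) auto
    finally show "\<bar>dir_derivs ((y - z) # vs) F x\<bar> \<le> (\<bar>M\<bar> * ?P) * norm (y - z)"
      by (simp add: mult_ac)
  qed
  then show ?thesis
    using P by (intro exI[of _ "\<bar>M\<bar> * ?P"]) auto
qed

lemma smooth_bounded_continuous:
  assumes "\<And>x. \<exists>U. open U \<and> x \<in> U \<and> smooth_bounded U F"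
  shows "continuous_on UNIV (dir_derivs vs F)"
proof -
  have "isCont (dir_derivs vs F) x" for x
  proof -
    obtain U where U: "open U" "x \<in> U" "smooth_bounded U F"
      using assms by blast
    then obtain r where r: "r > 0" "ball x r \<subseteq> U"
      by (meson open_contains_ball)
    then obtain L where "0 \<le> L" "\<forall>y\<in>ball x r. \<forall>z\<in>ball x r.
        \<bar>dir_derivs vs F y - dir_derivs vs F z\<bar> \<le> L * norm (y - z)"
      using smooth_bounded_lipschitz[OF convex_ball smooth_bounded_subset[OF U(3) open_ball r(2)]] by blast
    then have "continuous_on (ball x r) (dir_derivs vs F)"
      by (intro continuous_on_of_lipschitz[of _ _ L]) auto
    then show ?thesis
      using r(1) by (simp add: continuous_on_eq_continuous_at)
  qed
  then show ?thesis
    by (simp add: continuous_on_eq_continuous_at)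
qed

context mollifier
begin

lemma mollify_abs_le:
  assumes u: "continuous_on UNIV u" and \<alpha>: "\<And>i. m \<le> i \<Longrightarrow> \<alpha> i = 0"
    and L: "\<And>y z. y \<in> box_over UNIV x \<Longrightarrow> z \<in> box_over UNIV x \<Longrightarrow> \<bar>u y - u z\<bar> \<le> L * norm (y - z)" "0 \<le> L"
    and B: "\<And>y. y \<in> box_over UNIV x \<Longrightarrow> \<bar>u y\<bar> \<le> B"
  shows "\<bar>mollify \<alpha> u x\<bar> \<le> order_bound m \<alpha> * B"
proof (rule LIMSEQ_le_const2)
  show "(\<lambda>n. \<bar>iter [0..<n] \<alpha> u x\<bar>) \<longlonglongrightarrow> \<bar>mollify \<alpha> u x\<bar>"
    by (intro tendsto_rabs iter_tendsto(1)[OF u \<alpha> L])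
  have "\<bar>iter [0..<n] \<alpha> u x\<bar> \<le> order_bound m \<alpha> * B" if "m \<le> n" for n
  proof -
    have "\<bar>iter [0..<n] \<alpha> u x\<bar> \<le> (\<Prod>i\<in>set [0..<n]. conv_bound i (\<alpha> i)) * B"
      by (rule iter_abs_le[OF u]) (use B box_over_mono[of _ UNIV] in auto)
    then show ?thesis
      using prod_conv_bound[OF \<alpha> that] by simp
  qed
  then show "\<exists>N. \<forall>n\<ge>N. \<bar>iter [0..<n] \<alpha> u x\<bar> \<le> order_bound m \<alpha> * B"
    by blast
qed

text \<open>The kernels of order 0 reproduce constants, so one may subtract \<open>c\<close> and use
  the bound with total kernel mass 1. With \<open>B = 0\<close> a function constant on the box keeps
  its exact value.\<close>

lemma mollify_near_const:
  assumes u: "continuous_on UNIV u"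
    and L: "\<And>y z. y \<in> box_over UNIV x \<Longrightarrow> z \<in> box_over UNIV x \<Longrightarrow> \<bar>u y - u z\<bar> \<le> L * norm (y - z)" "0 \<le> L"
    and B: "\<And>y. y \<in> box_over UNIV x \<Longrightarrow> \<bar>u y - c\<bar> \<le> B"
  shows "\<bar>mollify (\<lambda>_. 0) u x - c\<bar> \<le> B"
proof -
  have c: "continuous_on UNIV (\<lambda>y. u y - c)"
    by (intro continuous_intros u)
  have "iter [0..<n] (\<lambda>_. 0) (\<lambda>y. u y - c) x = iter [0..<n] (\<lambda>_. 0) u x - c" for n
    using iter_diff[OF u continuous_on_const[of _ c], of "[0..<n]" "\<lambda>_. 0"] by (simp add: iter_const)
  then have "(\<lambda>n. iter [0..<n] (\<lambda>_. 0) (\<lambda>y. u y - c) x) \<longlonglongrightarrow> mollify (\<lambda>_. 0) u x - c"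
    using iter_tendsto(1)[OF u _ L, of 0 "\<lambda>_. 0"] by (simp add: tendsto_diff)
  moreover have "(\<lambda>n. iter [0..<n] (\<lambda>_. 0) (\<lambda>y. u y - c) x) \<longlonglongrightarrow> mollify (\<lambda>_. 0) (\<lambda>y. u y - c) x"
    by (rule iter_tendsto(1)[OF c _ _ L(2), of 0]) (use L(1) in auto)
  ultimately have "mollify (\<lambda>_. 0) (\<lambda>y. u y - c) x = mollify (\<lambda>_. 0) u x - c"
    using LIMSEQ_unique by blast
  moreover have "\<bar>mollify (\<lambda>_. 0) (\<lambda>y. u y - c) x\<bar> \<le> order_bound 0 (\<lambda>_. 0) * B"
    by (rule mollify_abs_le[OF c _ _ L(2)]) (use L(1) B in auto)
  ultimately show ?thesis
    by (simp add: order_bound_0)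
qed

text \<open>Averaging commutes with translations, so the sup bound applies to the difference of
  \<open>u\<close> and its translate by \<open>x - y\<close>.\<close>

lemma mollify_lipschitz:
  assumes L: "\<And>x y. \<bar>u x - u y\<bar> \<le> L * norm (x - y)" "0 \<le> L" and \<alpha>: "\<And>i. m \<le> i \<Longrightarrow> \<alpha> i = 0"
  shows "\<bar>mollify \<alpha> u x - mollify \<alpha> u y\<bar> \<le> order_bound m \<alpha> * L * norm (x - y)"
proof (rule LIMSEQ_le_const2)
  have u: "continuous_on UNIV u"
    by (rule continuous_on_of_lipschitz[OF L])
  show "(\<lambda>n. \<bar>iter [0..<n] \<alpha> u x - iter [0..<n] \<alpha> u y\<bar>) \<longlonglongrightarrow> \<bar>mollify \<alpha> u x - mollify \<alpha> u y\<bar>"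
    by (intro tendsto_rabs tendsto_diff iter_tendsto(1)[OF u \<alpha> L])
  have "\<bar>iter [0..<n] \<alpha> u x - iter [0..<n] \<alpha> u y\<bar> \<le> order_bound m \<alpha> * L * norm (x - y)" if "m \<le> n" for n
  proof -
    have c: "continuous_on UNIV (\<lambda>z. u (z + (x - y)))"
      by (intro continuous_on_compose2[OF u] continuous_intros) auto
    have "\<bar>iter [0..<n] \<alpha> (\<lambda>z. u (z + (x - y)) - u z) y\<bar> \<le> (\<Prod>i\<in>set [0..<n]. conv_bound i (\<alpha> i)) * (L * norm (x - y))"
    proof (rule iter_abs_le)
      show "continuous_on UNIV (\<lambda>z. u (z + (x - y)) - u z)"
        by (intro continuous_intros c u)
      show "\<bar>u (z + (x - y)) - u z\<bar> \<le> L * norm (x - y)" for z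
        using L(1)[of "z + (x - y)" z] by simp
    qed simp
    then show ?thesis
      using prod_conv_bound[OF \<alpha> that] by (simp add: iter_diff[OF c u] iter_translate mult.assoc)
  qed
  then show "\<exists>N. \<forall>n\<ge>N. \<bar>iter [0..<n] \<alpha> u x - iter [0..<n] \<alpha> u y\<bar> \<le> order_bound m \<alpha> * L * norm (x - y)"
    by blast
qed

lemma uniform_limit_iter:
  assumes u: "continuous_on UNIV u" and \<alpha>: "\<And>i. m \<le> i \<Longrightarrow> \<alpha> i = 0"
    and L: "\<And>x y z. x \<in> V \<Longrightarrow> y \<in> box_over UNIV x \<Longrightarrow> z \<in> box_over UNIV x \<Longrightarrow> \<bar>u y - u z\<bar> \<le> L * norm (y - z)"
    and "0 \<le> L"
  shows "uniform_limit V (\<lambda>n. iter [0..<n] \<alpha> u) (mollify \<alpha> u) sequentially"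
proof (rule uniform_limitI)
  fix e :: real assume "e > 0"
  have "(\<lambda>n. order_bound m \<alpha> * (L * tail n)) \<longlonglongrightarrow> 0"
    by (intro tendsto_mult_right_zero tail_tendsto_0)
  then have "\<forall>\<^sub>F n in sequentially. order_bound m \<alpha> * (L * tail n) < e"
    using \<open>e > 0\<close> by (rule order_tendstoD(2))
  then show "\<forall>\<^sub>F n in sequentially. \<forall>x\<in>V. dist (iter [0..<n] \<alpha> u x) (mollify \<alpha> u x) < e"
    using eventually_ge_at_top[of m]
  proof eventually_elim
    case (elim n)
    have "\<bar>iter [0..<n] \<alpha> u x - mollify \<alpha> u x\<bar> < e" if "x \<in> V" for x
    proof (rule le_less_trans[OF _ elim(1)])
      show "\<bar>iter [0..<n] \<alpha> u x - mollify \<alpha> u x\<bar> \<le> order_bound m \<alpha> * (L * tail n)"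
        by (rule iter_tendsto(2)[OF u _ _ \<open>0 \<le> L\<close> elim(2)]) (use \<alpha> L[OF that] in auto)
    qed
    then show ?case by (simp add: dist_real_def)
  qed
qed

text \<open>Finite averages are differentiable along coordinate \<open>i\<close> for
  \<open>n > i\<close>, and their derivatives converge uniformly on the whole space because the
  Lipschitz constant is global.\<close>

lemma mollify_has_dir_deriv_unit:
  assumes L: "\<And>x y. \<bar>u x - u y\<bar> \<le> L * norm (x - y)" "0 \<le> L" and \<alpha>: "\<And>i. m \<le> i \<Longrightarrow> \<alpha> i = 0"
  shows "has_dir_deriv (mollify \<alpha> u) (unit_vec i) x (mollify (\<alpha>(i := Suc (\<alpha> i))) u x)"
proof (rule has_dir_deriv_limit[where V = UNIV and start = "Suc i"])
  have u: "continuous_on UNIV u"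
    by (rule continuous_on_of_lipschitz[OF L])
  have \<alpha>': "(\<alpha>(i := Suc (\<alpha> i))) j = 0" if "max m (Suc i) \<le> j" for j
    using \<alpha> that by simp
  show "(\<lambda>n. iter [0..<n] \<alpha> u z) \<longlonglongrightarrow> mollify \<alpha> u z" for z
    by (rule iter_tendsto(1)[OF u \<alpha> L])
  show "uniform_limit UNIV (\<lambda>n. iter [0..<n] (\<alpha>(i := Suc (\<alpha> i))) u) (mollify (\<alpha>(i := Suc (\<alpha> i))) u) sequentially"
    by (rule uniform_limit_iter[OF u \<alpha>' L])
  show "has_dir_deriv (iter [0..<n] \<alpha> u) (unit_vec i) z (iter [0..<n] (\<alpha>(i := Suc (\<alpha> i))) u z)" if "Suc i \<le> n" for n z
    using that by (intro iter_has_dir_deriv_unit u) auto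
qed auto

text \<open>All derivatives fall on \<open>F\<close> and none on the kernels, so no factor
  \<open>\<epsilon> i\<close> appears in a denominator and the bounds of \<open>F\<close> on
  \<open>W\<close> carry over to \<open>V\<close> for directions of every kind. Convexity of
  \<open>W\<close> provides one Lipschitz constant for all boxes, hence convergence uniform on
  \<open>V\<close>.\<close>

lemma mollify_smooth_bounded:
  assumes smooth: "\<And>x. \<exists>U. open U \<and> x \<in> U \<and> smooth_bounded U F"
    and V: "open V" and W: "convex W" "smooth_bounded W F" "\<And>y. y \<in> V \<Longrightarrow> box_over UNIV y \<subseteq> W"
  shows "smooth_bounded V (mollify (\<lambda>_. 0) F)"
proof -
  let ?D = "\<lambda>vs. dir_derivs vs F"
  have cont: "continuous_on UNIV (?D vs)" for vs
    by (rule smooth_bounded_continuous[OF smooth])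
  have deriv: "has_dir_deriv (?D vs) v x (?D (v # vs) x)" for vs v x
    using smooth smooth_bounded_deriv by blast
  have step: "has_dir_deriv (mollify (\<lambda>_. 0) (?D vs)) v x (mollify (\<lambda>_. 0) (?D (v # vs)) x)"
    if "x \<in> V" for vs v x
  proof (rule has_dir_deriv_limit[OF V that, where start = 0])
    obtain L where L: "0 \<le> L" "\<forall>y\<in>W. \<forall>z\<in>W. \<bar>?D vs y - ?D vs z\<bar> \<le> L * norm (y - z)"
      using smooth_bounded_lipschitz[OF W(1,2)] by blast
    show "(\<lambda>n. iter [0..<n] (\<lambda>_. 0) (?D vs) z) \<longlonglongrightarrow> mollify (\<lambda>_. 0) (?D vs) z" if "z \<in> V" for z
      by (rule iter_tendsto(1)[OF cont, where m = 0 and L = L]) (use L W(3)[OF that] in auto)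
    obtain L' where L': "0 \<le> L'" "\<forall>y\<in>W. \<forall>z\<in>W. \<bar>?D (v # vs) y - ?D (v # vs) z\<bar> \<le> L' * norm (y - z)"
      using smooth_bounded_lipschitz[OF W(1,2)] by blast
    show "uniform_limit V (\<lambda>n. iter [0..<n] (\<lambda>_. 0) (?D (v # vs))) (mollify (\<lambda>_. 0) (?D (v # vs))) sequentially"
    proof (rule uniform_limit_iter[OF cont _ _ L'(1), where m = 0])
      fix x y z assume "x \<in> V" "y \<in> box_over UNIV x" "z \<in> box_over UNIV x"
      then show "\<bar>?D (v # vs) y - ?D (v # vs) z\<bar> \<le> L' * norm (y - z)"
        using L'(2) W(3) by blast
    qed simp
    show "has_dir_deriv (iter [0..<n] (\<lambda>_. 0) (?D vs)) v z (iter [0..<n] (\<lambda>_. 0) (?D (v # vs)) z)" for n z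
      by (rule iter_has_dir_deriv[OF cont cont deriv])
  qed
  have bound: "\<exists>M. \<forall>vs. length vs = k \<longrightarrow> (\<forall>v\<in>set vs. norm v \<le> 1) \<longrightarrow> (\<forall>x\<in>V. \<bar>mollify (\<lambda>_. 0) (?D vs) x\<bar> \<le> M)" for k
  proof -
    obtain M where M: "\<And>vs x. length vs = k \<Longrightarrow> x \<in> W \<Longrightarrow> \<bar>?D vs x\<bar> \<le> M * prod_list (map norm vs)"
      using smooth_bounded_bound[OF W(2)] by blast
    have "\<bar>mollify (\<lambda>_. 0) (?D vs) x\<bar> \<le> \<bar>M\<bar>" if vs: "length vs = k" "\<forall>v\<in>set vs. norm v \<le> 1" and "x \<in> V" for vs x
    proof -
      obtain L where L: "0 \<le> L" "\<forall>y\<in>W. \<forall>z\<in>W. \<bar>?D vs y - ?D vs z\<bar> \<le> L * norm (y - z)"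
        using smooth_bounded_lipschitz[OF W(1,2)] by blast
      have "M * prod_list (map norm vs) \<le> \<bar>M\<bar> * 1"
        using prod_list_norm_le_1[OF vs(2)] by (intro mult_mono) (auto intro!: prod_list_nonneg)
      then have "\<bar>?D vs y\<bar> \<le> \<bar>M\<bar>" if "y \<in> W" for y
        using M[OF vs(1) that] by linarith
      then have "\<bar>mollify (\<lambda>_. 0) (?D vs) x\<bar> \<le> order_bound 0 (\<lambda>_. 0) * \<bar>M\<bar>"
        by (intro mollify_abs_le[OF cont _ _ L(1)]) (use L(2) W(3)[OF \<open>x \<in> V\<close>] in auto)
      then show ?thesis
        by (simp add: order_bound_0)
    qed
    then show ?thesis by blast
  qed
  let ?M = "\<lambda>j. {mollify (\<lambda>_. 0) (?D vs) | vs. length vs = j \<and> (\<forall>v\<in>set vs. norm v \<le> 1)}"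
  have "unif_smooth k V (?M j)" for k j
  proof (induction k arbitrary: j)
    case 0
    then show ?case
      using bound[of j] by auto
  next
    case (Suc k)
    show ?case
    proof (rule unif_smooth_SucI[OF V Suc Suc[of "Suc j"]])
      fix f assume "f \<in> ?M j"
      then obtain vs where vs: "f = mollify (\<lambda>_. 0) (?D vs)" "length vs = j" "\<forall>v\<in>set vs. norm v \<le> 1"
        by blast
      have "mollify (\<lambda>_. 0) (?D (v # vs)) \<in> ?M (Suc j)" if "norm v \<le> 1" for v
        using vs that by (intro CollectI exI[of _ "v # vs"]) simp
      then show "\<exists>E. (\<forall>v. \<forall>x\<in>V. has_dir_deriv f v x (E v x)) \<and> (\<forall>v. norm v \<le> 1 \<longrightarrow> E v \<in> ?M (Suc j))"
        using step unfolding vs(1) by (intro exI[of _ "\<lambda>v. mollify (\<lambda>_. 0) (?D (v # vs))"]) simp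
    qed
  qed
  from this[of _ 0] show ?thesis
    using V by (simp add: smooth_bounded_def)
qed

text \<open>
  The kernels with \<open>m > 0\<close> have mean zero, so \<open>conv i m u\<close> only sees the variance of \<open>u\<close> on the segment,
  which is \<open>conv i 0 u\<^sup>2 - (conv i 0 u)\<^sup>2\<close>.  Since the constant on the right-hand side is exactly 1, the
  inequality can be iterated over arbitrarily many coordinates without loss.
\<close>

lemma conv_bessel:
  "\<exists>\<mu>>0. \<forall>u i x. continuous_on UNIV u \<longrightarrow>
    (\<Sum>m\<le>k. (if m = 0 then 1 else \<mu>) * (\<epsilon> i ^ m * conv i m u x)\<^sup>2) \<le> conv i 0 (\<lambda>y. (u y)\<^sup>2) x"
proof -
  obtain C where C: "\<And>m. C m > 0" "\<And>m s. (bump m s)\<^sup>2 \<le> C m * bump 0 s"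
    using bump_dominated by metis
  \<comment> \<open>With \<open>\<mu> = 1 / K\<close> the derivative terms of orders 1 to
    \<open>k\<close> add up to at most the variance \<open>V\<close>, exactly what the square of the
    mean leaves over.\<close>
  define K where "K = (\<Sum>m\<le>k. 2 * C m)"
  have "K > 0"
    unfolding K_def using C(1) by (intro sum_pos) auto
  define \<mu> where "\<mu> = 1 / K"
  have \<mu>: "\<mu> > 0" "\<mu> * K = 1"
    using \<open>K > 0\<close> by (auto simp: \<mu>_def)
  have "(\<Sum>m\<le>k. (if m = 0 then 1 else \<mu>) * (\<epsilon> i ^ m * conv i m u x)\<^sup>2) \<le> conv i 0 (\<lambda>y. (u y)\<^sup>2) x"
    if u: "continuous_on UNIV u" for u i x
  proof -
    define g where "g s = u (x + (\<epsilon> i * s) *\<^sub>R unit_vec i)" for s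
    define c where "c = conv i 0 u x"
    define V where "V = integral {-1..1} (\<lambda>s. bump 0 s * (g s - c)\<^sup>2)"
    have g: "continuous_on A g" for A
      unfolding g_def by (intro continuous_intros continuous_on_compose2[OF u]) auto
    have c: "c = integral {-1..1} (\<lambda>s. bump 0 s * g s)"
      by (simp add: c_def conv_def g_def)
    have int: "(\<lambda>s. bump m s * h s) integrable_on {-1..1}" if "continuous_on {-1..1} h" for m h
      by (intro integrable_continuous_interval continuous_intros bump_continuous that)
    have V: "V = conv i 0 (\<lambda>y. (u y)\<^sup>2) x - c\<^sup>2"
    proof -
      have "V = integral {-1..1} (\<lambda>s. bump 0 s * (g s)\<^sup>2 - (2 * c) * (bump 0 s * g s) + c\<^sup>2 * bump 0 s)"
        unfolding V_def by (intro integral_cong) (simp add: power2_eq_square algebra_simps)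
      also have "\<dots> = integral {-1..1} (\<lambda>s. bump 0 s * (g s)\<^sup>2 - (2 * c) * (bump 0 s * g s)) + integral {-1..1} (\<lambda>s. c\<^sup>2 * bump 0 s)"
        by (rule Henstock_Kurzweil_Integration.integral_add)
           (intro integrable_continuous_interval continuous_intros bump_continuous g)+
      also have "integral {-1..1} (\<lambda>s. bump 0 s * (g s)\<^sup>2 - (2 * c) * (bump 0 s * g s)) =
          integral {-1..1} (\<lambda>s. bump 0 s * (g s)\<^sup>2) - integral {-1..1} (\<lambda>s. (2 * c) * (bump 0 s * g s))"
        by (rule Henstock_Kurzweil_Integration.integral_diff)
           (intro integrable_continuous_interval continuous_intros bump_continuous g)+
      also have "integral {-1..1} (\<lambda>s. (2 * c) * (bump 0 s * g s)) = 2 * c * c"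
        using c by simp
      also have "integral {-1..1} (\<lambda>s. c\<^sup>2 * bump 0 s) = c * c"
        using bump_integral by (simp add: power2_eq_square)
      finally show ?thesis
        by (simp add: conv_def g_def power2_eq_square)
    qed
    have "V \<ge> 0"
      unfolding V_def using bump_nonneg by (intro integral_nonneg int continuous_intros g) auto
    have main: "(\<epsilon> i ^ m * conv i m u x)\<^sup>2 \<le> 2 * C m * V" if "m \<noteq> 0" for m
    proof -
      have e: "\<epsilon> i ^ m * (- 1 / \<epsilon> i) ^ m = (- 1) ^ m"
        using eps_pos[of i] by (simp add: power_mult_distrib[symmetric])
      have "\<epsilon> i ^ m * conv i m u x = (- 1) ^ m * integral {-1..1} (\<lambda>s. bump m s * g s)"
        unfolding conv_def g_def[symmetric] mult.assoc[symmetric] e ..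
      then have "(\<epsilon> i ^ m * conv i m u x)\<^sup>2 = (integral {-1..1} (\<lambda>s. bump m s * g s))\<^sup>2"
        by (simp add: power_mult_distrib flip: power_mult)
      also have "integral {-1..1} (\<lambda>s. bump m s * g s) = integral {-1..1} (\<lambda>s. bump m s * (g s - c))"
      proof -
        obtain m' where "m = Suc m'" using \<open>m \<noteq> 0\<close> by (cases m) auto
        then have "integral {-1..1} (\<lambda>s. c * bump m s) = 0"
          using bump_integral_derivative[of m'] by simp
        moreover have "integral {-1..1} (\<lambda>s. bump m s * g s - c * bump m s) =
            integral {-1..1} (\<lambda>s. bump m s * g s) - integral {-1..1} (\<lambda>s. c * bump m s)"
          by (rule Henstock_Kurzweil_Integration.integral_diff)
             (intro integrable_continuous_interval continuous_intros bump_continuous g)+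
        ultimately show ?thesis
          by (simp add: right_diff_distrib mult.commute)
      qed
      also have "(integral {-1..1} (\<lambda>s. bump m s * (g s - c)))\<^sup>2 \<le> 2 * integral {-1..1} (\<lambda>s. (bump m s * (g s - c))\<^sup>2)"
        by (rule cauchy_schwarz_interval) (intro continuous_intros bump_continuous g)
      also have "integral {-1..1} (\<lambda>s. (bump m s * (g s - c))\<^sup>2) \<le> integral {-1..1} (\<lambda>s. C m * (bump 0 s * (g s - c)\<^sup>2))"
      proof (rule integral_le)
        show "(bump m s * (g s - c))\<^sup>2 \<le> C m * (bump 0 s * (g s - c)\<^sup>2)" for s
          using mult_right_mono[OF C(2)[of m s], of "(g s - c)\<^sup>2"] by (simp add: power_mult_distrib mult.assoc)
      qed (intro integrable_continuous_interval continuous_intros bump_continuous g)+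
      finally show ?thesis
        by (simp add: V_def)
    qed
    have "(\<Sum>m\<le>k. (if m = 0 then 1 else \<mu>) * (\<epsilon> i ^ m * conv i m u x)\<^sup>2)
        \<le> (\<Sum>m\<le>k. (if m = 0 then c\<^sup>2 else 0) + \<mu> * V * (2 * C m))"
    proof (rule sum_mono)
      fix m
      show "(if m = 0 then 1 else \<mu>) * (\<epsilon> i ^ m * conv i m u x)\<^sup>2 \<le> (if m = 0 then c\<^sup>2 else 0) + \<mu> * V * (2 * C m)"
      proof (cases "m = 0")
        case True
        then show ?thesis
          using \<mu>(1) \<open>V \<ge> 0\<close> C(1)[of 0] by (simp add: c_def)
      next
        case False
        then show ?thesis
          using mult_left_mono[OF main[OF False], of \<mu>] \<mu>(1) by (simp add: mult_ac)
      qed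
    qed
    also have "\<dots> = c\<^sup>2 + \<mu> * V * K"
      by (simp add: sum.distrib K_def sum_distrib_left)
    also have "\<mu> * V * K = V"
      using \<mu>(2) by (metis mult.commute mult.left_commute mult.right_neutral)
    finally show ?thesis
      by (simp add: V)
  qed
  then show ?thesis
    using \<mu>(1) by blast
qed

text \<open>Tensorisation over coordinates. The one-coordinate inequality is applied to
  \<open>iter is \<beta> u\<close> for each fixed \<open>\<beta>\<close>; linearity then moves the
  sum over \<open>\<beta>\<close> inside the average, where the induction hypothesis applies by
  positivity of the kernel. Indices range over a full box rather than over a bounded total degree,
  which gives the sum this product structure.\<close>

lemma iter_bessel:
  fixes w :: "nat \<Rightarrow> real"
  assumes w: "\<And>m. w m \<ge> 0"
    and conv: "\<And>u i x. continuous_on UNIV u \<Longrightarrow>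
      (\<Sum>m\<le>k. w m * (\<epsilon> i ^ m * conv i m u x)\<^sup>2) \<le> conv i 0 (\<lambda>y. (u y)\<^sup>2) x"
    and u: "continuous_on UNIV u"
  shows "distinct is \<Longrightarrow>
    (\<Sum>\<beta>\<in>PiE (set is) (\<lambda>_. {..k}). (\<Prod>i\<in>set is. w (\<beta> i) * (\<epsilon> i ^ \<beta> i)\<^sup>2) * (iter is \<beta> u x)\<^sup>2)
    \<le> iter is (\<lambda>_. 0) (\<lambda>y. (u y)\<^sup>2) x"
proof (induction "is" arbitrary: x)
  case Nil
  then show ?case by simp
next
  case (Cons i "is")
  let ?P = "PiE (set is) (\<lambda>_. {..k})"
  let ?w = "\<lambda>\<beta>. \<Prod>j\<in>set is. w (\<beta> j) * (\<epsilon> j ^ \<beta> j)\<^sup>2"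
  let ?f = "\<lambda>\<beta>. (\<Prod>j\<in>set (i # is). w (\<beta> j) * (\<epsilon> j ^ \<beta> j)\<^sup>2) * (iter (i # is) \<beta> u x)\<^sup>2"
  have i: "i \<notin> set is" "distinct is" using Cons.prems by auto
  have fin: "finite ?P"
    by (intro finite_PiE) auto
  have wnn: "0 \<le> ?w \<beta>" for \<beta>
    using w by (intro prod_nonneg) auto
  have f: "?f (\<beta>(i := m)) = ?w \<beta> * (w m * (\<epsilon> i ^ m * conv i m (iter is \<beta> u) x)\<^sup>2)" for \<beta> m
  proof -
    have "iter is (\<beta>(i := m)) u = iter is \<beta> u"
      using i by (intro iter_cong) auto
    moreover have "?w (\<beta>(i := m)) = ?w \<beta>"
      using i by (intro prod.cong) auto
    ultimately show ?thesis
      using i by (simp add: power_mult_distrib mult_ac del: fun_upd_apply) (simp add: mult_ac)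
  qed
  have "sum ?f (PiE (set (i # is)) (\<lambda>_. {..k})) = sum ?f ((\<lambda>(m, \<beta>). \<beta>(i := m)) ` ({..k} \<times> ?P))"
    by (simp add: PiE_insert_eq)
  also have "\<dots> = (\<Sum>(m, \<beta>)\<in>{..k} \<times> ?P. ?f (\<beta>(i := m)))"
    using inj_combinator[OF i(1), of "\<lambda>_. {..k}"]
    by (subst sum.reindex) (auto simp: case_prod_beta' o_def)
  also have "\<dots> = (\<Sum>m\<le>k. \<Sum>\<beta>\<in>?P. ?f (\<beta>(i := m)))"
    by (simp add: sum.cartesian_product)
  also have "\<dots> = (\<Sum>\<beta>\<in>?P. \<Sum>m\<le>k. ?f (\<beta>(i := m)))"
    by (rule sum.swap)
  also have "\<dots> = (\<Sum>\<beta>\<in>?P. ?w \<beta> * (\<Sum>m\<le>k. w m * (\<epsilon> i ^ m * conv i m (iter is \<beta> u) x)\<^sup>2))"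
    unfolding f sum_distrib_left ..
  also have "\<dots> \<le> (\<Sum>\<beta>\<in>?P. ?w \<beta> * conv i 0 (\<lambda>y. (iter is \<beta> u y)\<^sup>2) x)"
    by (intro sum_mono mult_left_mono conv wnn iter_continuous u)
  also have "\<dots> = conv i 0 (\<lambda>y. \<Sum>\<beta>\<in>?P. ?w \<beta> * (iter is \<beta> u y)\<^sup>2) x"
    by (subst conv_sum[OF fin]) (auto intro!: continuous_intros iter_continuous u simp: conv_cmult)
  also have "\<dots> \<le> conv i 0 (iter is (\<lambda>_. 0) (\<lambda>y. (u y)\<^sup>2)) x"
    using Cons.IH[OF i(2)]
    by (intro conv_mono) (auto intro!: continuous_intros iter_continuous u)
  finally show ?case by simp
qed

end

section \<open>Weighted sums of partial derivatives\<close>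

lemma weighted_young:
  fixes p w y :: real
  assumes "w > 0"
  shows "p * \<bar>y\<bar> \<le> p\<^sup>2 / w / 2 + w * y\<^sup>2 / 2"
proof -
  have "0 \<le> (p - w * \<bar>y\<bar>)\<^sup>2 / (2 * w)"
    using assms by simp
  also have "\<dots> = p\<^sup>2 / w / 2 + w * y\<^sup>2 / 2 - p * \<bar>y\<bar>"
    unfolding power2_diff power_mult_distrib power2_abs
    using assms by (simp add: diff_divide_distrib add_divide_distrib power2_eq_square)
  finally show ?thesis by simp
qed

context mollifier
begin

text \<open>Each summand is split by \<open>weighted_young\<close>. The quadratic parts add up to at
  most \<open>B^2 / 2\<close> by \<open>iter_bessel\<close>. The remaining parts factor over the
  coordinates, and the product stays bounded in \<open>n\<close> because the squares of
  \<open>\<epsilon>\<close> are summable. A finite set of multi-indices is handled by finite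
  averages first and then by a limit.\<close>

lemma mollify_weighted_sum:
  assumes "\<kappa> > 0" and L: "\<And>x y. \<bar>u x - u y\<bar> \<le> L * norm (x - y)" "0 \<le> L" and B: "\<And>x. \<bar>u x\<bar> \<le> B"
  shows "\<exists>K. \<forall>S x. finite S \<longrightarrow> S \<subseteq> {\<alpha>. degree_mi \<alpha> \<le> k} \<longrightarrow>
    (\<Sum>\<alpha>\<in>S. \<bar>power_mi (\<lambda>i. \<kappa> * (\<epsilon> i)\<^sup>2) \<alpha> * mollify (Poly_Mapping.lookup \<alpha>) u x\<bar>) \<le> K"
proof -
  have u: "continuous_on UNIV u"
    by (rule continuous_on_of_lipschitz[OF L])
  obtain \<mu> where \<mu>: "\<mu> > 0" "\<And>u i x. continuous_on UNIV u \<Longrightarrow>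
    (\<Sum>m\<le>k. (if m = 0 then 1 else \<mu>) * (\<epsilon> i ^ m * conv i m u x)\<^sup>2) \<le> conv i 0 (\<lambda>y. (u y)\<^sup>2) x"
    using conv_bessel[of k] by blast
  define w :: "nat \<Rightarrow> real" where "w m = (if m = 0 then 1 else \<mu>)" for m
  have w: "w m > 0" for m
    using \<mu>(1) by (simp add: w_def)
  define a where "a i = \<kappa> * (\<epsilon> i)\<^sup>2" for i
  have a: "a i > 0" for i
    using \<open>\<kappa> > 0\<close> eps_pos[of i] by (simp add: a_def)
  define E where "E = suminf (\<lambda>i. (\<epsilon> i)\<^sup>2)"
  have E: "(\<Sum>i<n. (\<epsilon> i)\<^sup>2) \<le> E" "(\<epsilon> i)\<^sup>2 \<le> E" for n i
    unfolding E_def using sum_le_suminf[OF eps_summable, of "{..<n}"] sum_le_suminf[OF eps_summable, of "{i}"] by auto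
  \<comment> \<open>This is \<open>(a i / \<epsilon> i)^2\<close>, the ratio of squared weight to
    Bessel weight for one derivative in coordinate \<open>i\<close>.\<close>
  define t where "t i = \<kappa>\<^sup>2 * (\<epsilon> i)\<^sup>2" for i
  have t: "0 \<le> t i" "t i \<le> \<kappa>\<^sup>2 * E" for i
    unfolding t_def using E(2)[of i] by (auto intro: mult_left_mono)
  \<comment> \<open>Pulling one factor \<open>t i\<close> out of the terms of positive order leaves
    a sum bounded uniformly in \<open>i\<close> by \<open>D\<close>; so a row is at most
    \<open>1 + D * t i\<close>, and the product of the rows is at most an exponential of a
    convergent sum.\<close>
  define D where "D = (\<Sum>m<k. (\<kappa>\<^sup>2 * E) ^ m / \<mu>)"
  have D: "0 \<le> D"
    unfolding D_def using \<mu>(1) order_trans[OF t(1,2)] by (intro sum_nonneg) auto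
  have row: "(\<Sum>m\<le>k. t i ^ m / w m) \<le> exp (D * t i)" for i
  proof -
    have "(\<Sum>m\<le>k. t i ^ m / w m) = 1 + (\<Sum>m<k. t i ^ Suc m / \<mu>)"
      by (simp add: sum.atMost_shift w_def)
    also have "(\<Sum>m<k. t i ^ Suc m / \<mu>) = (\<Sum>m<k. t i ^ m / \<mu>) * t i"
      by (simp add: sum_distrib_left mult.commute[of _ "t i"])
    also have "(\<Sum>m<k. t i ^ m / \<mu>) \<le> D"
      unfolding D_def using t[of i] \<mu>(1) by (intro sum_mono divide_right_mono power_mono) auto
    finally have "(\<Sum>m\<le>k. t i ^ m / w m) \<le> 1 + D * t i"
      using t(1)[of i] by (simp add: mult_right_mono)
    also have "\<dots> \<le> exp (D * t i)"
      by (rule exp_ge_add_one_self)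
    finally show ?thesis .
  qed
  define K where "K = exp (D * (\<kappa>\<^sup>2 * E)) / 2 + B\<^sup>2 / 2"
  have fin_bound: "(\<Sum>\<beta>\<in>PiE {..<n} (\<lambda>_. {..k}). (\<Prod>i<n. a i ^ \<beta> i) * \<bar>iter [0..<n] \<beta> u x\<bar>) \<le> K" for n x
  proof -
    let ?P = "PiE {..<n} (\<lambda>_. {..k})"
    let ?w = "\<lambda>\<beta>. \<Prod>i<n. w (\<beta> i) * (\<epsilon> i ^ \<beta> i)\<^sup>2"
    have set: "set [0..<n] = {..<n}" by auto
    have wpos: "?w \<beta> > 0" for \<beta>
      using w eps_pos by (intro prod_pos mult_pos_pos zero_less_power) auto
    have "(\<Sum>\<beta>\<in>?P. (\<Prod>i<n. a i ^ \<beta> i) * \<bar>iter [0..<n] \<beta> u x\<bar>)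
        \<le> (\<Sum>\<beta>\<in>?P. (\<Prod>i<n. t i ^ \<beta> i / w (\<beta> i)) / 2 + ?w \<beta> * (iter [0..<n] \<beta> u x)\<^sup>2 / 2)"
    proof (rule sum_mono)
      fix \<beta>
      let ?p = "\<Prod>i<n. a i ^ \<beta> i" and ?y = "iter [0..<n] \<beta> u x"
      have "?p * \<bar>?y\<bar> \<le> ?p\<^sup>2 / ?w \<beta> / 2 + ?w \<beta> * ?y\<^sup>2 / 2"
        by (rule weighted_young[OF wpos])
      also have "?p\<^sup>2 / ?w \<beta> = (\<Prod>i<n. t i ^ \<beta> i / w (\<beta> i))"
      proof -
        have "(a i ^ \<beta> i)\<^sup>2 / (w (\<beta> i) * (\<epsilon> i ^ \<beta> i)\<^sup>2) = t i ^ \<beta> i / w (\<beta> i)" for i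
        proof -
          have "(a i ^ \<beta> i)\<^sup>2 = t i ^ \<beta> i * (\<epsilon> i ^ \<beta> i)\<^sup>2"
            by (simp add: a_def t_def power_mult_distrib power2_eq_square mult_ac)
          then show ?thesis
            using eps_pos[of i] by simp
        qed
        then have "(\<Prod>i<n. t i ^ \<beta> i / w (\<beta> i)) = (\<Prod>i<n. (a i ^ \<beta> i)\<^sup>2 / (w (\<beta> i) * (\<epsilon> i ^ \<beta> i)\<^sup>2))"
          by simp
        then show ?thesis
          unfolding prod_dividef prod_power_distrib by simp
      qed
      finally show "?p * \<bar>?y\<bar> \<le> (\<Prod>i<n. t i ^ \<beta> i / w (\<beta> i)) / 2 + ?w \<beta> * ?y\<^sup>2 / 2" .
    qed
    also have "\<dots> = (\<Sum>\<beta>\<in>?P. \<Prod>i<n. t i ^ \<beta> i / w (\<beta> i)) / 2 + (\<Sum>\<beta>\<in>?P. ?w \<beta> * (iter [0..<n] \<beta> u x)\<^sup>2) / 2"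
      by (simp add: sum.distrib sum_divide_distrib)
    also have "(\<Sum>\<beta>\<in>?P. \<Prod>i<n. t i ^ \<beta> i / w (\<beta> i)) = (\<Prod>i<n. \<Sum>m\<le>k. t i ^ m / w m)"
      by (rule prod_sum_PiE[symmetric]) auto
    also have "\<dots> \<le> (\<Prod>i<n. exp (D * t i))"
      using row t(1) w by (intro prod_mono conjI sum_nonneg divide_nonneg_pos) auto
    also have "\<dots> = exp (D * (\<kappa>\<^sup>2 * (\<Sum>i<n. (\<epsilon> i)\<^sup>2)))"
      by (simp add: exp_sum[symmetric] t_def sum_distrib_left)
    also have "\<dots> \<le> exp (D * (\<kappa>\<^sup>2 * E))"
      using D E(1)[of n] by (auto intro!: mult_left_mono)
    also have "(\<Sum>\<beta>\<in>?P. ?w \<beta> * (iter [0..<n] \<beta> u x)\<^sup>2) \<le> iter [0..<n] (\<lambda>_. 0) (\<lambda>y. (u y)\<^sup>2) x"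
    proof -
      have "(\<Sum>\<beta>\<in>PiE (set [0..<n]) (\<lambda>_. {..k}). (\<Prod>i\<in>set [0..<n]. w (\<beta> i) * (\<epsilon> i ^ \<beta> i)\<^sup>2) * (iter [0..<n] \<beta> u x)\<^sup>2)
        \<le> iter [0..<n] (\<lambda>_. 0) (\<lambda>y. (u y)\<^sup>2) x"
        by (rule iter_bessel) (use \<mu>(2) w u in \<open>auto simp: w_def less_imp_le\<close>)
      then show ?thesis
        unfolding set .
    qed
    also have "\<dots> \<le> B\<^sup>2"
    proof -
      have "\<bar>iter [0..<n] (\<lambda>_. 0) (\<lambda>y. (u y)\<^sup>2) x\<bar> \<le> (\<Prod>i\<in>set [0..<n]. conv_bound i 0) * B\<^sup>2"
      proof (rule iter_abs_le)
        show "\<bar>(u y)\<^sup>2\<bar> \<le> B\<^sup>2" for y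
          using power_mono[OF B[of y], of 2] by simp
      qed (auto intro!: continuous_intros u)
      then show ?thesis
        by (simp add: conv_bound_0)
    qed
    finally show ?thesis
      by (simp add: K_def)
  qed
  have "(\<Sum>\<alpha>\<in>S. \<bar>power_mi a \<alpha> * mollify (Poly_Mapping.lookup \<alpha>) u x\<bar>) \<le> K"
    if S: "finite S" "S \<subseteq> {\<alpha>. degree_mi \<alpha> \<le> k}" for S x
  proof -
    obtain N where N: "\<And>\<alpha> i. \<alpha> \<in> S \<Longrightarrow> i \<in> Poly_Mapping.keys \<alpha> \<Longrightarrow> i < N"
    proof -
      have "finite (\<Union>\<alpha>\<in>S. Poly_Mapping.keys \<alpha>)"
        using S(1) by auto
      then obtain N where "\<forall>i\<in>(\<Union>\<alpha>\<in>S. Poly_Mapping.keys \<alpha>). i < N"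
        by (meson finite_nat_set_iff_bounded)
      then show ?thesis using that by blast
    qed
    have zero: "Poly_Mapping.lookup \<alpha> i = 0" if "\<alpha> \<in> S" "N \<le> i" for \<alpha> i
      using N[OF that(1), of i] that(2) by (force simp: in_keys_iff)
    have lim: "(\<lambda>n. \<Sum>\<alpha>\<in>S. \<bar>power_mi a \<alpha> * iter [0..<n] (Poly_Mapping.lookup \<alpha>) u x\<bar>)
        \<longlonglongrightarrow> (\<Sum>\<alpha>\<in>S. \<bar>power_mi a \<alpha> * mollify (Poly_Mapping.lookup \<alpha>) u x\<bar>)"
    proof (intro tendsto_sum tendsto_rabs tendsto_mult tendsto_const)
      fix \<alpha> assume "\<alpha> \<in> S"
      then show "(\<lambda>n. iter [0..<n] (Poly_Mapping.lookup \<alpha>) u x) \<longlonglongrightarrow> mollify (Poly_Mapping.lookup \<alpha>) u x"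
        by (intro iter_tendsto(1)[OF u zero L])
    qed
    have "(\<Sum>\<alpha>\<in>S. \<bar>power_mi a \<alpha> * iter [0..<n] (Poly_Mapping.lookup \<alpha>) u x\<bar>) \<le> K" if "N \<le> n" for n
    proof -
      \<comment> \<open>For \<open>n \<ge> N\<close> restriction to the first \<open>n\<close>
        coordinates loses nothing, and total degree at most \<open>k\<close> forces every entry to
        be at most \<open>k\<close>; so \<open>S\<close> embeds into the box of
        \<open>fin_bound\<close>.\<close>
      let ?r = "\<lambda>\<alpha>. restrict (Poly_Mapping.lookup \<alpha>) {..<n}"
      let ?f = "\<lambda>\<beta>. (\<Prod>i<n. a i ^ \<beta> i) * \<bar>iter [0..<n] \<beta> u x\<bar>"
      have inj: "inj_on ?r S"
      proof (rule inj_onI, rule poly_mapping_eqI)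
        fix \<alpha> \<beta> i assume *: "\<alpha> \<in> S" "\<beta> \<in> S" "?r \<alpha> = ?r \<beta>"
        show "Poly_Mapping.lookup \<alpha> i = Poly_Mapping.lookup \<beta> i"
        proof (cases "i < n")
          case True
          then show ?thesis
            using fun_cong[OF *(3), of i] by simp
        next
          case False
          then show ?thesis
            using zero[OF *(1), of i] zero[OF *(2), of i] \<open>N \<le> n\<close> by simp
        qed
      qed
      have "\<bar>power_mi a \<alpha> * iter [0..<n] (Poly_Mapping.lookup \<alpha>) u x\<bar> = ?f (?r \<alpha>)" if "\<alpha> \<in> S" for \<alpha>
      proof -
        have "power_mi a \<alpha> = (\<Prod>i<n. a i ^ Poly_Mapping.lookup \<alpha> i)"
          unfolding power_mi_def
        proof (rule prod.mono_neutral_left)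
          show "Poly_Mapping.keys \<alpha> \<subseteq> {..<n}"
            using N[OF that] \<open>N \<le> n\<close> by fastforce
        qed (auto simp: in_keys_iff)
        also have "\<dots> = (\<Prod>i<n. a i ^ ?r \<alpha> i)"
          by (intro prod.cong) auto
        finally have p: "power_mi a \<alpha> = (\<Prod>i<n. a i ^ ?r \<alpha> i)" .
        have "iter [0..<n] (Poly_Mapping.lookup \<alpha>) u = iter [0..<n] (?r \<alpha>) u"
          by (intro iter_cong) auto
        moreover have "0 \<le> (\<Prod>i<n. a i ^ ?r \<alpha> i)"
          using a by (intro prod_nonneg) (auto simp: less_imp_le)
        ultimately show ?thesis
          unfolding p abs_mult by simp
      qed
      then have "(\<Sum>\<alpha>\<in>S. \<bar>power_mi a \<alpha> * iter [0..<n] (Poly_Mapping.lookup \<alpha>) u x\<bar>) = sum ?f (?r ` S)"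
        unfolding sum.reindex[OF inj] by simp
      also have "\<dots> \<le> sum ?f (PiE {..<n} (\<lambda>_. {..k}))"
      proof (rule sum_mono2)
        show "finite (PiE {..<n} (\<lambda>_. {..k}))"
          by (intro finite_PiE) auto
        show "?r ` S \<subseteq> PiE {..<n} (\<lambda>_. {..k})"
        proof
          fix \<beta> assume "\<beta> \<in> ?r ` S"
          then obtain \<alpha> where \<alpha>: "\<alpha> \<in> S" "\<beta> = ?r \<alpha>" by blast
          have "Poly_Mapping.lookup \<alpha> i \<le> k" for i
          proof (cases "i \<in> Poly_Mapping.keys \<alpha>")
            case True
            then have "Poly_Mapping.lookup \<alpha> i \<le> degree_mi \<alpha>"
              unfolding degree_mi_def by (intro member_le_sum) auto
            then show ?thesis using \<alpha>(1) S(2) by auto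
          qed (simp add: in_keys_iff)
          then show "\<beta> \<in> PiE {..<n} (\<lambda>_. {..k})"
            using \<alpha>(2) by auto
        qed
        show "0 \<le> ?f \<beta>" for \<beta>
          using a by (intro mult_nonneg_nonneg prod_nonneg) (auto simp: less_imp_le)
      qed
      also have "\<dots> \<le> K"
        by (rule fin_bound)
      finally show ?thesis .
    qed
    then show ?thesis
      by (intro LIMSEQ_le_const2[OF lim]) blast
  qed
  then show ?thesis
    unfolding a_def by blast
qed

end

section \<open>Tame functions\<close>

lemma partial_eq_dir_deriv: "partial i = dir_deriv (unit_vec i)"
  by (intro ext) (simp add: partial_def dir_deriv_def)

lemma partial_list_Nil [simp]: "partial_list [] h = h"
  and partial_list_Cons [simp]: "partial_list (i # is) h = dir_deriv (unit_vec i) (partial_list is h)"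
  by (simp_all add: partial_list_def partial_eq_dir_deriv)

lemma partial_list_eq_dir_derivs: "partial_list is h = dir_derivs (map unit_vec is) h"
  by (induction "is") auto

text \<open>
  The partial derivatives of a tame function are bounded globally, but with constants that may depend on
  the multi-index, and its Frechet derivatives are only locally bounded.  Global bounds on the Frechet
  derivatives would be too much to ask for: on \<open>\<ell>\<^sup>2\<close> such functions do not separate all sets of
  positive distance.
\<close>

definition tame :: "(nat \<Rightarrow> real) \<Rightarrow> (ell2 \<Rightarrow> real) \<Rightarrow> bool"
  where "tame a h \<longleftrightarrow>
    (\<forall>is. \<exists>B. \<forall>x. \<bar>partial_list is h x\<bar> \<le> B) \<and>
    (\<forall>is. \<exists>L\<ge>0. \<forall>x y. \<bar>partial_list is h x - partial_list is h y\<bar> \<le> L * norm (x - y)) \<and>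
    (\<forall>k. \<exists>K. \<forall>S x. finite S \<longrightarrow> S \<subseteq> {\<alpha>. degree_mi \<alpha> \<le> k} \<longrightarrow>
      (\<Sum>\<alpha>\<in>S. \<bar>power_mi a \<alpha> * D_mi \<alpha> h x\<bar>) \<le> K) \<and>
    (\<forall>x. \<exists>U. open U \<and> x \<in> U \<and> smooth_bounded U h)"

lemma tame_bounded: "tame a h \<Longrightarrow> \<exists>B. \<forall>x. \<bar>partial_list is h x\<bar> \<le> B"
  and tame_lipschitz: "tame a h \<Longrightarrow> \<exists>L\<ge>0. \<forall>x y. \<bar>partial_list is h x - partial_list is h y\<bar> \<le> L * norm (x - y)"
  and tame_weighted: "tame a h \<Longrightarrow> \<exists>K. \<forall>S x. finite S \<longrightarrow> S \<subseteq> {\<alpha>. degree_mi \<alpha> \<le> k} \<longrightarrow>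
      (\<Sum>\<alpha>\<in>S. \<bar>power_mi a \<alpha> * D_mi \<alpha> h x\<bar>) \<le> K"
  and tame_smooth: "tame a h \<Longrightarrow> \<exists>U. open U \<and> x \<in> U \<and> smooth_bounded U h"
  by (simp_all add: tame_def)

lemma tame_has_dir_deriv:
  assumes "tame a h"
  shows "has_dir_deriv (partial_list is h) v x (dir_deriv v (partial_list is h) x)"
  using tame_smooth[OF assms, of x] smooth_bounded_deriv[of _ h x "map unit_vec is" v]
  by (auto simp: partial_list_eq_dir_derivs)

lemma partial_list_add:
  assumes "tame a f" "tame a g"
  shows "partial_list is (\<lambda>x. f x + g x) = (\<lambda>x. partial_list is f x + partial_list is g x)"
proof (induction "is")
  case (Cons i "is")
  show ?case
    unfolding partial_list_Cons Cons
    by (intro ext dir_deriv_eqI has_dir_deriv_add tame_has_dir_deriv[OF assms(1)] tame_has_dir_deriv[OF assms(2)])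
qed simp

lemma tame_add:
  assumes f: "tame a f" and g: "tame a g"
  shows "tame a (\<lambda>x. f x + g x)"
  unfolding tame_def
proof (intro conjI allI)
  fix "is" :: "nat list"
  obtain B B' where "\<forall>x. \<bar>partial_list is f x\<bar> \<le> B" "\<forall>x. \<bar>partial_list is g x\<bar> \<le> B'"
    using tame_bounded[OF f, of "is"] tame_bounded[OF g, of "is"] by blast
  then have "\<bar>partial_list is (\<lambda>x. f x + g x) x\<bar> \<le> B + B'" for x
    unfolding partial_list_add[OF f g] using abs_triangle_ineq order_trans add_mono by metis
  then show "\<exists>B. \<forall>x. \<bar>partial_list is (\<lambda>x. f x + g x) x\<bar> \<le> B"
    by blast
  obtain L L' where L: "L \<ge> 0" "L' \<ge> 0"
    "\<And>x y. \<bar>partial_list is f x - partial_list is f y\<bar> \<le> L * norm (x - y)"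
    "\<And>x y. \<bar>partial_list is g x - partial_list is g y\<bar> \<le> L' * norm (x - y)"
    using tame_lipschitz[OF f, of "is"] tame_lipschitz[OF g, of "is"] by blast
  have "\<bar>partial_list is (\<lambda>x. f x + g x) x - partial_list is (\<lambda>x. f x + g x) y\<bar> \<le> (L + L') * norm (x - y)" for x y
    unfolding partial_list_add[OF f g] distrib_right using L(3)[of x y] L(4)[of x y] by linarith
  then show "\<exists>L\<ge>0. \<forall>x y. \<bar>partial_list is (\<lambda>x. f x + g x) x - partial_list is (\<lambda>x. f x + g x) y\<bar> \<le> L * norm (x - y)"
    using L(1,2) by (intro exI[of _ "L + L'"]) auto
next
  fix k
  have D: "D_mi \<alpha> (\<lambda>x. f x + g x) x = D_mi \<alpha> f x + D_mi \<alpha> g x" for \<alpha> x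
    unfolding D_mi_def partial_list_add[OF f g] ..
  obtain K K' where K: "\<And>S x. finite S \<Longrightarrow> S \<subseteq> {\<alpha>. degree_mi \<alpha> \<le> k} \<Longrightarrow> (\<Sum>\<alpha>\<in>S. \<bar>power_mi a \<alpha> * D_mi \<alpha> f x\<bar>) \<le> K"
    "\<And>S x. finite S \<Longrightarrow> S \<subseteq> {\<alpha>. degree_mi \<alpha> \<le> k} \<Longrightarrow> (\<Sum>\<alpha>\<in>S. \<bar>power_mi a \<alpha> * D_mi \<alpha> g x\<bar>) \<le> K'"
    using tame_weighted[OF f, of k] tame_weighted[OF g, of k] by blast
  have "(\<Sum>\<alpha>\<in>S. \<bar>power_mi a \<alpha> * D_mi \<alpha> (\<lambda>x. f x + g x) x\<bar>) \<le> K + K'"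
    if "finite S" "S \<subseteq> {\<alpha>. degree_mi \<alpha> \<le> k}" for S x
  proof -
    have "(\<Sum>\<alpha>\<in>S. \<bar>power_mi a \<alpha> * D_mi \<alpha> (\<lambda>x. f x + g x) x\<bar>)
        \<le> (\<Sum>\<alpha>\<in>S. \<bar>power_mi a \<alpha> * D_mi \<alpha> f x\<bar> + \<bar>power_mi a \<alpha> * D_mi \<alpha> g x\<bar>)"
      unfolding D distrib_left by (intro sum_mono abs_triangle_ineq)
    then show ?thesis
      using K(1)[OF that, of x] K(2)[OF that, of x] by (simp add: sum.distrib)
  qed
  then show "\<exists>K. \<forall>S x. finite S \<longrightarrow> S \<subseteq> {\<alpha>. degree_mi \<alpha> \<le> k} \<longrightarrow>
      (\<Sum>\<alpha>\<in>S. \<bar>power_mi a \<alpha> * D_mi \<alpha> (\<lambda>x. f x + g x) x\<bar>) \<le> K"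
    by blast
next
  fix x
  obtain U V where UV: "open U" "x \<in> U" "smooth_bounded U f" "open V" "x \<in> V" "smooth_bounded V g"
    using tame_smooth[OF f] tame_smooth[OF g] by metis
  then have "smooth_bounded (U \<inter> V) (\<lambda>x. f x + g x)"
    by (intro smooth_bounded_add smooth_bounded_subset[OF UV(3)] smooth_bounded_subset[OF UV(6)] open_Int) auto
  then show "\<exists>U. open U \<and> x \<in> U \<and> smooth_bounded U (\<lambda>x. f x + g x)"
    using UV by (intro exI[of _ "U \<inter> V"]) auto
qed

lemma dir_derivs_const: "dir_derivs vs (\<lambda>_. c) = (\<lambda>_. if vs = [] then c else 0)"
proof (induction vs)
  case (Cons v vs)
  then show ?case
    by (auto intro!: ext dir_deriv_eqI has_dir_deriv_const)
qed simp

lemma count_list_concat_replicate: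
  "distinct xs \<Longrightarrow> count_list (concat (map (\<lambda>i. replicate (f i) i) xs)) j = (if j \<in> set xs then f j else 0)"
proof (induction xs)
  case (Cons x xs)
  have "count_list (replicate n x) j = (if j = x then n else 0)" for n
    by (induction n) auto
  then show ?case
    using Cons by auto
qed simp

text \<open>Only the multiplicities in the differentiation list matter for mollified functions, so
  the sorted list inside \<open>D_mi\<close> can be forgotten.\<close>

lemma D_mi_list:
  obtains js where "\<And>h. D_mi \<alpha> h = partial_list js h" "\<And>j. count_list js j = Poly_Mapping.lookup \<alpha> j"
proof -
  let ?js = "concat (map (\<lambda>i. replicate (Poly_Mapping.lookup \<alpha> i) i) (sorted_list_of_set (Poly_Mapping.keys \<alpha>)))"
  have "count_list ?js j = Poly_Mapping.lookup \<alpha> j" for j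
    by (subst count_list_concat_replicate) (auto simp: in_keys_iff)
  then show ?thesis
    using that[of ?js] by (simp add: D_mi_def)
qed

lemma tame_const: "tame a (\<lambda>_. c)"
  unfolding tame_def
proof (intro conjI allI)
  fix "is" :: "nat list"
  show "\<exists>B. \<forall>x. \<bar>partial_list is (\<lambda>_. c) x\<bar> \<le> B"
    "\<exists>L\<ge>0. \<forall>x y. \<bar>partial_list is (\<lambda>_. c) x - partial_list is (\<lambda>_. c) y\<bar> \<le> L * norm (x - y)"
    by (auto simp: partial_list_eq_dir_derivs dir_derivs_const)
next
  fix k
  have D: "D_mi \<alpha> (\<lambda>_. c) x = (if \<alpha> = 0 then c else 0)" for \<alpha> x
  proof -
    obtain js where js: "\<And>h. D_mi \<alpha> h = partial_list js h" "\<And>j. count_list js j = Poly_Mapping.lookup \<alpha> j"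
      using D_mi_list[of \<alpha>] by blast
    have "js = [] \<longleftrightarrow> \<alpha> = 0"
    proof
      assume "js = []"
      then show "\<alpha> = 0"
        using js(2) by (intro poly_mapping_eqI) auto
    next
      assume "\<alpha> = 0"
      then have "\<forall>j. count_list js j = 0"
        using js(2) by simp
      then show "js = []"
        by (cases js) (auto split: if_splits)
    qed
    then show ?thesis
      by (simp add: js(1) partial_list_eq_dir_derivs dir_derivs_const)
  qed
  have "(\<Sum>\<alpha>\<in>S. \<bar>power_mi a \<alpha> * D_mi \<alpha> (\<lambda>_. c) x\<bar>) \<le> \<bar>c\<bar>" if "finite S" for S x
  proof -
    have "\<bar>power_mi a \<alpha> * D_mi \<alpha> (\<lambda>_. c) x\<bar> = (if \<alpha> = 0 then \<bar>c\<bar> else 0)" for \<alpha>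
      by (simp add: D power_mi_def)
    then show ?thesis
      using that by simp
  qed
  then show "\<exists>K. \<forall>S x. finite S \<longrightarrow> S \<subseteq> {\<alpha>. degree_mi \<alpha> \<le> k} \<longrightarrow>
      (\<Sum>\<alpha>\<in>S. \<bar>power_mi a \<alpha> * D_mi \<alpha> (\<lambda>_. c) x\<bar>) \<le> K"
    by blast
next
  fix x :: ell2
  show "\<exists>U. open U \<and> x \<in> U \<and> smooth_bounded U (\<lambda>_. c)"
    by (intro exI[of _ UNIV]) (simp add: smooth_bounded_const)
qed

lemma tame_sum: "(\<And>i. i < n \<Longrightarrow> tame a (h i)) \<Longrightarrow> tame a (\<lambda>x. \<Sum>i<(n::nat). h i x)"
  by (induction n) (auto intro: tame_add tame_const)

context mollifier
begin

text \<open>Each derivative only raises the order of one kernel. The result depends on the list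
  through its counts alone, so mixed partial derivatives commute without a separate symmetry
  argument.\<close>

lemma partial_list_mollify:
  assumes L: "\<And>x y. \<bar>u x - u y\<bar> \<le> L * norm (x - y)" "0 \<le> L"
  shows "partial_list is (mollify (\<lambda>_. 0) u) = mollify (count_list is) u"
proof (induction "is")
  case Nil
  have "count_list ([] :: nat list) = (\<lambda>_. 0)"
    by (simp add: fun_eq_iff)
  then show ?case by simp
next
  case (Cons i "is")
  have eq: "(count_list is)(i := Suc (count_list is i)) = count_list (i # is)"
    by (auto simp: fun_eq_iff)
  obtain m where m: "\<And>j. j \<in> set is \<Longrightarrow> j < m"
    by (meson List.finite_set finite_nat_set_iff_bounded)
  have z: "count_list is j = 0" if "m \<le> j" for j
    using m[of j] that by (auto simp: count_list_0_iff)
  have "has_dir_deriv (mollify (count_list is) u) (unit_vec i) x (mollify (count_list (i # is)) u x)" for x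
    using mollify_has_dir_deriv_unit[OF L, where \<alpha> = "count_list is" and m = m and i = i and x = x] z
    unfolding eq by blast
  then have "dir_deriv (unit_vec i) (mollify (count_list is) u) = mollify (count_list (i # is)) u"
    by (intro ext dir_deriv_eqI)
  then show ?case
    by (simp only: partial_list_Cons Cons)
qed

text \<open>The bounds on partial derivatives and on their weighted sums come from the kernels,
  given that \<open>u\<close> is bounded and Lipschitz. The hypothesis \<open>smooth\<close>
  supplies the Frechet clause: near each point all boxes fit into one convex set on which
  \<open>u\<close> has bounded derivatives.\<close>

lemma mollify_tame:
  assumes "\<kappa> > 0" and L: "\<And>x y. \<bar>u x - u y\<bar> \<le> L * norm (x - y)" "0 \<le> L" and B: "\<And>x. \<bar>u x\<bar> \<le> B"
    and smooth: "\<And>x. \<exists>V W. open V \<and> x \<in> V \<and> convex W \<and> open W \<and> smooth_bounded W u \<and> (\<forall>y\<in>V. box_over UNIV y \<subseteq> W)"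
  shows "tame (\<lambda>i. \<kappa> * (\<epsilon> i)\<^sup>2) (mollify (\<lambda>_. 0) u)"
  unfolding tame_def
proof (intro conjI allI)
  have u: "continuous_on UNIV u"
    by (rule continuous_on_of_lipschitz[OF L])
  fix "is" :: "nat list"
  obtain m where m: "\<And>j. j \<in> set is \<Longrightarrow> j < m"
    by (meson List.finite_set finite_nat_set_iff_bounded)
  have z: "count_list is j = 0" if "m \<le> j" for j
    using m[of j] that by (auto simp: count_list_0_iff)
  have "\<bar>mollify (count_list is) u x\<bar> \<le> order_bound m (count_list is) * B" for x
    by (rule mollify_abs_le[OF u _ L B]) (rule z)
  then show "\<exists>B. \<forall>x. \<bar>partial_list is (mollify (\<lambda>_. 0) u) x\<bar> \<le> B"
    unfolding partial_list_mollify[OF L] by blast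
  have "\<bar>mollify (count_list is) u x - mollify (count_list is) u y\<bar> \<le> order_bound m (count_list is) * L * norm (x - y)" for x y
    by (rule mollify_lipschitz[OF L]) (rule z)
  then show "\<exists>L\<ge>0. \<forall>x y. \<bar>partial_list is (mollify (\<lambda>_. 0) u) x - partial_list is (mollify (\<lambda>_. 0) u) y\<bar> \<le> L * norm (x - y)"
    unfolding partial_list_mollify[OF L] using L(2) order_bound_nonneg
    by (intro exI[of _ "order_bound m (count_list is) * L"]) auto
next
  fix k
  have "D_mi \<alpha> (mollify (\<lambda>_. 0) u) = mollify (Poly_Mapping.lookup \<alpha>) u" for \<alpha>
  proof -
    obtain js where js: "\<And>h. D_mi \<alpha> h = partial_list js h" "\<And>j. count_list js j = Poly_Mapping.lookup \<alpha> j"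
      using D_mi_list[of \<alpha>] by blast
    then have "count_list js = Poly_Mapping.lookup \<alpha>"
      by auto
    then show ?thesis
      by (simp add: js(1) partial_list_mollify[OF L])
  qed
  then show "\<exists>K. \<forall>S x. finite S \<longrightarrow> S \<subseteq> {\<alpha>. degree_mi \<alpha> \<le> k} \<longrightarrow>
      (\<Sum>\<alpha>\<in>S. \<bar>power_mi (\<lambda>i. \<kappa> * (\<epsilon> i)\<^sup>2) \<alpha> * D_mi \<alpha> (mollify (\<lambda>_. 0) u) x\<bar>) \<le> K"
    using mollify_weighted_sum[OF \<open>\<kappa> > 0\<close> L B] by simp
next
  fix x
  have "\<exists>U. open U \<and> y \<in> U \<and> smooth_bounded U u" for y
  proof -
    obtain V W where "y \<in> V" "open W" "smooth_bounded W u" "\<forall>z\<in>V. box_over UNIV z \<subseteq> W"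
      using smooth by blast
    then show ?thesis
      using box_over_self by blast
  qed
  moreover obtain V W where "open V" "x \<in> V" "convex W" "smooth_bounded W u" "\<forall>y\<in>V. box_over UNIV y \<subseteq> W"
    using smooth by blast
  ultimately have "smooth_bounded V (mollify (\<lambda>_. 0) u)"
    by (intro mollify_smooth_bounded[where W = W]) auto
  then show "\<exists>U. open U \<and> x \<in> U \<and> smooth_bounded U (mollify (\<lambda>_. 0) u)"
    using \<open>open V\<close> \<open>x \<in> V\<close> by blast
qed

end

section \<open>A map with locally finite-dimensional range\<close>

lemma bump_bounded: "\<exists>B. \<forall>s. \<bar>bump m s\<bar> \<le> B"
proof -
  have "bounded (bump m ` {-1..1})"
    by (intro compact_imp_bounded compact_continuous_image bump_continuous compact_Icc)
  then obtain B where B: "\<And>s. s \<in> {-1..1} \<Longrightarrow> norm (bump m s) \<le> B"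
    unfolding bounded_iff by blast
  have "\<bar>bump m s\<bar> \<le> max B 0" for s
  proof (cases "\<bar>s\<bar> \<le> 1")
    case True
    then have "s \<in> {-1..1}" by auto
    from B[OF this] show ?thesis by simp
  qed (simp add: bump_support)
  then show ?thesis by blast
qed

text \<open>The lower limit -2 lies strictly to the left of the support, so that every
  \<open>s \<ge> -1\<close> is interior to an interval on which the fundamental theorem
  applies.\<close>

definition step :: "real \<Rightarrow> real"
  where "step s = integral {-2..s} (bump 0)"

lemma step_eq_0: "s \<le> -1 \<Longrightarrow> step s = 0"
  unfolding step_def by (rule integral_unique, rule has_integral_is_0) (simp add: bump_support)

lemma step_eq_1: "s \<ge> 1 \<Longrightarrow> step s = 1"
proof -
  assume "s \<ge> 1"
  have "(bump 0 has_integral 1) {-1..1}"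
    using bump_integral bump_continuous integrable_continuous_interval integrable_integral by metis
  then have "(bump 0 has_integral 1) {-2..s}"
    by (rule has_integral_on_superset) (use \<open>s \<ge> 1\<close> in \<open>auto intro: bump_support\<close>)
  then show "step s = 1"
    by (simp add: step_def integral_unique)
qed

lemma step_has_derivative: "(step has_real_derivative bump 0 s) (at s)"
proof (cases "s < -1")
  case True
  have "(step has_real_derivative 0) (at s)"
    by (rule has_field_derivative_transform_within_open[OF DERIV_const[of 0], where S = "{..<-1}"])
       (use True in \<open>auto simp: step_eq_0\<close>)
  then show ?thesis
    using True by (simp add: bump_support)
next
  case False
  have "(step has_real_derivative bump 0 s) (at s within {-2..s + 1})"
    unfolding step_def[abs_def] using False
    by (intro integral_has_real_derivative bump_continuous) auto
  then show ?thesis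
    using False at_within_Icc_at[of "-2" s "s + 1"] by simp
qed

lemma step_range: "0 \<le> step s" "step s \<le> 1"
proof -
  have mono: "step x \<le> step y" if "x \<le> y" for x y
    using that by (intro DERIV_nonneg_imp_nondecreasing[of x y step])
      (auto intro: step_has_derivative bump_nonneg)
  show "0 \<le> step s"
    using mono[of "min s (-1)" s] step_eq_0[of "min s (-1)"] by simp
  show "step s \<le> 1"
    using mono[of s "max s 1"] step_eq_1[of "max s 1"] by simp
qed

section \<open>Tails of sequences\<close>

definition drop_coords :: "nat \<Rightarrow> ell2 \<Rightarrow> ell2"
  where "drop_coords n x = x - (\<Sum>j<n. coord x j *\<^sub>R unit_vec j)"

lemma coord_drop_coords: "coord (drop_coords n x) i = (if i < n then 0 else coord x i)"
  by (simp add: drop_coords_def coord_diff coord_sum_unit_vec)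

lemma drop_coords_diff: "drop_coords n (x - y) = drop_coords n x - drop_coords n y"
  by (rule ell2_eqI) (simp add: coord_drop_coords coord_diff)

lemma norm_le_of_coord_le:
  assumes "\<And>i. \<bar>coord x i\<bar> \<le> \<bar>coord y i\<bar>"
  shows "norm x \<le> norm y"
proof -
  have "(norm x)\<^sup>2 \<le> (norm y)\<^sup>2"
    unfolding norm_ell2_sq
    by (rule suminf_le[OF _ summable_coord_sq summable_coord_sq]) (use assms in \<open>simp add: abs_le_square_iff\<close>)
  then show ?thesis by simp
qed

lemma norm_drop_coords_le: "norm (drop_coords n x) \<le> norm x"
  by (rule norm_le_of_coord_le) (simp add: coord_drop_coords)

lemma norm_drop_coords_antimono: "m \<le> n \<Longrightarrow> norm (drop_coords n x) \<le> norm (drop_coords m x)"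
  by (rule norm_le_of_coord_le) (simp add: coord_drop_coords)

text \<open>Pythagoras. The squared tail is the squared norm minus finitely many squared
  coordinates, which is what makes functions of it smooth.\<close>

lemma norm_drop_coords_sq: "(norm (drop_coords n x))\<^sup>2 = (norm x)\<^sup>2 - (\<Sum>j<n. (coord x j)\<^sup>2)"
proof -
  have i: "x \<bullet> (\<Sum>j<n. coord x j *\<^sub>R unit_vec j) = (\<Sum>j<n. (coord x j)\<^sup>2)"
    by (simp add: inner_sum_right inner_commute[of x] unit_vec_inner power2_eq_square)
  have "(norm (drop_coords n x))\<^sup>2 = x \<bullet> x - 2 * (x \<bullet> (\<Sum>j<n. coord x j *\<^sub>R unit_vec j))
      + (norm (\<Sum>j<n. coord x j *\<^sub>R unit_vec j))\<^sup>2"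
    unfolding drop_coords_def power2_norm_eq_inner
    by (simp add: inner_diff_left inner_diff_right inner_commute)
  then show ?thesis
    unfolding i norm_sum_unit_vec_sq by (simp add: power2_norm_eq_inner)
qed

lemma norm_drop_coords_tendsto_0: "(\<lambda>n. norm (drop_coords n x)) \<longlonglongrightarrow> 0"
proof -
  have "(\<lambda>n. sqrt ((norm x)\<^sup>2 - (\<Sum>j<n. (coord x j)\<^sup>2))) \<longlonglongrightarrow> sqrt ((norm x)\<^sup>2 - suminf (\<lambda>i. (coord x i)\<^sup>2))"
    by (intro tendsto_intros summable_LIMSEQ summable_coord_sq)
  then show ?thesis
    unfolding norm_drop_coords_sq[symmetric] by (simp add: norm_ell2_sq[of x])
qed

lemma norm_drop_coords_lipschitz: "\<bar>norm (drop_coords n x) - norm (drop_coords n y)\<bar> \<le> norm (x - y)"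
  using norm_triangle_ineq3[of "drop_coords n x" "drop_coords n y"] norm_drop_coords_le[of n "x - y"]
  by (simp add: drop_coords_diff)

section \<open>The cut-off map and its local dimension\<close>

locale cutoff =
  fixes b :: real
  assumes b_pos: "b > 0"
begin

text \<open>A smooth transition together with all its derivatives. The affine argument sends
  \<open>b / 2\<close> to -1 and \<open>b\<close> to 1, so \<open>\<theta> 0\<close> rises from 0 to
  1 between these values.\<close>

definition \<theta> :: "nat \<Rightarrow> real \<Rightarrow> real"
  where "\<theta> m T = (case m of 0 \<Rightarrow> step (4 * T / b - 3) | Suc j \<Rightarrow> (4 / b) ^ m * bump j (4 * T / b - 3))"

lemma \<theta>_has_derivative: "(\<theta> m has_real_derivative \<theta> (Suc m) T) (at T)"
proof -
  have lin: "((\<lambda>T. 4 * T / b - 3) has_real_derivative 4 / b) (at T)"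
    using b_pos by (auto intro!: derivative_eq_intros)
  show ?thesis
  proof (cases m)
    case 0
    then show ?thesis
      using DERIV_chain2[OF step_has_derivative lin] by (simp add: \<theta>_def[abs_def] mult.commute)
  next
    case (Suc j)
    show ?thesis
      using DERIV_cmult[OF DERIV_chain2[OF bump_has_derivative lin], of "(4 / b) ^ m"] Suc
      by (simp add: \<theta>_def[abs_def] mult_ac)
  qed
qed

lemma \<theta>_bounded: "\<exists>B. \<forall>T. \<bar>\<theta> m T\<bar> \<le> B"
proof (cases m)
  case 0
  then show ?thesis
    using step_range by (intro exI[of _ 1]) (auto simp: \<theta>_def)
next
  case (Suc j)
  obtain B where B: "\<And>s. \<bar>bump j s\<bar> \<le> B"
    using bump_bounded by blast
  have "\<bar>\<theta> m T\<bar> \<le> (4 / b) ^ m * B" for T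
    using mult_left_mono[OF B[of "4 * T / b - 3"], of "(4 / b) ^ m"] b_pos Suc
    by (simp add: \<theta>_def abs_mult)
  then show ?thesis by blast
qed

lemma \<theta>_eq_0: "T \<le> b / 2 \<Longrightarrow> \<theta> 0 T = 0"
  using b_pos by (simp add: \<theta>_def step_eq_0 field_simps)

lemma \<theta>_eq_1: "b \<le> T \<Longrightarrow> \<theta> 0 T = 1"
  using b_pos by (simp add: \<theta>_def step_eq_1 field_simps)

lemma \<theta>_range: "0 \<le> \<theta> 0 T" "\<theta> 0 T \<le> 1"
  by (simp_all add: \<theta>_def step_range)

text \<open>The derivative contains a factor \<open>2 * s\<close>, but
  \<open>\<theta> 1 (s^2)\<close> vanishes once \<open>s^2\<close> exceeds \<open>b\<close>, so only
  \<open>\<bar>s\<bar> \<le> sqrt b\<close> counts.\<close>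

lemma \<theta>_sq_lipschitz: "\<exists>C\<ge>0. \<forall>s t. \<bar>\<theta> 0 (s\<^sup>2) - \<theta> 0 (t\<^sup>2)\<bar> \<le> C * \<bar>s - t\<bar>"
proof -
  obtain B where B: "\<And>T. \<bar>\<theta> 1 T\<bar> \<le> B"
    using \<theta>_bounded by blast
  have d: "((\<lambda>s. \<theta> 0 (s\<^sup>2)) has_real_derivative \<theta> 1 (s\<^sup>2) * (2 * s)) (at s)" for s
    by (rule DERIV_chain2[where f = "\<theta> 0"])
       (use \<theta>_has_derivative[of 0] in \<open>auto intro!: derivative_eq_intros\<close>)
  have bd: "\<bar>\<theta> 1 (s\<^sup>2) * (2 * s)\<bar> \<le> B * (2 * sqrt b)" for s
  proof (cases "s\<^sup>2 \<le> b")
    case True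
    then have "\<bar>s\<bar> \<le> sqrt b"
      using real_le_rsqrt by (metis power2_abs)
    then show ?thesis
      unfolding abs_mult using B[of "s\<^sup>2"] by (intro mult_mono) (auto intro: order_trans[OF abs_ge_zero])
  next
    case False
    then have "1 \<le> \<bar>4 * s\<^sup>2 / b - 3\<bar>"
      using b_pos by (simp add: field_simps)
    then have "\<theta> 1 (s\<^sup>2) = 0"
      by (simp add: \<theta>_def bump_support)
    then show ?thesis
      using order_trans[OF abs_ge_zero B] b_pos by simp
  qed
  have "\<bar>\<theta> 0 (s\<^sup>2) - \<theta> 0 (t\<^sup>2)\<bar> \<le> B * (2 * sqrt b) * \<bar>s - t\<bar>" for s t
    using field_differentiable_bound[of UNIV "\<lambda>s. \<theta> 0 (s\<^sup>2)" "\<lambda>s. \<theta> 1 (s\<^sup>2) * (2 * s)" "B * (2 * sqrt b)" s t]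
      d bd by (simp add: dist_real_def)
  moreover have "0 \<le> B * (2 * sqrt b)"
    using order_trans[OF abs_ge_zero B] b_pos by simp
  ultimately show ?thesis by blast
qed

text \<open>
  Coordinate \<open>i\<close> is switched off as soon as the tail of \<open>x\<close> from \<open>i\<close> on is short.  As the tails tend to 0,
  near every point only finitely many coordinates survive.
\<close>

definition cut :: "nat \<Rightarrow> ell2 \<Rightarrow> real"
  where "cut i x = \<theta> 0 ((norm (drop_coords i x))\<^sup>2)"

definition moulis :: "ell2 \<Rightarrow> ell2"
  where "moulis x = Abs_ell2 (\<lambda>i. cut i x * coord x i)"

lemma cut_range: "0 \<le> cut i x" "cut i x \<le> 1"
  by (simp_all add: cut_def \<theta>_range)

lemma coord_Abs_of_le:
  assumes "\<And>i. \<bar>f i\<bar> \<le> \<bar>coord x i\<bar>"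
  shows "coord (Abs_ell2 f) i = f i"
proof -
  have "summable (\<lambda>i. (f i)\<^sup>2)"
    by (rule summable_comparison_test'[OF summable_coord_sq[of x]])
       (use assms in \<open>simp add: abs_le_square_iff[symmetric]\<close>)
  then show ?thesis
    by (simp add: Abs_ell2_inverse)
qed

lemma coord_moulis: "coord (moulis x) i = cut i x * coord x i"
  unfolding moulis_def
proof (rule coord_Abs_of_le)
  show "\<bar>cut i x * coord x i\<bar> \<le> \<bar>coord x i\<bar>" for i
    using cut_range[of i x] by (simp add: abs_mult mult_left_le_one_le)
qed

lemma cut_eq_1: "sqrt b \<le> norm (drop_coords i x) \<Longrightarrow> cut i x = 1"
  unfolding cut_def by (intro \<theta>_eq_1) (simp add: sqrt_le_D)

lemma cut_eq_0: "norm (drop_coords i x) \<le> sqrt (b / 2) \<Longrightarrow> cut i x = 0"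
  unfolding cut_def using b_pos
  by (intro \<theta>_eq_0) (metis norm_ge_zero power_mono real_sqrt_pow2 half_gt_zero_iff less_imp_le)

lemma ex_norm_drop_coords_less: "e > 0 \<Longrightarrow> \<exists>n. norm (drop_coords n x) < e"
  using order_tendstoD(2)[OF norm_drop_coords_tendsto_0[of x], of e]
  by (meson eventually_happens trivial_limit_sequentially)

text \<open>Up to the first index \<open>n\<close> at which the tail is shorter than
  \<open>sqrt b\<close> nothing is changed; from \<open>n\<close> on coordinates only shrink, so the
  displacement is at most that short tail.\<close>

lemma moulis_near_id: "norm (moulis x - x) \<le> sqrt b"
proof -
  define n where "n = (LEAST n. norm (drop_coords n x) < sqrt b)"
  have n: "norm (drop_coords n x) < sqrt b"
  proof -
    have "\<exists>n. norm (drop_coords n x) < sqrt b"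
      using ex_norm_drop_coords_less b_pos by simp
    then show ?thesis
      unfolding n_def by (rule LeastI_ex)
  qed
  have below: "cut i x = 1" if "i < n" for i
    using not_less_Least[of i "\<lambda>n. norm (drop_coords n x) < sqrt b"] that
    by (intro cut_eq_1) (simp add: n_def)
  have "norm (moulis x - x) \<le> norm (drop_coords n x)"
  proof (rule norm_le_of_coord_le)
    fix i
    have "\<bar>coord (moulis x - x) i\<bar> = \<bar>cut i x - 1\<bar> * \<bar>coord x i\<bar>"
      by (simp add: coord_diff coord_moulis abs_mult[symmetric] algebra_simps)
    also have "\<dots> \<le> (if i < n then 0 else \<bar>coord x i\<bar>)"
      using below[of i] cut_range[of i x] by (auto intro!: mult_left_le_one_le)
    finally show "\<bar>coord (moulis x - x) i\<bar> \<le> \<bar>coord (drop_coords n x) i\<bar>"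
      by (simp add: coord_drop_coords split: if_splits)
  qed
  then show ?thesis using n by simp
qed

text \<open>Let \<open>n\<close> be the first index at which one of the two tails is shorter than
  \<open>sqrt b\<close>, say that of \<open>y\<close>; below \<open>n\<close> both cuts are 1. The
  difference splits into \<open>cut i x * (x - y)\<close>, of norm at most
  \<open>norm (x - y)\<close>, and \<open>(cut i x - cut i y) * y\<close>, which lives on the short
  tail of \<open>y\<close>. The constant \<open>1 + C * sqrt b\<close> is therefore free of the
  dimension.\<close>

lemma moulis_lipschitz: "\<exists>\<Lambda>\<ge>0. \<forall>x y. norm (moulis x - moulis y) \<le> \<Lambda> * norm (x - y)"
proof -
  obtain C where C: "C \<ge> 0" "\<And>s t. \<bar>\<theta> 0 (s\<^sup>2) - \<theta> 0 (t\<^sup>2)\<bar> \<le> C * \<bar>s - t\<bar>"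
    using \<theta>_sq_lipschitz by blast
  have cut: "\<bar>cut i x - cut i y\<bar> \<le> C * norm (x - y)" for i x y
    unfolding cut_def using order_trans[OF C(2) mult_left_mono[OF norm_drop_coords_lipschitz C(1)]] .
  have main: "norm (moulis x - moulis y) \<le> (1 + C * sqrt b) * norm (x - y)"
    if n: "norm (drop_coords n y) < sqrt b" "\<And>i. i < n \<Longrightarrow> cut i x = cut i y" for x y n
  proof -
    define A where "A = Abs_ell2 (\<lambda>i. cut i x * coord (x - y) i)"
    have le: "\<bar>cut i x * coord (x - y) i\<bar> \<le> \<bar>coord (x - y) i\<bar>" for i
      using cut_range[of i x] by (simp add: abs_mult mult_left_le_one_le)
    have A: "coord A i = cut i x * coord (x - y) i" for i
      unfolding A_def by (rule coord_Abs_of_le[OF le])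
    have "norm A \<le> norm (x - y)"
      by (rule norm_le_of_coord_le) (use le A in simp)
    moreover have "norm (moulis x - moulis y - A) \<le> norm ((C * norm (x - y)) *\<^sub>R drop_coords n y)"
    proof (rule norm_le_of_coord_le)
      fix i
      have "coord (moulis x - moulis y - A) i = (cut i x - cut i y) * coord y i"
        by (simp only: coord_diff coord_moulis A) (simp add: algebra_simps)
      then have "\<bar>coord (moulis x - moulis y - A) i\<bar> = \<bar>cut i x - cut i y\<bar> * \<bar>coord y i\<bar>"
        by (simp add: abs_mult)
      also have "\<dots> \<le> (if i < n then 0 else (C * norm (x - y)) * \<bar>coord y i\<bar>)"
        using n(2)[of i] cut[of i x y] by (auto intro!: mult_right_mono)
      finally show "\<bar>coord (moulis x - moulis y - A) i\<bar> \<le> \<bar>coord ((C * norm (x - y)) *\<^sub>R drop_coords n y) i\<bar>"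
        using C(1) by (simp add: coord_scaleR coord_drop_coords abs_mult split: if_splits)
    qed
    moreover have "norm ((C * norm (x - y)) *\<^sub>R drop_coords n y) \<le> (C * norm (x - y)) * sqrt b"
      using C(1) n(1) by (simp add: mult_left_mono)
    moreover have "norm (moulis x - moulis y) \<le> norm (moulis x - moulis y - A) + norm A"
      using norm_triangle_ineq[of "moulis x - moulis y - A" A] by simp
    ultimately show ?thesis
      by (simp add: algebra_simps)
  qed
  have "norm (moulis x - moulis y) \<le> (1 + C * sqrt b) * norm (x - y)" for x y
  proof -
    define n where "n = (LEAST n. norm (drop_coords n x) < sqrt b \<or> norm (drop_coords n y) < sqrt b)"
    have n: "norm (drop_coords n x) < sqrt b \<or> norm (drop_coords n y) < sqrt b"
    proof -
      have "\<exists>n. norm (drop_coords n x) < sqrt b"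
        using ex_norm_drop_coords_less b_pos by simp
      then have "\<exists>n. norm (drop_coords n x) < sqrt b \<or> norm (drop_coords n y) < sqrt b"
        by blast
      then show ?thesis
        unfolding n_def by (rule LeastI_ex)
    qed
    have below: "cut i x = 1 \<and> cut i y = 1" if "i < n" for i
      using not_less_Least[of i "\<lambda>n. norm (drop_coords n x) < sqrt b \<or> norm (drop_coords n y) < sqrt b"] that
      by (auto simp: n_def intro!: cut_eq_1)
    from n show ?thesis
    proof
      assume "norm (drop_coords n y) < sqrt b"
      then show ?thesis
        by (rule main) (use below in simp)
    next
      assume "norm (drop_coords n x) < sqrt b"
      then have "norm (moulis y - moulis x) \<le> (1 + C * sqrt b) * norm (y - x)"
        by (rule main) (use below in simp)
      then show ?thesis
        by (simp add: norm_minus_commute)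
    qed
  qed
  moreover have "0 \<le> 1 + C * sqrt b"
    using C(1) b_pos by simp
  ultimately show ?thesis by blast
qed

text \<open>For \<open>s = sqrt (b / 2)\<close> the map takes values in the span of the first
  \<open>N\<close> unit vectors here. The bound \<open>R\<close> makes linear forms and the squared
  norm bounded, and convexity is required for averaging.\<close>

definition region :: "nat \<Rightarrow> real \<Rightarrow> real \<Rightarrow> ell2 set"
  where "region N s R = {x. norm x < R \<and> norm (drop_coords N x) < s}"

lemma open_region: "open (region N s R)"
proof -
  have "continuous_on UNIV (\<lambda>x. norm (drop_coords N x))"
    by (rule continuous_on_of_lipschitz[of _ _ 1]) (use norm_drop_coords_lipschitz in auto)
  then have "open {x. norm (drop_coords N x) < s}"
    by (intro open_Collect_less) auto
  moreover have "open {x::ell2. norm x < R}"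
    by (intro open_Collect_less continuous_intros)
  ultimately show ?thesis
    unfolding region_def by (simp add: Collect_conj_eq open_Int)
qed

lemma convex_region: "convex (region N s R)"
proof -
  have dc: "drop_coords N (u *\<^sub>R x + v *\<^sub>R y) = u *\<^sub>R drop_coords N x + v *\<^sub>R drop_coords N y" for u v x y
    by (rule ell2_eqI) (simp add: coord_drop_coords coord_add coord_scaleR)
  have conv: "norm (u *\<^sub>R p + v *\<^sub>R q) < r" if "norm p < r" "norm q < r" "0 \<le> u" "0 \<le> v" "u + v = 1" for u v r and p q :: ell2
  proof -
    have "norm (u *\<^sub>R p + v *\<^sub>R q) \<le> u * norm p + v * norm q"
      using norm_triangle_ineq[of "u *\<^sub>R p" "v *\<^sub>R q"] that by simp
    also have "\<dots> < r"
      using that by (intro convex_bound_lt)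
    finally show ?thesis .
  qed
  show ?thesis
    unfolding convex_def region_def using conv by (auto simp: dc)
qed

lemma bounded_region: "bounded (region N s R)"
  unfolding bounded_iff region_def by (auto intro!: exI[of _ R])

lemma moulis_region:
  assumes "x \<in> region N (sqrt (b / 2)) R"
  shows "moulis x = (\<Sum>i<N. (cut i x * coord x i) *\<^sub>R unit_vec i)"
proof (rule ell2_eqI)
  fix i
  have "cut i x = 0" if "\<not> i < N"
    using assms norm_drop_coords_antimono[of N i x] that by (intro cut_eq_0) (auto simp: region_def)
  then show "coord (moulis x) i = coord (\<Sum>i<N. (cut i x * coord x i) *\<^sub>R unit_vec i) i"
    by (simp add: coord_moulis coord_sum_unit_vec)
qed

lemma unif_smooth_moulis_coord:
  "unif_smooth k (region N s R) {\<lambda>x. cut i x * coord x i | i. i < n}"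
proof -
  let ?U = "region N s R"
  have U: "open ?U" by (rule open_region)
  let ?I = "{\<lambda>x::ell2. v \<bullet> x | v. norm v \<le> 1}"
  have I: "unif_smooth k ?U ?I"
    by (rule unif_smooth_inner[OF U bounded_region])
  have one: "unif_smooth k ?U {\<lambda>x. cut i x * coord x i}" for i
  proof -
    let ?Q = "{\<lambda>x. f x * g x | f g. f \<in> ?I \<and> g \<in> ?I}"
    have "unif_smooth k ?U {\<lambda>x. p x + q x | p q. p \<in> {\<lambda>x. x \<bullet> x} \<and> q \<in> {\<lambda>x. \<Sum>j<i. f j x | f. \<forall>j<i. f j \<in> ?Q}}"
      by (intro unif_smooth_add[OF U] unif_smooth_sum[OF U] unif_smooth_mult[OF U] I
          unif_smooth_norm_sq[OF U bounded_region])
    moreover have "(\<lambda>x. (norm (drop_coords i x))\<^sup>2) \<in> {\<lambda>x. p x + q x | p q. p \<in> {\<lambda>x. x \<bullet> x} \<and> q \<in> {\<lambda>x. \<Sum>j<i. f j x | f. \<forall>j<i. f j \<in> ?Q}}"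
    proof -
      \<comment> \<open>The minus signs of the squared coordinates are hidden in
        \<open>- unit_vec j\<close>, so the squared tail is literally a sum of products from
        families already handled.\<close>
      have "(\<lambda>x. (- unit_vec j) \<bullet> x) \<in> ?I" "(\<lambda>x. unit_vec j \<bullet> x) \<in> ?I" for j
        by (rule CollectI, rule exI[of _ "- unit_vec j"], simp) (rule CollectI, rule exI[of _ "unit_vec j"], simp)
      then have "(\<lambda>x. ((- unit_vec j) \<bullet> x) * (unit_vec j \<bullet> x)) \<in> ?Q" for j
        by (rule prod_memI)
      then have "(\<lambda>x. \<Sum>j<i. ((- unit_vec j) \<bullet> x) * (unit_vec j \<bullet> x)) \<in> {\<lambda>x. \<Sum>j<i. f j x | f. \<forall>j<i. f j \<in> ?Q}"
        by (intro CollectI exI[of _ "\<lambda>j x. ((- unit_vec j) \<bullet> x) * (unit_vec j \<bullet> x)"]) simp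
      then have "(\<lambda>x. x \<bullet> x + (\<Sum>j<i. ((- unit_vec j) \<bullet> x) * (unit_vec j \<bullet> x)))
          \<in> {\<lambda>x. p x + q x | p q. p \<in> {\<lambda>x. x \<bullet> x} \<and> q \<in> {\<lambda>x. \<Sum>j<i. f j x | f. \<forall>j<i. f j \<in> ?Q}}"
        by (intro sum_memI) simp
      moreover have "(\<lambda>x. x \<bullet> x + (\<Sum>j<i. ((- unit_vec j) \<bullet> x) * (unit_vec j \<bullet> x))) = (\<lambda>x. (norm (drop_coords i x))\<^sup>2)"
        unfolding norm_drop_coords_sq unfolding power2_norm_eq_inner by (simp add: unit_vec_inner power2_eq_square sum_negf)
      ultimately show ?thesis by simp
    qed
    ultimately have T: "unif_smooth k ?U {\<lambda>x. (norm (drop_coords i x))\<^sup>2}"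
      by (elim unif_smooth_subset[OF _ _ U]) simp
    obtain B where B: "\<And>m T. \<bar>\<theta> m T\<bar> \<le> B m"
      using \<theta>_bounded by metis
    have "unif_smooth k ?U {\<lambda>x. \<theta> m (f x) | m f. m \<le> 0 \<and> f \<in> {\<lambda>x. (norm (drop_coords i x))\<^sup>2}}"
      by (rule unif_smooth_comp[where \<theta> = \<theta> and B = B, OF U \<theta>_has_derivative B T])
    then have "unif_smooth k ?U {cut i}"
      by (rule unif_smooth_subset[OF _ _ U]) (auto simp: cut_def[abs_def])
    from unif_smooth_mult[OF U this I] show ?thesis
    proof (rule unif_smooth_subset[OF _ _ U], safe)
      show "\<exists>f g. (\<lambda>x. cut i x * coord x i) = (\<lambda>x. f x * g x) \<and> f \<in> {cut i} \<and> g \<in> ?I"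
        by (rule exI[of _ "cut i"], rule exI[of _ "\<lambda>x. unit_vec i \<bullet> x"])
           (auto simp: unit_vec_inner intro!: exI[of _ "unit_vec i"])
    qed
  qed
  have "unif_smooth k ?U (\<Union>i\<in>{..<n}. {\<lambda>x. cut i x * coord x i})"
    by (rule unif_smooth_finite_UN) (auto intro: one)
  then show ?thesis
    by (rule unif_smooth_subset[OF _ _ U]) auto
qed

end

text \<open>The place where a locally finite-dimensional range pays off. \<open>D\<close> may have
  bounds that depend on the multi-index in an uncontrolled way; but \<open>k\<close> derivatives of
  the composition involve only a finite set of multi-indices, since each one raises an entry below
  \<open>N\<close>. The derivative itself comes from
  \<open>has_derivative_along_frame\<close>.\<close>

lemma unif_smooth_compose:
  fixes D :: "(nat \<Rightarrow> nat) \<Rightarrow> ell2 \<Rightarrow> real" and \<Phi> :: "nat \<Rightarrow> 'a::real_normed_vector \<Rightarrow> real"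
  assumes U: "open U"
    and deriv: "\<And>\<alpha> i x. \<alpha> \<in> \<A> \<Longrightarrow> has_dir_deriv (D \<alpha>) (unit_vec i) x (D (\<alpha>(i := Suc (\<alpha> i))) x)"
    and closed: "\<And>\<alpha> i. \<alpha> \<in> \<A> \<Longrightarrow> \<alpha>(i := Suc (\<alpha> i)) \<in> \<A>"
    and bounded: "\<And>\<alpha>. \<alpha> \<in> \<A> \<Longrightarrow> \<exists>B. \<forall>x. \<bar>D \<alpha> x\<bar> \<le> B"
    and cont: "\<And>\<alpha>. \<alpha> \<in> \<A> \<Longrightarrow> continuous_on UNIV (D \<alpha>)"
    and \<Phi>: "\<And>k. unif_smooth k U {\<Phi> i | i. i < N}"
  shows "finite A \<Longrightarrow> A \<subseteq> \<A> \<Longrightarrow> unif_smooth k U {\<lambda>x. D \<alpha> (\<Sum>i<N. \<Phi> i x *\<^sub>R unit_vec i) | \<alpha>. \<alpha> \<in> A}"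
proof (induction k arbitrary: A)
  case 0
  have "unif_smooth 0 U (\<Union>\<alpha>\<in>A. {\<lambda>x. D \<alpha> (\<Sum>i<N. \<Phi> i x *\<^sub>R unit_vec i)})"
  proof (rule unif_smooth_finite_UN[OF 0(1)])
    fix \<alpha> assume "\<alpha> \<in> A"
    then obtain B where "\<forall>x. \<bar>D \<alpha> x\<bar> \<le> B"
      using bounded 0(2) by blast
    then show "unif_smooth 0 U {\<lambda>x. D \<alpha> (\<Sum>i<N. \<Phi> i x *\<^sub>R unit_vec i)}"
      by auto
  qed
  then show ?case
    by (rule unif_smooth_subset[OF _ _ U]) auto
next
  case (Suc k)
  let ?H = "\<lambda>A. {\<lambda>x. D \<alpha> (\<Sum>i<N. \<Phi> i x *\<^sub>R unit_vec i) | \<alpha>. \<alpha> \<in> A}"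
  let ?A' = "(\<lambda>(\<alpha>, i). \<alpha>(i := Suc (\<alpha> i))) ` (A \<times> {..<N})"
  have A': "finite ?A'" "?A' \<subseteq> \<A>"
    using Suc.prems closed by auto
  have dd: "has_dir_deriv (\<lambda>x. D \<alpha> (\<Sum>i<N. \<Phi> i x *\<^sub>R unit_vec i)) v x
      (\<Sum>i<N. D (\<alpha>(i := Suc (\<alpha> i))) (\<Sum>i<N. \<Phi> i x *\<^sub>R unit_vec i) * dir_deriv v (\<Phi> i) x)"
    if "\<alpha> \<in> A" "x \<in> U" for \<alpha> v x
  proof -
    have "\<alpha> \<in> \<A>" using that(1) Suc.prems(2) by blast
    have "((\<lambda>t. D \<alpha> (0 + (\<Sum>i<N. \<Phi> i (x + t *\<^sub>R v) *\<^sub>R unit_vec i))) has_real_derivative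
      (\<Sum>i<N. D (\<alpha>(i := Suc (\<alpha> i))) (0 + (\<Sum>j<N. \<Phi> j (x + 0 *\<^sub>R v) *\<^sub>R unit_vec j)) * dir_deriv v (\<Phi> i) x)) (at 0)"
    proof (rule has_derivative_along_frame)
      fix i assume "i < N"
      show "has_dir_deriv (D \<alpha>) (unit_vec i) y (D (\<alpha>(i := Suc (\<alpha> i))) y)" for y
        by (rule deriv[OF \<open>\<alpha> \<in> \<A>\<close>])
      show "continuous_on UNIV (D (\<alpha>(i := Suc (\<alpha> i))))"
        by (rule cont[OF closed[OF \<open>\<alpha> \<in> \<A>\<close>]])
      have "has_dir_deriv (\<Phi> i) v x (dir_deriv v (\<Phi> i) x)"
        by (rule unif_smooth_dir_deriv[OF \<Phi>[of "Suc 0"] _ that(2)]) (use \<open>i < N\<close> in blast)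
      then show "((\<lambda>t. \<Phi> i (x + t *\<^sub>R v)) has_real_derivative dir_deriv v (\<Phi> i) x) (at 0)"
        by (simp add: has_dir_deriv_def)
    qed
    then show ?thesis
      by (simp add: has_dir_deriv_def)
  qed
  let ?P = "prod_family (?H ?A') (unit_dir_derivs {\<Phi> i | i. i < N})"
  have S: "unif_smooth k U {\<lambda>x. \<Sum>i<N. f i x | f. \<forall>i<N. f i \<in> ?P}"
    by (rule unif_smooth_sum[OF U unif_smooth_mult[OF U Suc.IH[OF A'] unif_smooth_unit_dir_derivs[OF \<Phi>]]])
  show ?case
  proof (rule unif_smooth_SucI[OF U Suc.IH[OF Suc.prems] S])
    fix h assume "h \<in> ?H A"
    then obtain \<alpha> where h: "h = (\<lambda>x. D \<alpha> (\<Sum>i<N. \<Phi> i x *\<^sub>R unit_vec i))" "\<alpha> \<in> A"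
      by blast
    let ?f = "\<lambda>v i x. D (\<alpha>(i := Suc (\<alpha> i))) (\<Sum>i<N. \<Phi> i x *\<^sub>R unit_vec i) * dir_deriv v (\<Phi> i) x"
    have "?f v i \<in> ?P" if "i < N" "norm v \<le> 1" for v i
    proof (rule prod_memI)
      have "\<alpha>(i := Suc (\<alpha> i)) \<in> ?A'"
        using h(2) that by (intro image_eqI[of _ _ "(\<alpha>, i)"]) auto
      then show "(\<lambda>x. D (\<alpha>(i := Suc (\<alpha> i))) (\<Sum>i<N. \<Phi> i x *\<^sub>R unit_vec i)) \<in> ?H ?A'"
        by (intro CollectI exI[of _ "\<alpha>(i := Suc (\<alpha> i))"] conjI refl)
      show "dir_deriv v (\<Phi> i) \<in> unit_dir_derivs {\<Phi> i | i. i < N}"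
        using that by blast
    qed
    then have "(\<lambda>x. \<Sum>i<N. ?f v i x) \<in> {\<lambda>x. \<Sum>i<N. f i x | f. \<forall>i<N. f i \<in> ?P}" if "norm v \<le> 1" for v
      using that by (intro CollectI exI[of _ "?f v"]) simp
    then show "\<exists>E. (\<forall>v. \<forall>x\<in>U. has_dir_deriv h v x (E v x)) \<and>
        (\<forall>v. norm v \<le> 1 \<longrightarrow> E v \<in> {\<lambda>x. \<Sum>i<N. f i x | f. \<forall>i<N. f i \<in> ?P})"
      using dd[OF h(2)] unfolding h(1) by (intro exI[of _ "\<lambda>v x. \<Sum>i<N. ?f v i x"] conjI allI ballI impI)
  qed
qed

section \<open>The exhaustion function\<close>

text \<open>The second clause says that any bound on the distance of \<open>g\<close> from a
  constant on a ball passes to \<open>h\<close> at its centre. With \<open>\<delta> = 0\<close>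
  regions of constancy survive exactly, shrunk by \<open>\<rho>\<close>.\<close>

lemma mollified_approximation:
  fixes a :: "nat \<Rightarrow> real"
  assumes a: "\<And>i. a i > 0" "summable a" and "\<rho> > 0"
    and L: "\<And>x y. \<bar>g x - g y\<bar> \<le> L * norm (x - y)" "0 \<le> L" and B: "\<And>x. \<bar>g x\<bar> \<le> B"
  shows "\<exists>h. tame a h \<and> (\<forall>x c \<delta>. (\<forall>y\<in>cball x \<rho>. \<bar>g y - c\<bar> \<le> \<delta>) \<longrightarrow> \<bar>h x - c\<bar> \<le> \<delta>)"
proof -
  \<comment> \<open>Three displacements have to fit into \<open>\<rho>\<close>: the box of the outer
    averaging, the cut-off map, and the box of the inner averaging, each at most
    \<open>r\<close>.\<close>
  define r where "r = \<rho> / 3"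
  have r: "r > 0" using \<open>\<rho> > 0\<close> by (simp add: r_def)
  \<comment> \<open>With \<open>(\<epsilon> i)\<^sup>2\<close> proportional to \<open>a i\<close>, both \<open>\<epsilon> i\<close> and \<open>a i / \<epsilon> i\<close> are square-summable: the former
    keeps the averaging boxes bounded, the latter pairs with \<open>iter_bessel\<close> by Cauchy-Schwarz.\<close>
  define c where "c = r\<^sup>2 / suminf a"
  have sa: "suminf a > 0"
    using a by (intro suminf_pos) auto
  have c: "c > 0"
    using r sa by (simp add: c_def)
  define \<epsilon> where "\<epsilon> i = sqrt (c * a i)" for i
  have \<epsilon>_sq: "(\<epsilon> i)\<^sup>2 = c * a i" for i
    using c a(1)[of i] by (simp add: \<epsilon>_def)
  interpret mollifier \<epsilon>
  proof
    show "\<epsilon> i > 0" for i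
      using c a(1)[of i] by (simp add: \<epsilon>_def)
    show "summable (\<lambda>i. (\<epsilon> i)\<^sup>2)"
      unfolding \<epsilon>_sq by (intro summable_mult a)
  qed
  \<comment> \<open>The scale \<open>c\<close> was chosen for this: the full box then has radius
    \<open>r\<close>.\<close>
  have "suminf (\<lambda>i. (\<epsilon> i)\<^sup>2) = r\<^sup>2"
    unfolding \<epsilon>_sq suminf_mult[OF a(2)] c_def using sa by simp
  then have tail: "tail 0 = r"
    using r by (simp add: tail_def)
  interpret cutoff "r\<^sup>2"
    by standard (use r in simp)
  define G where "G = mollify (\<lambda>_. 0) g"
  define F where "F = (\<lambda>x. G (moulis x))"
  have g: "continuous_on UNIV g"
    by (rule continuous_on_of_lipschitz[OF L])
  have GL: "\<bar>G x - G y\<bar> \<le> L * norm (x - y)" for x y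
    using mollify_lipschitz[OF L, where m = 0 and \<alpha> = "\<lambda>_. 0"] by (simp add: G_def order_bound_0)
  obtain \<Lambda> where \<Lambda>: "\<Lambda> \<ge> 0" "\<And>x y. norm (moulis x - moulis y) \<le> \<Lambda> * norm (x - y)"
    using moulis_lipschitz by blast
  have FL: "\<bar>F x - F y\<bar> \<le> (L * \<Lambda>) * norm (x - y)" for x y
    unfolding F_def using order_trans[OF GL mult_left_mono[OF \<Lambda>(2) L(2)]] by (simp add: mult.assoc)
  have L\<Lambda>: "0 \<le> L * \<Lambda>"
    using L(2) \<Lambda>(1) by simp
  have F: "continuous_on UNIV F"
    by (rule continuous_on_of_lipschitz[OF FL L\<Lambda>])
  have box_norm: "norm (y - x) \<le> r" if "y \<in> box_over UNIV x" for x y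
    using box_over_norm_le[OF _ that, of 0] tail by simp
  have near: "\<bar>mollify (\<lambda>_. 0) F x - c\<bar> \<le> \<delta>" if near_g: "\<forall>y\<in>cball x \<rho>. \<bar>g y - c\<bar> \<le> \<delta>" for x c \<delta>
  proof (rule mollify_near_const[OF F FL L\<Lambda>])
    fix y assume y: "y \<in> box_over UNIV x"
    show "\<bar>F y - c\<bar> \<le> \<delta>"
      unfolding F_def G_def
    proof (rule mollify_near_const[OF g L])
      fix z assume z: "z \<in> box_over UNIV (moulis y)"
      have "norm (z - x) \<le> norm (z - moulis y) + norm (moulis y - y) + norm (y - x)"
        using norm_triangle_ineq[of "z - moulis y" "moulis y - y"] norm_triangle_ineq[of "z - y" "y - x"] by simp
      also have "\<dots> \<le> r + r + r"
        using box_norm[OF z] box_norm[OF y] moulis_near_id[of y] r by simp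
      finally have "z \<in> cball x \<rho>"
        by (simp add: r_def dist_norm norm_minus_commute)
      then show "\<bar>g z - c\<bar> \<le> \<delta>"
        using near_g by blast
    qed
  qed
  \<comment> \<open>The threshold of \<open>cut_eq_0\<close> for
    \<open>b = r\<^sup>2\<close>.\<close>
  let ?s = "sqrt (r\<^sup>2 / 2)"
  have s: "?s > 0" using r by simp
  have smooth: "smooth_bounded (region N ?s R) F" for N R
  proof (rule smooth_bounded_cong)
    let ?\<A> = "{\<alpha>. \<exists>m. \<forall>i\<ge>m. \<alpha> i = (0::nat)}"
    let ?F = "\<lambda>x. mollify (\<lambda>_. 0) g (\<Sum>i<N. (cut i x * coord x i) *\<^sub>R unit_vec i)"
    show "smooth_bounded (region N ?s R) ?F"
      unfolding smooth_bounded_def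
    proof (intro conjI allI open_region)
      fix k
      have "unif_smooth k (region N ?s R) {\<lambda>x. mollify \<alpha> g (\<Sum>i<N. (cut i x * coord x i) *\<^sub>R unit_vec i) | \<alpha>. \<alpha> \<in> {\<lambda>_. 0}}"
      proof (rule unif_smooth_compose[OF open_region, where \<A> = ?\<A>])
        fix \<alpha> :: "nat \<Rightarrow> nat" and i assume "\<alpha> \<in> ?\<A>"
        then obtain m where m: "\<And>i. m \<le> i \<Longrightarrow> \<alpha> i = 0" by blast
        show "has_dir_deriv (mollify \<alpha> g) (unit_vec i) x (mollify (\<alpha>(i := Suc (\<alpha> i))) g x)" for x
          by (rule mollify_has_dir_deriv_unit[OF L]) (rule m)
        have "\<forall>j\<ge>max m (Suc i). (\<alpha>(i := Suc (\<alpha> i))) j = 0"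
          using m by simp
        then show "\<alpha>(i := Suc (\<alpha> i)) \<in> ?\<A>"
          by blast
        have "\<bar>mollify \<alpha> g x\<bar> \<le> order_bound m \<alpha> * B" for x
          by (rule mollify_abs_le[OF g _ L B]) (rule m)
        then show "\<exists>B. \<forall>x. \<bar>mollify \<alpha> g x\<bar> \<le> B"
          by blast
        have "\<bar>mollify \<alpha> g x - mollify \<alpha> g y\<bar> \<le> order_bound m \<alpha> * L * norm (x - y)" for x y
          by (rule mollify_lipschitz[OF L]) (rule m)
        then show "continuous_on UNIV (mollify \<alpha> g)"
          by (rule continuous_on_of_lipschitz) (intro mult_nonneg_nonneg order_bound_nonneg L(2))
      next
        show "unif_smooth k (region N ?s R) {\<lambda>x. cut i x * coord x i | i. i < N}" for k
          by (rule unif_smooth_moulis_coord)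
      qed auto
      then show "unif_smooth k (region N ?s R) {?F}"
        by (rule unif_smooth_subset[OF _ _ open_region]) auto
    qed
    show "?F x = F x" if "x \<in> region N ?s R" for x
      using moulis_region[OF that] by (simp add: F_def G_def)
  qed
  have "tame (\<lambda>i. (1 / c) * (\<epsilon> i)\<^sup>2) (mollify (\<lambda>_. 0) F)"
  proof (rule mollify_tame[OF _ FL L\<Lambda>])
    have GB: "\<bar>G x\<bar> \<le> B" for x
      using mollify_abs_le[OF g _ L B, where m = 0 and \<alpha> = "\<lambda>_. 0"] by (simp add: G_def order_bound_0)
    show "\<bar>F x\<bar> \<le> B" for x
      by (simp add: F_def GB)
    fix x
    have "\<forall>\<^sub>F n in sequentially. norm (drop_coords n x) < ?s / 2"
      by (rule order_tendstoD(2)[OF norm_drop_coords_tendsto_0]) (use s in simp)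
    moreover have "\<forall>\<^sub>F n in sequentially. tail n < ?s / 2"
      by (rule order_tendstoD(2)[OF tail_tendsto_0]) (use s in simp)
    ultimately obtain N where N: "norm (drop_coords N x) < ?s / 2" "tail N < ?s / 2"
      by (metis (mono_tags, lifting) eventually_conj eventually_happens trivial_limit_sequentially)
    \<comment> \<open>A box has radius up to \<open>r\<close>, which exceeds \<open>?s\<close>, so
      it is not contained in a small ball. But its coordinates from \<open>N\<close> on contribute
      less than \<open>?s / 2\<close>, and so do those of the points of \<open>?V\<close>; hence all
      boxes over \<open>?V\<close> lie in \<open>?W\<close>.\<close>
    let ?V = "region N (?s / 2) (norm x + 1)" and ?W = "region N ?s (norm x + 1 + r)"
    have "box_over UNIV y \<subseteq> ?W" if "y \<in> ?V" for y
    proof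
      fix z assume z: "z \<in> box_over UNIV y"
      have "norm z \<le> norm y + norm (z - y)"
        using norm_triangle_ineq[of y "z - y"] by simp
      then have "norm z < norm x + 1 + r"
        using box_norm[OF z] that by (auto simp: region_def)
      \<comment> \<open>An auxiliary point that keeps only the displacement in coordinates from
        \<open>N\<close> on, so that \<open>box_over_norm_le\<close> applies with
        \<open>tail N\<close>.\<close>
      moreover have "y + drop_coords N (z - y) \<in> box_over {N..} y"
        using z by (auto simp: box_over_def coord_add coord_drop_coords coord_diff)
      then have "norm (drop_coords N (z - y)) \<le> tail N"
        using box_over_norm_le[of "{N..}" N "y + drop_coords N (z - y)" y] by simp
      moreover have "norm (drop_coords N z) \<le> norm (drop_coords N y) + norm (drop_coords N (z - y))"
        using norm_triangle_ineq[of "drop_coords N y" "drop_coords N (z - y)"] by (simp add: drop_coords_diff)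
      ultimately show "z \<in> ?W"
        using that N(2) by (auto simp: region_def)
    qed
    moreover have "x \<in> ?V"
      using N(1) by (simp add: region_def)
    ultimately show "\<exists>V W. open V \<and> x \<in> V \<and> convex W \<and> open W \<and> smooth_bounded W F \<and> (\<forall>y\<in>V. box_over UNIV y \<subseteq> W)"
      by (intro exI[of _ ?V] exI[of _ ?W] conjI open_region convex_region smooth) auto
  qed (use c in simp)
  moreover have "(\<lambda>i. (1 / c) * (\<epsilon> i)\<^sup>2) = a"
    using c by (simp add: \<epsilon>_sq)
  ultimately show ?thesis
    using near by auto
qed

section \<open>From tame functions to the three function classes\<close>

lemma partial_list_append: "partial_list (is @ js) h = partial_list is (partial_list js h)"
  by (simp add: partial_list_def)

lemma partial_list_cong:
  assumes "open U" "\<And>y. y \<in> U \<Longrightarrow> f y = g y" "x \<in> U"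
  shows "partial_list is f x = partial_list is g x"
  unfolding partial_list_eq_dir_derivs by (rule dir_derivs_cong[OF assms])

lemma F_continuous_of_continuous_on:
  assumes "continuous_on \<Omega> f"
  shows "F_continuous \<Omega> f"
  unfolding F_continuous_def
proof (intro ballI allI)
  fix x :: ell2 and n
  let ?p = "\<lambda>s. x + (\<Sum>j<n. s j *\<^sub>R unit_vec j)"
  have "continuous_on A (\<lambda>s::nat \<Rightarrow> real. s j)" for A j
    by (rule continuous_on_subset[OF continuous_on_product_coordinates]) simp
  then have "continuous_on A ?p" for A
    by (intro continuous_on_add continuous_on_sum continuous_on_scaleR continuous_on_const)
  then have "continuous_on ({x. \<forall>i\<ge>n. x i = 0} \<inter> {s. ?p s \<in> \<Omega>}) (\<lambda>s. f (?p s))"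
    by (intro continuous_on_compose2[OF assms]) auto
  then show "continuous_map (subtopology (Euclidean_space n) {s. ?p s \<in> \<Omega>}) euclideanreal (\<lambda>s. f (?p s))"
    unfolding Euclidean_space_def subtopology_subtopology euclidean_product_topology continuous_map_iff_continuous .
qed

lemma suminf_ennreal_le_of_partial_sums:
  assumes "\<And>i. 0 \<le> f i" "\<And>n. (\<Sum>i<n. f i) \<le> C"
  shows "suminf (\<lambda>i. ennreal (f i)) \<le> ennreal C"
  unfolding suminf_eq_SUP using assms by (intro SUP_least) (simp add: sum_ennreal ennreal_leI)

text \<open>A bound on absolute sums bounds each single term as well, so the power \<open>q\<close>
  costs at most the factor \<open>K powr (q - 1)\<close>. Thus exponent 1 settles every
  exponent.\<close>

lemma infsum_powr_le:
  fixes f :: "'i \<Rightarrow> real"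
  assumes "q \<ge> 1" and K: "\<And>S. finite S \<Longrightarrow> S \<subseteq> A \<Longrightarrow> (\<Sum>i\<in>S. \<bar>f i\<bar>) \<le> K"
  shows "(\<Sum>\<^sub>\<infinity>i\<in>A. ennreal (\<bar>f i\<bar> powr q)) \<le> ennreal (K * K powr (q - 1))"
proof (rule infsum_le_finite_sums)
  fix S assume S: "finite S" "S \<subseteq> A"
  have "\<bar>f i\<bar> powr q \<le> \<bar>f i\<bar> * K powr (q - 1)" if "i \<in> S" for i
  proof (cases "f i = 0")
    case False
    have "\<bar>f i\<bar> \<le> K"
      using K[of "{i}"] that S by auto
    then have "\<bar>f i\<bar> powr (q - 1) \<le> K powr (q - 1)"
      using \<open>q \<ge> 1\<close> by (intro powr_mono2) auto
    moreover have "\<bar>f i\<bar> powr q = \<bar>f i\<bar> * \<bar>f i\<bar> powr (q - 1)"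
      using False by (simp add: powr_diff)
    ultimately show ?thesis
      by (simp add: mult_left_mono)
  qed simp
  then have "(\<Sum>i\<in>S. \<bar>f i\<bar> powr q) \<le> (\<Sum>i\<in>S. \<bar>f i\<bar>) * K powr (q - 1)"
    unfolding sum_distrib_right by (intro sum_mono)
  also have "\<dots> \<le> K * K powr (q - 1)"
    by (intro mult_right_mono K S) auto
  finally show "(\<Sum>i\<in>S. ennreal (\<bar>f i\<bar> powr q)) \<le> ennreal (K * K powr (q - 1))"
    by (simp add: sum_ennreal ennreal_leI)
qed (rule nonneg_summable_on_complete, simp)

lemma strictly_inside_singleton:
  assumes "open \<Omega>" "x \<in> \<Omega>"
  shows "strictly_inside {x} \<Omega>"
proof -
  obtain r where "r > 0" "ball x r \<subseteq> \<Omega>"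
    using assms by (meson open_contains_ball)
  then show ?thesis
    unfolding strictly_inside_def by (intro exI[of _ r] conjI exI[of _ "norm x + 1"]) (auto simp: add_nonneg_pos)
qed

text \<open>One tame function has to serve all of \<open>E\<close>, not just a neighbourhood of each
  point: its global bounds then become the suprema over \<open>E\<close>. The open set
  \<open>W\<close> around \<open>E\<close> makes the partial derivatives agree on \<open>E\<close>
  too.\<close>

locale locally_tame =
  fixes a :: "nat \<Rightarrow> real" and \<Omega> :: "ell2 set" and \<Psi> :: "ell2 \<Rightarrow> real"
  assumes open_\<Omega>: "open \<Omega>"
    and local: "strictly_inside E \<Omega> \<Longrightarrow> \<exists>h W. tame a h \<and> open W \<and> E \<subseteq> W \<and> (\<forall>x\<in>W. \<Psi> x = h x)"
begin

lemma local_at: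
  assumes "x \<in> \<Omega>"
  obtains h W where "tame a h" "open W" "x \<in> W" "\<And>y. y \<in> W \<Longrightarrow> \<Psi> y = h y"
proof -
  obtain h W where "tame a h" "open W" "{x} \<subseteq> W" "\<forall>y\<in>W. \<Psi> y = h y"
    using local[OF strictly_inside_singleton[OF open_\<Omega> assms]] by blast
  then show ?thesis
    using that[of h W] by simp
qed

lemma has_dir_deriv_partial_list:
  assumes "x \<in> \<Omega>"
  shows "has_dir_deriv (partial_list is \<Psi>) (unit_vec i) x (partial_list (i # is) \<Psi> x)"
proof -
  obtain h W where h: "tame a h" "open W" "x \<in> W" "\<And>y. y \<in> W \<Longrightarrow> \<Psi> y = h y"
    using local_at[OF assms] by blast
  have eq: "partial_list js \<Psi> y = partial_list js h y" if "y \<in> W" for js y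
    by (rule partial_list_cong[OF h(2,4) that])
  show ?thesis
    using tame_has_dir_deriv[OF h(1), of "is" "unit_vec i" x] has_dir_deriv_cong[OF h(2,3) eq, where v = "unit_vec i"]
      eq[OF h(3), of "i # is"] by simp
qed

lemma continuous_on_partial_list: "continuous_on \<Omega> (partial_list is \<Psi>)"
proof (rule continuous_at_imp_continuous_on, rule ballI)
  fix x assume "x \<in> \<Omega>"
  then obtain h W where h: "tame a h" "open W" "x \<in> W" "\<And>y. y \<in> W \<Longrightarrow> \<Psi> y = h y"
    using local_at by blast
  obtain L where "L \<ge> 0" "\<forall>x y. \<bar>partial_list is h x - partial_list is h y\<bar> \<le> L * norm (x - y)"
    using tame_lipschitz[OF h(1)] by blast
  then have "continuous_on W (partial_list is h)"
    by (intro continuous_on_of_lipschitz[of _ _ L]) auto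
  then have "continuous_on W (partial_list is \<Psi>)"
    using partial_list_cong[OF h(2,4)] by (simp cong: continuous_on_cong)
  then show "isCont (partial_list is \<Psi>) x"
    using h(2,3) by (simp add: continuous_on_eq_continuous_at)
qed

lemma in_C_k: "partial_list js \<Psi> \<in> C_k k \<Omega>"
  unfolding C_k_def partials_exist_def
  using has_dir_deriv_partial_list continuous_on_partial_list
  by (auto simp: partial_list_append[symmetric] has_dir_deriv_def field_differentiable_def simp del: partial_list_Cons)

lemma in_C_infinity_F_infinity: "\<Psi> \<in> C_infinity_F_infinity \<Omega>"
proof -
  have "\<Psi> \<in> C_infinity \<Omega>"
    using in_C_k[of "[]"] by (auto simp: C_infinity_def)
  moreover have "D_mi \<alpha> \<Psi> \<in> C_1_F \<Omega>" for \<alpha>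
  proof -
    obtain js where js: "\<And>h. D_mi \<alpha> h = partial_list js h" "\<And>j. count_list js j = Poly_Mapping.lookup \<alpha> j"
      using D_mi_list[of \<alpha>] by blast
    have "(SUP x\<in>E. ennreal \<bar>partial_list js \<Psi> x\<bar> + suminf (\<lambda>i. ennreal (\<bar>partial i (partial_list js \<Psi>) x\<bar>\<^sup>2))) < \<infinity>"
      if "strictly_inside E \<Omega>" for E
    proof -
      obtain h W where h: "tame a h" "open W" "E \<subseteq> W" "\<And>y. y \<in> W \<Longrightarrow> \<Psi> y = h y"
        using local[OF \<open>strictly_inside E \<Omega>\<close>] by blast
      have eq: "partial_list js \<Psi> y = partial_list js h y" if "y \<in> W" for js y
        by (rule partial_list_cong[OF h(2,4) that])
      obtain B where B: "\<And>x. \<bar>partial_list js h x\<bar> \<le> B"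
        using tame_bounded[OF h(1)] by blast
      obtain L where L: "\<And>x y. \<bar>partial_list js h x - partial_list js h y\<bar> \<le> L * norm (x - y)"
        using tame_lipschitz[OF h(1)] by blast
      have cont: "continuous_on UNIV (partial_list is h)" for "is"
      proof -
        obtain L where "L \<ge> 0" "\<forall>x y. \<bar>partial_list is h x - partial_list is h y\<bar> \<le> L * norm (x - y)"
          using tame_lipschitz[OF h(1)] by blast
        then show ?thesis
          by (intro continuous_on_of_lipschitz[of _ _ L]) auto
      qed
      have "(SUP x\<in>E. ennreal \<bar>partial_list js \<Psi> x\<bar> + suminf (\<lambda>i. ennreal (\<bar>partial i (partial_list js \<Psi>) x\<bar>\<^sup>2)))
          \<le> ennreal B + ennreal (L\<^sup>2)"
      proof (rule SUP_least, rule add_mono)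
        fix x assume "x \<in> E"
        then have "x \<in> W" using h(3) by blast
        show "ennreal \<bar>partial_list js \<Psi> x\<bar> \<le> ennreal B"
          using B eq[OF \<open>x \<in> W\<close>] by (simp add: ennreal_leI)
        have "partial i (partial_list js \<Psi>) x = partial_list (i # js) h x" for i
          using eq[OF \<open>x \<in> W\<close>, of "i # js"] by (simp add: partial_eq_dir_deriv)
        \<comment> \<open>The Lipschitz constant of a partial derivative bounds the square sum of
          all partial derivatives one order higher.\<close>
        moreover have "(\<Sum>i<n. (partial_list (i # js) h x)\<^sup>2) \<le> L\<^sup>2" for n
          by (rule gradient_sum_le[OF _ cont L]) (use tame_has_dir_deriv[OF h(1)] in simp)
        ultimately show "suminf (\<lambda>i. ennreal (\<bar>partial i (partial_list js \<Psi>) x\<bar>\<^sup>2)) \<le> ennreal (L\<^sup>2)"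
          by (intro suminf_ennreal_le_of_partial_sums) auto
      qed
      also have "\<dots> < \<infinity>"
        by (simp add: ennreal_add_less_top)
      finally show ?thesis .
    qed
    then show ?thesis
      using in_C_k by (simp add: C_1_F_def js(1))
  qed
  ultimately show ?thesis
    by (simp add: C_infinity_F_infinity_def)
qed

lemma in_C_infinity_ell2: "\<Psi> \<in> C_infinity_ell2 \<Omega>"
proof (rule smooth_bounded_imp_C_infinity_ell2)
  fix x assume "x \<in> \<Omega>"
  then obtain h W where h: "tame a h" "open W" "x \<in> W" "\<And>y. y \<in> W \<Longrightarrow> \<Psi> y = h y"
    using local_at by blast
  obtain U where U: "open U" "x \<in> U" "smooth_bounded U h"
    using tame_smooth[OF h(1)] by blast
  have "smooth_bounded (U \<inter> W) \<Psi>"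
    by (rule smooth_bounded_cong[OF smooth_bounded_subset[OF U(3)]]) (use U(1) h(2,4) in auto)
  then show "\<exists>U. open U \<and> x \<in> U \<and> smooth_bounded U \<Psi>"
    using U h by (intro exI[of _ "U \<inter> W"]) auto
qed

lemma in_C_k_F:
  assumes "V \<subseteq> \<Omega>"
  shows "\<Psi> \<in> C_k_F k V"
proof -
  have c: "continuous_on V (partial_list is \<Psi>)" for "is"
    using continuous_on_partial_list assms by (rule continuous_on_subset)
  have "partials_exist k V \<Psi>"
    using in_C_k[of "[]" k] assms by (auto simp: C_k_def partials_exist_def)
  then show ?thesis
    unfolding C_k_F_def
    using F_continuous_of_continuous_on[OF c] borel_measurable_continuous_on_restrict[OF c] by simp
qed

lemma in_C_infinity_F_loc: "\<Psi> \<in> C_infinity_F_loc a \<Omega>"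
proof -
  have "\<Psi> \<in> C_k_q_F a k q V" if "q \<ge> 1" and V: "strictly_inside V \<Omega>" for k q V
  proof -
    have "V \<subseteq> \<Omega>"
      using V unfolding strictly_inside_def by (meson UN_subset_iff centre_in_ball subset_eq)
    obtain h W where h: "tame a h" "open W" "V \<subseteq> W" "\<And>y. y \<in> W \<Longrightarrow> \<Psi> y = h y"
      using local[OF V] by blast
    obtain K where K: "\<And>S x. finite S \<Longrightarrow> S \<subseteq> {\<alpha>. degree_mi \<alpha> \<le> k} \<Longrightarrow>
        (\<Sum>\<alpha>\<in>S. \<bar>power_mi a \<alpha> * D_mi \<alpha> h x\<bar>) \<le> K"
      using tame_weighted[OF h(1), of k] by blast
    have "(SUP x\<in>V. \<Sum>\<^sub>\<infinity>\<alpha>\<in>{\<alpha>. degree_mi \<alpha> \<le> k}. ennreal (\<bar>power_mi a \<alpha> * D_mi \<alpha> \<Psi> x\<bar> powr q))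
        \<le> ennreal (K * K powr (q - 1))"
    proof (rule SUP_least)
      fix x assume "x \<in> V"
      then have "D_mi \<alpha> \<Psi> x = D_mi \<alpha> h x" for \<alpha>
        unfolding D_mi_def using h(3) by (intro partial_list_cong[OF h(2,4)]) auto
      then show "(\<Sum>\<^sub>\<infinity>\<alpha>\<in>{\<alpha>. degree_mi \<alpha> \<le> k}. ennreal (\<bar>power_mi a \<alpha> * D_mi \<alpha> \<Psi> x\<bar> powr q))
          \<le> ennreal (K * K powr (q - 1))"
        using infsum_powr_le[OF \<open>q \<ge> 1\<close> K] by simp
    qed
    also have "\<dots> < \<infinity>" by simp
    finally show ?thesis
      unfolding C_k_q_F_def using in_C_k_F[OF \<open>V \<subseteq> \<Omega>\<close>] by blast
  qed
  then show ?thesis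
    unfolding C_infinity_F_loc_def C_k_q_F_loc_def using in_C_k_F[OF subset_refl] by auto
qed

end

text \<open>The case \<open>\<Omega> = UNIV\<close> is separate because \<open>infdist\<close> to the empty set is 0.\<close>

definition depth :: "ell2 set \<Rightarrow> ell2 \<Rightarrow> real"
  where "depth \<Omega> x = (if \<Omega> = UNIV then 1 / (1 + norm x) else min (infdist x (- \<Omega>)) (1 / (1 + norm x)))"

lemma inverse_one_plus_norm_lipschitz:
  fixes x y :: "'a::real_normed_vector"
  shows "\<bar>1 / (1 + norm x) - 1 / (1 + norm y)\<bar> \<le> norm (x - y)"
proof -
  have pos: "1 + norm x > 0" "1 + norm y > 0"
    by (auto intro: add_pos_nonneg)
  then have "1 / (1 + norm x) - 1 / (1 + norm y) = (norm y - norm x) / ((1 + norm x) * (1 + norm y))"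
    by (simp add: diff_frac_eq)
  then have "\<bar>1 / (1 + norm x) - 1 / (1 + norm y)\<bar> = \<bar>norm y - norm x\<bar> / ((1 + norm x) * (1 + norm y))"
    using pos by (simp add: abs_divide abs_mult)
  also have "\<dots> \<le> \<bar>norm y - norm x\<bar> / 1"
    using mult_mono[of 1 "1 + norm x" 1 "1 + norm y"] by (intro divide_left_mono) auto
  also have "\<dots> \<le> norm (x - y)"
    using norm_triangle_ineq3[of y x] by (simp add: norm_minus_commute)
  finally show ?thesis .
qed

lemma depth_lipschitz: "\<bar>depth \<Omega> x - depth \<Omega> y\<bar> \<le> norm (x - y)"
  using infdist_triangle_abs[of x "- \<Omega>" y] inverse_one_plus_norm_lipschitz[of x y]
  unfolding depth_def dist_norm by (auto simp: min_def abs_if split: if_splits)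

lemma depth_pos:
  assumes "open \<Omega>" "x \<in> \<Omega>"
  shows "depth \<Omega> x > 0"
proof -
  have "infdist x (- \<Omega>) > 0" if "\<Omega> \<noteq> UNIV"
    using assms that by (intro infdist_pos_not_in_closed) auto
  moreover have "1 / (1 + norm x) > 0"
    by (simp add: add_pos_nonneg)
  ultimately show ?thesis
    by (auto simp: depth_def)
qed

lemma depth_lower_bound:
  assumes "strictly_inside E \<Omega>"
  shows "\<exists>\<kappa>>0. \<forall>x\<in>E. \<kappa> \<le> depth \<Omega> x"
proof -
  obtain r R where r: "r > 0" "R > 0" "(\<Union>z\<in>E. ball z r) \<subseteq> \<Omega>" "E \<subseteq> ball 0 R"
    using assms unfolding strictly_inside_def by blast
  have "min r (1 / (1 + R)) \<le> depth \<Omega> x" if "x \<in> E" for x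
  proof -
    have "r \<le> infdist x (- \<Omega>)" if "\<Omega> \<noteq> UNIV"
    proof -
      have "r \<le> dist x y" if "y \<in> - \<Omega>" for y
        using r(3) \<open>x \<in> E\<close> that by (force simp: not_less[symmetric])
      then show ?thesis
        using \<open>\<Omega> \<noteq> UNIV\<close> by (auto simp: infdist_def intro!: cINF_greatest)
    qed
    moreover have "1 / (1 + R) \<le> 1 / (1 + norm x)"
      using r(4) that by (intro frac_le) (auto simp: dist_norm add_pos_nonneg)
    ultimately show ?thesis
      by (cases "\<Omega> = UNIV") (auto simp: depth_def intro: min.coboundedI1 min.coboundedI2)
  qed
  moreover have "min r (1 / (1 + R)) > 0"
    using r(1,2) by simp
  ultimately show ?thesis by blast
qed

text \<open>The two terms of the minimum answer the two clauses of \<open>strictly_inside\<close>: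
  the distance to the complement gives the radius, and \<open>1 / (1 + norm z)\<close> keeps the set
  bounded.\<close>

lemma strictly_inside_depth:
  assumes "\<delta> > 0"
  shows "strictly_inside {z. \<delta> \<le> depth \<Omega> z} \<Omega>"
  unfolding strictly_inside_def
proof (intro exI conjI)
  show "(\<Union>z\<in>{z. \<delta> \<le> depth \<Omega> z}. ball z \<delta>) \<subseteq> \<Omega>"
  proof
    fix y assume "y \<in> (\<Union>z\<in>{z. \<delta> \<le> depth \<Omega> z}. ball z \<delta>)"
    then obtain z where z: "\<delta> \<le> depth \<Omega> z" "dist z y < \<delta>" by auto
    show "y \<in> \<Omega>"
    proof (rule ccontr)
      assume "y \<notin> \<Omega>"
      then have "depth \<Omega> z \<le> infdist z (- \<Omega>)" "infdist z (- \<Omega>) \<le> dist z y"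
        by (auto simp: depth_def intro: infdist_le)
      then show False using z by linarith
    qed
  qed
  show "{z. \<delta> \<le> depth \<Omega> z} \<subseteq> ball 0 (1 / \<delta>)"
  proof
    fix z assume "z \<in> {z. \<delta> \<le> depth \<Omega> z}"
    then have "\<delta> \<le> 1 / (1 + norm z)"
      by (auto simp: depth_def split: if_splits)
    then have "1 + norm z \<le> 1 / \<delta>"
      using assms by (simp add: field_simps add_pos_nonneg)
    then show "z \<in> ball 0 (1 / \<delta>)"
      by (simp add: dist_norm)
  qed
qed (use assms in auto)

theorem theorem3p4:
  fixes a :: "nat \<Rightarrow> real" and \<Omega> :: "ell2 set"
  assumes "\<And>i. a i > 0" and "summable a"
    and "open \<Omega>" and "\<Omega> \<noteq> {}"
  shows "\<exists>\<Psi> :: ell2 \<Rightarrow> real. (\<forall>x\<in>\<Omega>. \<Psi> x > 0) \<and> exhaustion_function \<Omega> \<Psi> \<and>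
    \<Psi> \<in> C_infinity_F_infinity \<Omega> \<inter> C_infinity_ell2 \<Omega> \<inter> C_infinity_F_loc a \<Omega>"
proof -
  let ?d = "depth \<Omega>"
  define \<delta> :: "nat \<Rightarrow> real" where "\<delta> n = (1 / 2) ^ n" for n
  have \<delta>: "\<delta> n > 0" for n
    by (simp add: \<delta>_def)
  have \<delta>_mono: "\<delta> n \<le> \<delta> m" if "m \<le> n" for m n
    unfolding \<delta>_def using that by (intro power_decreasing) auto
  have "\<exists>h. tame a h \<and> (\<forall>x. 0 \<le> h x) \<and> (\<forall>x. ?d x \<le> \<delta> n \<longrightarrow> h x = 1) \<and> (\<forall>x. 2 * \<delta> n \<le> ?d x \<longrightarrow> h x = 0)" for n
  proof -
    \<comment> \<open>A ramp in the depth of slope \<open>2 / \<delta> n\<close>, equal to 1 up to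
      depth \<open>5 / 4 * \<delta> n\<close> and to 0 from \<open>7 / 4 * \<delta> n\<close> on.
      The margin \<open>\<delta> n / 4\<close> on both sides is spent on the approximation
      radius.\<close>
    define g where "g x = max 0 (min 1 ((7 / 4 * \<delta> n - ?d x) * (2 / \<delta> n)))" for x
    have "\<bar>g x - g y\<bar> \<le> 2 / \<delta> n * norm (x - y)" for x y
    proof -
      have "\<bar>g x - g y\<bar> \<le> \<bar>(7 / 4 * \<delta> n - ?d x) * (2 / \<delta> n) - (7 / 4 * \<delta> n - ?d y) * (2 / \<delta> n)\<bar>"
        unfolding g_def by (auto simp: max_def min_def abs_if split: if_splits)
      also have "\<dots> = \<bar>2 / \<delta> n * (?d y - ?d x)\<bar>"
        by (simp add: algebra_simps)
      also have "\<dots> = 2 / \<delta> n * \<bar>?d y - ?d x\<bar>"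
        unfolding abs_mult using \<delta>[of n] by simp
      also have "\<dots> \<le> 2 / \<delta> n * norm (x - y)"
        using depth_lipschitz[of \<Omega> y x] \<delta>[of n] by (intro mult_left_mono) (auto simp: norm_minus_commute)
      finally show ?thesis .
    qed
    moreover have "\<bar>g x\<bar> \<le> 1" for x
      by (simp add: g_def)
    ultimately obtain h where h: "tame a h" "\<And>x c e. (\<forall>y\<in>cball x (\<delta> n / 4). \<bar>g y - c\<bar> \<le> e) \<Longrightarrow> \<bar>h x - c\<bar> \<le> e"
      using mollified_approximation[OF assms(1,2), of "\<delta> n / 4" g "2 / \<delta> n" 1] \<delta>[of n] by auto
    have d: "\<bar>?d y - ?d x\<bar> \<le> \<delta> n / 4" if "y \<in> cball x (\<delta> n / 4)" for x y
      using depth_lipschitz[of \<Omega> y x] that by (simp add: dist_norm norm_minus_commute)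
    \<comment> \<open>The range [0, 1] is expressed as closeness to \<open>1 / 2\<close>, the form
      in which \<open>h\<close> inherits it.\<close>
    have "\<bar>g y - 1 / 2\<bar> \<le> 1 / 2" for y
    proof -
      have "0 \<le> g y" "g y \<le> 1"
        by (simp_all add: g_def)
      then show ?thesis
        by linarith
    qed
    then have "\<bar>h x - 1 / 2\<bar> \<le> 1 / 2" for x
      by (intro h(2)) simp
    then have "0 \<le> h x" for x
      by (smt (verit) field_sum_of_halves)
    moreover have "h x = 1" if "?d x \<le> \<delta> n" for x
    proof -
      have "g y = 1" if "y \<in> cball x (\<delta> n / 4)" for y
      proof -
        have "1 / 2 * \<delta> n \<le> 7 / 4 * \<delta> n - ?d y"
          using d[OF that] \<open>?d x \<le> \<delta> n\<close> by linarith
        then have "1 / 2 * \<delta> n * (2 / \<delta> n) \<le> (7 / 4 * \<delta> n - ?d y) * (2 / \<delta> n)"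
          using \<delta>[of n] by (intro mult_right_mono) auto
        then show ?thesis
          using \<delta>[of n] by (simp add: g_def)
      qed
      then show ?thesis
        using h(2)[of x 1 0] by simp
    qed
    moreover have "h x = 0" if "2 * \<delta> n \<le> ?d x" for x
    proof -
      have "g y = 0" if "y \<in> cball x (\<delta> n / 4)" for y
      proof -
        have "7 / 4 * \<delta> n - ?d y \<le> 0"
          using d[OF that] \<open>2 * \<delta> n \<le> ?d x\<close> by linarith
        then have "(7 / 4 * \<delta> n - ?d y) * (2 / \<delta> n) \<le> 0"
          using \<delta>[of n] by (intro mult_nonpos_nonneg) auto
        then show ?thesis
          by (simp add: g_def)
      qed
      then show ?thesis
        using h(2)[of x 0 0] by simp
    qed
    ultimately show ?thesis
      using h(1) by blast
  qed
  then obtain h where h: "\<And>n. tame a (h n)" "\<And>n x. 0 \<le> h n x" "\<And>n x. ?d x \<le> \<delta> n \<Longrightarrow> h n x = 1"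
    "\<And>n x. 2 * \<delta> n \<le> ?d x \<Longrightarrow> h n x = 0"
    by metis
  define \<Psi> where "\<Psi> x = 1 + suminf (\<lambda>n. h n x)" for x
  \<comment> \<open>The index \<open>N\<close> depends on the depth alone and not on the point, so
    the series has a fixed number of nonzero terms wherever the depth is at least
    \<open>\<kappa>\<close>.\<close>
  have vanish: "\<exists>N. \<forall>n\<ge>N. \<forall>x. \<kappa> \<le> ?d x \<longrightarrow> h n x = 0" if \<kappa>: "\<kappa> > 0" for \<kappa>
  proof -
    obtain N where N: "\<delta> N < \<kappa> / 2"
    proof -
      have "\<exists>n. (1 / 2) ^ n < \<kappa> / 2"
        using \<kappa> by (intro real_arch_pow_inv) auto
      then show ?thesis
        using that unfolding \<delta>_def by blast
    qed
    have "h n x = 0" if "n \<ge> N" "\<kappa> \<le> ?d x" for n x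
      using h(4)[of n x] \<delta>_mono[OF that(1)] N that(2) by linarith
    then show ?thesis by blast
  qed
  have \<Psi>_sum: "\<Psi> x = 1 + (\<Sum>n<N. h n x)" if "\<forall>n\<ge>N. h n x = 0" for x N
    unfolding \<Psi>_def using that by (subst suminf_finite[of "{..<N}"]) auto
  \<comment> \<open>Membership in \<Omega> makes the depth positive and the series finite; outside
    \<Omega> the depth is 0 and every term equals 1.\<close>
  have \<Psi>_ge: "1 + (\<Sum>n<m. h n x) \<le> \<Psi> x" if x: "x \<in> \<Omega>" for x m
  proof -
    obtain N where N: "\<forall>n\<ge>N. h n x = 0"
      using vanish[OF depth_pos[OF assms(3) x]] by blast
    then have "\<Psi> x = 1 + (\<Sum>n<max N m. h n x)"
      by (intro \<Psi>_sum) auto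
    moreover have "(\<Sum>n<m. h n x) \<le> (\<Sum>n<max N m. h n x)"
      using h(2) by (intro sum_mono2) auto
    ultimately show ?thesis by simp
  qed
  interpret locally_tame a \<Omega> \<Psi>
  proof
    show "open \<Omega>" by fact
    fix E assume "strictly_inside E \<Omega>"
    then obtain \<kappa> where \<kappa>: "\<kappa> > 0" "\<And>x. x \<in> E \<Longrightarrow> \<kappa> \<le> ?d x"
      using depth_lower_bound by blast
    obtain N where N: "\<And>n x. n \<ge> N \<Longrightarrow> \<kappa> / 2 \<le> ?d x \<Longrightarrow> h n x = 0"
      using vanish[of "\<kappa> / 2"] \<kappa>(1) by auto
    \<comment> \<open>Halving \<open>\<kappa>\<close> leaves room for an open neighbourhood of
      \<open>E\<close> on which the same finite sum represents \<open>\<Psi>\<close>.\<close>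
    let ?W = "{x. \<kappa> / 2 < ?d x}"
    have "continuous_on UNIV ?d"
      by (rule continuous_on_of_lipschitz[of _ _ 1]) (use depth_lipschitz in auto)
    then have "open ?W"
      by (intro open_Collect_less) auto
    moreover have "E \<subseteq> ?W"
      using \<kappa> by force
    moreover have "\<forall>x\<in>?W. \<Psi> x = 1 + (\<Sum>n<N. h n x)"
      using N by (intro ballI \<Psi>_sum) auto
    moreover have "tame a (\<lambda>x. 1 + (\<Sum>n<N. h n x))"
      by (intro tame_add tame_const tame_sum h(1))
    ultimately show "\<exists>h W. tame a h \<and> open W \<and> E \<subseteq> W \<and> (\<forall>x\<in>W. \<Psi> x = h x)"
      by blast
  qed
  have "\<Psi> x > 0" if "x \<in> \<Omega>" for x
    using \<Psi>_ge[OF that, of 0] by simp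
  moreover have "exhaustion_function \<Omega> \<Psi>"
    unfolding exhaustion_function_def
  proof
    fix t
    obtain m where m: "t < real m"
      using reals_Archimedean2 by blast
    have "{z \<in> \<Omega>. \<Psi> z \<le> t} \<subseteq> {z. \<delta> m \<le> ?d z}"
    proof (intro subsetI CollectI)
      fix z assume z: "z \<in> {z \<in> \<Omega>. \<Psi> z \<le> t}"
      show "\<delta> m \<le> ?d z"
      \<comment> \<open>At depth below \<open>\<delta> m\<close> the first \<open>m\<close> terms
        are all 1, so \<open>\<Psi> z\<close> is at least \<open>1 + m\<close> and exceeds
        \<open>t\<close>.\<close>
      proof (rule ccontr)
        assume "\<not> \<delta> m \<le> ?d z"
        then have "h n z = 1" if "n < m" for n
          using \<delta>_mono[of n m] that by (intro h(3)) simp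
        then have "(\<Sum>n<m. h n z) = real m"
          by simp
        then show False
          using \<Psi>_ge[of z m] z m by simp
      qed
    qed
    then show "strictly_inside {z \<in> \<Omega>. \<Psi> z \<le> t} \<Omega>"
      using strictly_inside_depth[OF \<delta>[of m], of \<Omega>] unfolding strictly_inside_def by (meson UN_mono subset_refl subset_trans)
  qed
  ultimately show ?thesis
    using in_C_infinity_F_infinity in_C_infinity_ell2 in_C_infinity_F_loc by blast
qed

end
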